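(* Assuming generalized unclonable puncturable obfuscation (generalized UPO) for $\mathsf{P/poly}$, there exists a one-time unclonable bit-encryption scheme in the plain model.
   Context: QPT means quantum polynomial time. "Plain model" means that no oracle (such as a random oracle) is used. **Keyed circuit class.** A class $\mathfrak{C}=\{\mathfrak{C}_\lambda\}_{\lambda\in\mathbb{N}}$ with $\mathfrak{C}_\lambda=\{C_k:k\in\mathcal{K}_\lambda\}$, where each $C_k$ is a polynomial-size classical circuit with input length $n(\lambda)$ and output length $m(\lambda)$, all circuits in $\mathfrak{C}_\lambda$ having the same size. It is *generalized puncturable* if it is equipped with a polynomial-time algorithm $\mathsf{GenPuncture}$ which, on $k\in\mathcal{K}_\lambda$, points $x^{\mathcal B},x^{\mathcal C}\in\{0,1\}^n$ and polynomial-size circuits $\mu_{\mathcal B},\mu_{\mathcal C}:\{0,1\}^n\to\{0,1\}^m$, outputs a circuit $G_{k^*}$ (without loss of generality of the same size as $C_k$) such that $G_{k^*}(x)=C_k(x)$ for $x\notin\{x^{\mathcal B},x^{\mathcal C}\}$, $G_{k^*}(x^{\mathcal B})=\mu_{\mathcal B}(x^{\mathcal B})$ and, if $x^{\mathcal C}\neq x^{\mathcal B}$, $G_{k^*}(x^{\mathcal C})=\mu_{\mathcal C}(x^{\mathcal C})$. **Generalized UPO.** A UPO scheme for $\mathfrak{C}$ is a pair of QPT algorithms $\mathsf{Obf}(1^\lambda,C)\to\rho_C$ and $\mathsf{Eval}(\rho_C,x)\to(\rho'_C,y)$. Correctness: for every $C\in\mathfrak{C}_\lambda$ and every $x\in\{0,1\}^{n(\lambda)}$,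 $y=C(x)$ with probability negligibly close to 1. Generalized UPO security with respect to a distribution $\mathcal{D}_{\mathcal X}$ on $\{0,1\}^n\times\{0,1\}^n$: for every QPT $(\mathcal{A},\mathcal{B},\mathcal{C})$ the following experiment, with uniform $b\in\{0,1\}$, outputs 1 with probability at most $\frac12+\mathsf{negl}(\lambda)$. $\mathcal{A}$ sends $(k,\mu_{\mathcal B},\mu_{\mathcal C})$; the challenger samples $(x^{\mathcal B},x^{\mathcal C})\leftarrow\mathcal{D}_{\mathcal X}(1^\lambda)$, computes $G_{k^*}\leftarrow\mathsf{GenPuncture}(k,x^{\mathcal B},x^{\mathcal C},\mu_{\mathcal B},\mu_{\mathcal C})$, and sends $\mathcal{A}$ the state $\mathsf{Obf}(1^\lambda,C_k)$ if $b=0$ and $\mathsf{Obf}(1^\lambda,G_{k^*})$ if $b=1$; $\mathcal{A}$ outputs a bipartite state $\sigma$; $(\mathcal{B}(x^{\mathcal B},\cdot)\otimes\mathcal{C}(x^{\mathcal C},\cdot))(\sigma)$ gives $(b_{\mathcal B},b_{\mathcal C})$; output 1 iff $b_{\mathcal B}=b_{\mathcal C}=b$. "Generalized UPO for $\mathsf{P/poly}$" means generalized UPO for any generalized puncturable keyed circuit class in $\mathsf{P/poly}$; here the challenge distribution $\mathcal{D}_{\mathcal X}$ is the identical one, which samples $x\in\{0,1\}^n$ uniformly and outputs $(x,x)$. **One-time unclonable bit encryption.** QPT algorithms $\mathsf{Gen}(1^\lambda)\to sk$ (classical key), $\mathsf{Enc}(sk,m)\to\rho_{ct}$ (quantum ciphertext,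 for a one-bit message $m$), $\mathsf{Dec}(sk,\rho_{ct})\to m'$. Correctness: for every $m$, decrypting $\mathsf{Enc}(sk,m)$ with $sk\leftarrow\mathsf{Gen}(1^\lambda)$ gives $m$ with probability at least $1-\mathsf{negl}(\lambda)$. Security (unclonable indistinguishability): for every QPT $(\mathcal{A},\mathcal{B},\mathcal{C})$ the following outputs 1 with probability at most $\frac12+\mathsf{negl}(\lambda)$: $sk\leftarrow\mathsf{Gen}(1^\lambda)$; $\mathcal{A}$ sends messages $(m_0,m_1)$; the challenger picks a uniform bit $b$ and gives $\mathcal{A}$ the ciphertext $\rho_{ct}\leftarrow\mathsf{Enc}(sk,m_b)$; $\mathcal{A}$ outputs a bipartite state $\sigma$; $(\mathcal{B}(sk,\cdot)\otimes\mathcal{C}(sk,\cdot))(\sigma)$ gives $(b^{\mathcal B},b^{\mathcal C})$; output 1 iff $b^{\mathcal B}=b^{\mathcal C}=b$. "One-time" means that $\mathcal{A}$ receives a single ciphertext and no encryption oracle or public key. *)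

theory Defs
  imports
    "HOL-Probability.SPMF"
    "HOL-Computational_Algebra.Polynomial"
    "HOL-Library.Landau_Symbols"
begin

section \<open>Asymptotics\<close>

definition negligible :: "(nat \<Rightarrow> real) \<Rightarrow> bool" where
  "negligible f \<longleftrightarrow> (\<forall>c::nat. f \<in> O(\<lambda>n. 1 / real n ^ c))"

definition poly_bounded :: "(nat \<Rightarrow> nat) \<Rightarrow> bool" where
  "poly_bounded f \<longleftrightarrow> (\<exists>p :: nat poly. \<forall>n. f n \<le> poly p n)"


section \<open>Boolean circuits\<close>

type_synonym bits = "bool list"

text \<open>Wires are numbered consecutively: first the inputs, then the gates in order.\<close>

datatype gate = Const bool | Nand nat nat

datatype circuit = Circuit (inputs: nat) (gates: "gate list") (outputs: "nat list")

fun gate_ok :: "nat \<Rightarrow> gate \<Rightarrow> bool" where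
  "gate_ok w (Const b) \<longleftrightarrow> True"
| "gate_ok w (Nand i j) \<longleftrightarrow> i < w \<and> j < w"

definition circuit_io :: "nat \<Rightarrow> nat \<Rightarrow> circuit \<Rightarrow> bool" where
  "circuit_io n m C \<longleftrightarrow> inputs C = n \<and> length (outputs C) = m \<and>
     (\<forall>i < length (gates C). gate_ok (n + i) (gates C ! i)) \<and>
     (\<forall>w \<in> set (outputs C). w < n + length (gates C))"

definition circuit_size :: "circuit \<Rightarrow> nat" where
  "circuit_size C = inputs C + length (gates C) + length (outputs C)"

fun gate_value :: "bits \<Rightarrow> gate \<Rightarrow> bool" where
  "gate_value vs (Const b) = b"
| "gate_value vs (Nand i j) = (\<not> (vs ! i \<and> vs ! j))"

definition eval_circuit :: "circuit \<Rightarrow> bits \<Rightarrow> bits" where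
  "eval_circuit C x =
     (let vs = foldl (\<lambda>vs g. vs @ [gate_value vs g]) x (gates C)
      in map ((!) vs) (outputs C))"

text \<open>Circuits as bit strings. Numbers are in unary, which makes the description polynomially
  longer than the circuit size.\<close>

definition unary :: "nat \<Rightarrow> bits" where
  "unary n = replicate n True @ [False]"

fun encode_gate :: "gate \<Rightarrow> bits" where
  "encode_gate (Const b) = [False, b]"
| "encode_gate (Nand i j) = True # unary i @ unary j"

definition encode_circuit :: "circuit \<Rightarrow> bits" where
  "encode_circuit C = unary (inputs C) @
     unary (length (gates C)) @ concat (map encode_gate (gates C)) @
     unary (length (outputs C)) @ concat (map unary (outputs C))"

lemma unary_append_eq: "unary m @ u = unary n @ v \<longleftrightarrow> m = n \<and> u = v"
proof (induction m arbitrary: n)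
  case 0
  then show ?case by (cases n) (auto simp: unary_def)
next
  case (Suc m)
  then show ?case by (cases n) (auto simp: unary_def)
qed

lemma encode_gate_append_eq: "encode_gate g @ u = encode_gate h @ v \<longleftrightarrow> g = h \<and> u = v"
  by (cases g; cases h) (auto simp: unary_append_eq)

lemma concat_encode_append_eq:
  assumes "\<And>a b u v. f a @ u = f b @ v \<longleftrightarrow> a = b \<and> u = v" and "length xs = length ys"
  shows "concat (map f xs) @ u = concat (map f ys) @ v \<longleftrightarrow> xs = ys \<and> u = v"
  using assms(2) by (induction xs ys rule: list_induct2) (auto simp: assms(1))

lemma inj_encode_circuit: "inj encode_circuit"
proof (rule injI)
  fix C D assume "encode_circuit C = encode_circuit D"
  then have eq: "inputs C = inputs D" "length (gates C) = length (gates D)"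
    "concat (map encode_gate (gates C)) @ unary (length (outputs C)) @ concat (map unary (outputs C)) =
     concat (map encode_gate (gates D)) @ unary (length (outputs D)) @ concat (map unary (outputs D))"
    by (simp_all add: encode_circuit_def unary_append_eq)
  from eq(3) have g: "gates C = gates D" and
    o: "unary (length (outputs C)) @ concat (map unary (outputs C)) =
        unary (length (outputs D)) @ concat (map unary (outputs D))"
    by (simp_all add: concat_encode_append_eq[OF encode_gate_append_eq eq(2)])
  from o have "length (outputs C) = length (outputs D)"
    "concat (map unary (outputs C)) @ [] = concat (map unary (outputs D)) @ []"
    by (simp_all add: unary_append_eq)
  then have "outputs C = outputs D"
    using concat_encode_append_eq[of unary, OF unary_append_eq] by blast
  with eq(1) g show "C = D" by (simp add: circuit.expand)
qed

definition decode_circuit :: "bits \<Rightarrow> circuit" where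
  "decode_circuit = inv encode_circuit"

lemma decode_encode_circuit [simp]: "decode_circuit (encode_circuit C) = C"
  by (simp add: decode_circuit_def inj_encode_circuit)

definition is_circuit_code :: "nat \<Rightarrow> nat \<Rightarrow> bits \<Rightarrow> bool" where
  "is_circuit_code n m w \<longleftrightarrow> (\<exists>C. circuit_io n m C \<and> w = encode_circuit C)"


section \<open>Quantum systems\<close>

text \<open>All qubits that exist in an experiment form one system. The basis state indexed by a set
  \<open>S\<close> of qubit names is the one in which exactly the qubits in \<open>S\<close> are 1. Qubits not yet allocated
  are 0, so allocation leaves the amplitudes unchanged.\<close>

record qsys =
  nqubits :: nat
  amp :: "nat set \<Rightarrow> complex"

definition vacuum :: qsys where
  "vacuum = \<lparr>nqubits = 0, amp = (\<lambda>S. if S = {} then 1 else 0)\<rparr>"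

definition unit_state :: "qsys \<Rightarrow> bool" where
  "unit_state Q \<longleftrightarrow> (\<forall>S. \<not> S \<subseteq> {..<nqubits Q} \<longrightarrow> amp Q S = 0) \<and>
     (\<Sum>S\<in>Pow {..<nqubits Q}. (cmod (amp Q S))\<^sup>2) = 1"

definition hadamard :: "nat \<Rightarrow> qsys \<Rightarrow> qsys" where
  "hadamard i Q = Q\<lparr>amp := (\<lambda>S.
     (amp Q (S - {i}) + (if i \<in> S then - 1 else 1) * amp Q (insert i S)) / complex_of_real (sqrt 2))\<rparr>"

definition t_gate :: "nat \<Rightarrow> qsys \<Rightarrow> qsys" where
  "t_gate i Q = Q\<lparr>amp := (\<lambda>S. (if i \<in> S then cis (pi / 4) else 1) * amp Q S)\<rparr>"

text \<open>Control \<open>i\<close>, target \<open>j\<close>, with \<open>i \<noteq> j\<close>.\<close>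

definition cnot :: "nat \<Rightarrow> nat \<Rightarrow> qsys \<Rightarrow> qsys" where
  "cnot i j Q = Q\<lparr>amp := (\<lambda>S.
     amp Q (if i \<in> S then (if j \<in> S then S - {j} else insert j S) else S))\<rparr>"

definition prob_outcome :: "nat \<Rightarrow> bool \<Rightarrow> qsys \<Rightarrow> real" where
  "prob_outcome i b Q = (\<Sum>S | S \<subseteq> {..<nqubits Q} \<and> (i \<in> S) = b. (cmod (amp Q S))\<^sup>2)"

definition collapse :: "nat \<Rightarrow> bool \<Rightarrow> qsys \<Rightarrow> qsys" where
  "collapse i b Q = Q\<lparr>amp := (\<lambda>S.
     if (i \<in> S) = b then amp Q S / complex_of_real (sqrt (prob_outcome i b Q)) else 0)\<rparr>"


section \<open>Quantum algorithms\<close>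

text \<open>A uniform quantum algorithm is a structured program that controls stacks of bits
  (\<open>creg\<close>) and stacks of qubits (\<open>qreg\<close>, which hold the names of the qubits in the common system).
  The classical part is a multi-stack machine. On qubits it can use the universal gate
  set Hadamard, T, CNOT on the topmost elements of stacks, allocation in state 0, and measurement
  in the computational basis. A program can only act on qubits that are named in its own memory,
  and no instruction duplicates a name. A register is copied classically in one step; this
  never produces a register longer than the existing ones, so that after \<open>t\<close> steps registers
  have grown by at most \<open>t\<close>.

  Instructions without the required operands do nothing.\<close>

record mem =
  creg :: "nat \<Rightarrow> bits"
  qreg :: "nat \<Rightarrow> nat list"

datatype instr =
    Skip
  | Push nat bool
  | Pop nat
  | Copy nat nat \<comment> \<open>source, target\<close>
  | New nat
  | Move nat nat \<comment> \<open>source, target\<close>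
  | Had nat
  | Tgate nat
  | Cnot nat nat \<comment> \<open>control, target\<close>
  | Measure nat nat \<comment> \<open>quantum register, classical register for the outcome\<close>

datatype guard = Nonempty nat | Top nat | QNonempty nat

datatype prog =
    Do instr
  | Seq prog prog
  | Cond guard prog prog
  | While guard prog

fun step :: "instr \<Rightarrow> mem \<times> qsys \<Rightarrow> (mem \<times> qsys) spmf" where
  "step Skip (s, Q) = return_spmf (s, Q)"
| "step (Push r b) (s, Q) = return_spmf (s\<lparr>creg := (creg s)(r := b # creg s r)\<rparr>, Q)"
| "step (Pop r) (s, Q) = return_spmf (s\<lparr>creg := (creg s)(r := tl (creg s r))\<rparr>, Q)"
| "step (Copy r r') (s, Q) = return_spmf (s\<lparr>creg := (creg s)(r' := creg s r)\<rparr>, Q)"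
| "step (New q) (s, Q) =
     return_spmf (s\<lparr>qreg := (qreg s)(q := nqubits Q # qreg s q)\<rparr>, Q\<lparr>nqubits := Suc (nqubits Q)\<rparr>)"
| "step (Move q q') (s, Q) =
     (case qreg s q of
        [] \<Rightarrow> return_spmf (s, Q)
      | i # is \<Rightarrow> (let f = (qreg s)(q := is) in return_spmf (s\<lparr>qreg := f(q' := i # f q')\<rparr>, Q)))"
| "step (Had q) (s, Q) =
     (case qreg s q of [] \<Rightarrow> return_spmf (s, Q) | i # is \<Rightarrow> return_spmf (s, hadamard i Q))"
| "step (Tgate q) (s, Q) =
     (case qreg s q of [] \<Rightarrow> return_spmf (s, Q) | i # is \<Rightarrow> return_spmf (s, t_gate i Q))"
| "step (Cnot q q') (s, Q) =
     (if q = q' \<or> qreg s q = [] \<or> qreg s q' = [] then return_spmf (s, Q)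
      else return_spmf (s, cnot (hd (qreg s q)) (hd (qreg s q')) Q))"
| "step (Measure q r) (s, Q) =
     (case qreg s q of
        [] \<Rightarrow> return_spmf (s, Q)
      | i # is \<Rightarrow> map_spmf
          (\<lambda>b. (s\<lparr>creg := (creg s)(r := b # creg s r), qreg := (qreg s)(q := is)\<rparr>, collapse i b Q))
          (spmf_of_pmf (bernoulli_pmf (prob_outcome i True Q))))"

fun holds :: "guard \<Rightarrow> mem \<Rightarrow> bool" where
  "holds (Nonempty r) s \<longleftrightarrow> creg s r \<noteq> []"
| "holds (Top r) s \<longleftrightarrow> creg s r \<noteq> [] \<and> hd (creg s r)"
| "holds (QNonempty q) s \<longleftrightarrow> qreg s q \<noteq> []"

partial_function (spmf) while_spmf :: "('s \<Rightarrow> bool) \<Rightarrow> ('s \<Rightarrow> 's spmf) \<Rightarrow> 's \<Rightarrow> 's spmf" where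
  "while_spmf g f s = (if g s then bind_spmf (f s) (while_spmf g f) else return_spmf s)"

text \<open>The last component of a configuration counts the executed instructions and guards
  (except for the final, failing test of a loop). Non-termination is missing probability mass.\<close>

fun exec :: "prog \<Rightarrow> (mem \<times> qsys) \<times> nat \<Rightarrow> ((mem \<times> qsys) \<times> nat) spmf" where
  "exec (Do i) (s, t) = map_spmf (\<lambda>s'. (s', Suc t)) (step i s)"
| "exec (Seq c d) (s, t) = bind_spmf (exec c (s, t)) (exec d)"
| "exec (Cond g c d) (s, t) = (if holds g (fst s) then exec c (s, Suc t) else exec d (s, Suc t))"
| "exec (While g c) (s, t) =
     while_spmf (\<lambda>(s, t). holds g (fst s)) (\<lambda>(s, t). exec c (s, Suc t)) (s, t)"

definition run :: "prog \<Rightarrow> mem \<Rightarrow> qsys \<Rightarrow> (mem \<times> qsys) spmf" where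
  "run c s Q = map_spmf fst (exec c ((s, Q), 0))"

definition runs_within :: "prog \<Rightarrow> mem \<Rightarrow> qsys \<Rightarrow> nat \<Rightarrow> bool" where
  "runs_within c s Q T \<longleftrightarrow> lossless_spmf (exec c ((s, Q), 0)) \<and>
     (\<forall>(s', t) \<in> set_spmf (exec c ((s, Q), 0)). t \<le> T)"

definition owns :: "mem \<Rightarrow> qsys \<Rightarrow> bool" where
  "owns s Q \<longleftrightarrow> (\<forall>q. distinct (qreg s q) \<and> set (qreg s q) \<subseteq> {..<nqubits Q}) \<and>
     (\<forall>q q'. q \<noteq> q' \<longrightarrow> set (qreg s q) \<inter> set (qreg s q') = {})"

text \<open>The running time is bounded for every initial memory, of which the program holds a part of an
  arbitrary joint state.\<close>

definition qpt :: "prog \<Rightarrow> bool" where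
  "qpt c \<longleftrightarrow> (\<exists>p :: nat poly. \<forall>s Q N.
     unit_state Q \<and> owns s Q \<and> (\<forall>r. length (creg s r) \<le> N \<and> length (qreg s r) \<le> N) \<longrightarrow>
     runs_within c s Q (poly p N))"

fun classical_instr :: "instr \<Rightarrow> bool" where
  "classical_instr Skip \<longleftrightarrow> True"
| "classical_instr (Push r b) \<longleftrightarrow> True"
| "classical_instr (Pop r) \<longleftrightarrow> True"
| "classical_instr (Copy r r') \<longleftrightarrow> True"
| "classical_instr _ \<longleftrightarrow> False"

fun classical_guard :: "guard \<Rightarrow> bool" where
  "classical_guard (QNonempty q) \<longleftrightarrow> False"
| "classical_guard _ \<longleftrightarrow> True"

fun classical :: "prog \<Rightarrow> bool" where
  "classical (Do i) \<longleftrightarrow> classical_instr i"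
| "classical (Seq c d) \<longleftrightarrow> classical c \<and> classical d"
| "classical (Cond g c d) \<longleftrightarrow> classical_guard g \<and> classical c \<and> classical d"
| "classical (While g c) \<longleftrightarrow> classical_guard g \<and> classical c"

text \<open>Classical arguments are passed in the registers 0, 1, ...; a quantum argument is passed in
  quantum register 0. Every algorithm receives the security parameter in unary as its
  argument 0.\<close>

definition load :: "bits list \<Rightarrow> nat list \<Rightarrow> mem" where
  "load args qs = \<lparr>creg = (\<lambda>r. if r < length args then args ! r else []),
                  qreg = (\<lambda>q. if q = 0 then qs else [])\<rparr>"

definition sec_param :: "nat \<Rightarrow> bits" where
  "sec_param l = replicate l True"

definition bit_of :: "bits \<Rightarrow> bool" where
  "bit_of w \<longleftrightarrow> w \<noteq> [] \<and> hd w"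

text \<open>A quantum message is a register of qubits of the common system together with a classical
  string.\<close>

type_synonym qmsg = "bits \<times> nat list"

definition msg_out :: "nat \<Rightarrow> mem \<Rightarrow> qmsg" where
  "msg_out r s = (creg s r, qreg s r)"

definition receive :: "qmsg \<Rightarrow> mem \<Rightarrow> mem" where
  "receive msg s = s\<lparr>creg := (creg s)(0 := fst msg), qreg := (qreg s)(0 := snd msg)\<rparr>"


section \<open>Generalized puncturable keyed circuit classes\<close>

record keyed_class =
  keys :: "nat \<Rightarrow> bits set"
  inlen :: "nat \<Rightarrow> nat"
  outlen :: "nat \<Rightarrow> nat"
  csize :: "nat \<Rightarrow> nat"
  circ :: "nat \<Rightarrow> bits \<Rightarrow> circuit"
  gen_puncture :: "nat \<Rightarrow> bits \<Rightarrow> bits \<Rightarrow> bits \<Rightarrow> circuit \<Rightarrow> circuit \<Rightarrow> circuit"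

definition keyed_circuit_class :: "keyed_class \<Rightarrow> bool" where
  "keyed_circuit_class \<CC> \<longleftrightarrow>
     poly_bounded (inlen \<CC>) \<and> poly_bounded (outlen \<CC>) \<and> poly_bounded (csize \<CC>) \<and>
     (\<forall>l. \<forall>k \<in> keys \<CC> l. circuit_io (inlen \<CC> l) (outlen \<CC> l) (circ \<CC> l k) \<and>
        circuit_size (circ \<CC> l k) = csize \<CC> l)"

definition puncture_correct :: "keyed_class \<Rightarrow> bool" where
  "puncture_correct \<CC> \<longleftrightarrow> (\<forall>l. \<forall>k \<in> keys \<CC> l. \<forall>xB xC \<mu>B \<mu>C.
     length xB = inlen \<CC> l \<and> length xC = inlen \<CC> l \<and>
     circuit_io (inlen \<CC> l) (outlen \<CC> l) \<mu>B \<and> circuit_io (inlen \<CC> l) (outlen \<CC> l) \<mu>C \<longrightarrow>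
     (let G = gen_puncture \<CC> l k xB xC \<mu>B \<mu>C in
        circuit_io (inlen \<CC> l) (outlen \<CC> l) G \<and> circuit_size G = csize \<CC> l \<and>
        (\<forall>x. length x = inlen \<CC> l \<and> x \<notin> {xB, xC} \<longrightarrow>
           eval_circuit G x = eval_circuit (circ \<CC> l k) x) \<and>
        eval_circuit G xB = eval_circuit \<mu>B xB \<and>
        (xC \<noteq> xB \<longrightarrow> eval_circuit G xC = eval_circuit \<mu>C xC)))"

definition puncture_poly_time :: "keyed_class \<Rightarrow> bool" where
  "puncture_poly_time \<CC> \<longleftrightarrow> (\<exists>c. classical c \<and> qpt c \<and>
     (\<forall>l. \<forall>k \<in> keys \<CC> l. \<forall>xB xC \<mu>B \<mu>C.
        length xB = inlen \<CC> l \<and> length xC = inlen \<CC> l \<and>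
        circuit_io (inlen \<CC> l) (outlen \<CC> l) \<mu>B \<and> circuit_io (inlen \<CC> l) (outlen \<CC> l) \<mu>C \<longrightarrow>
        (\<forall>(s, Q) \<in> set_spmf (run c
             (load [sec_param l, k, xB, xC, encode_circuit \<mu>B, encode_circuit \<mu>C] []) vacuum).
           creg s 0 = encode_circuit (gen_puncture \<CC> l k xB xC \<mu>B \<mu>C))))"

definition generalized_puncturable :: "keyed_class \<Rightarrow> bool" where
  "generalized_puncturable \<CC> \<longleftrightarrow>
     keyed_circuit_class \<CC> \<and> puncture_correct \<CC> \<and> puncture_poly_time \<CC>"


section \<open>Generalized unclonable puncturable obfuscation\<close>

definition obfuscate :: "prog \<Rightarrow> nat \<Rightarrow> circuit \<Rightarrow> qsys \<Rightarrow> (qmsg \<times> qsys) spmf" where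
  "obfuscate Obf l C Q = map_spmf (\<lambda>(s, Q'). (msg_out 0 s, Q'))
     (run Obf (load [sec_param l, encode_circuit C] []) Q)"

text \<open>Returns \<open>((\<rho>', y), Q')\<close>, where \<open>\<rho>'\<close> is the obfuscated circuit after the evaluation.\<close>

definition evaluate :: "prog \<Rightarrow> nat \<Rightarrow> qmsg \<Rightarrow> bits \<Rightarrow> qsys \<Rightarrow> ((qmsg \<times> bits) \<times> qsys) spmf" where
  "evaluate Eval l \<rho> x Q = map_spmf (\<lambda>(s, Q'). ((msg_out 0 s, creg s 1), Q'))
     (run Eval (load [sec_param l, fst \<rho>, x] (snd \<rho>)) Q)"

definition upo_correct :: "keyed_class \<Rightarrow> prog \<Rightarrow> prog \<Rightarrow> bool" where
  "upo_correct \<CC> Obf Eval \<longleftrightarrow> (\<exists>\<nu>. negligible \<nu> \<and>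
     (\<forall>l. \<forall>k \<in> keys \<CC> l. \<forall>x. length x = inlen \<CC> l \<longrightarrow>
        spmf (do {
          (\<rho>, Q) \<leftarrow> obfuscate Obf l (circ \<CC> l k) vacuum;
          ((\<rho>', y), Q') \<leftarrow> evaluate Eval l \<rho> x Q;
          return_spmf (y = eval_circuit (circ \<CC> l k) x)
        }) True \<ge> 1 - \<nu> l))"

text \<open>The adversary's first component has two stages, which share their memory. The two parts of its
  bipartite output are in the registers with number 0 and 1. As the qubits
  in different registers are disjoint, running \<open>B\<close> and then \<open>C\<close> on their parts of the common
  system is the application of their tensor product.\<close>

definition split_guess ::
  "prog \<Rightarrow> prog \<Rightarrow> nat \<Rightarrow> bits \<Rightarrow> bits \<Rightarrow> mem \<Rightarrow> qsys \<Rightarrow> (bool \<times> bool) spmf" where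
  "split_guess B C l wB wC s Q = do {
     (sB, Q') \<leftarrow> run B (load [sec_param l, wB, creg s 0] (qreg s 0)) Q;
     (sC, Q'') \<leftarrow> run C (load [sec_param l, wC, creg s 1] (qreg s 1)) Q';
     return_spmf (bit_of (creg sB 0), bit_of (creg sC 0))
   }"

text \<open>An adversary that does not send a key of the class and two circuits of the right type loses.\<close>

definition upo_experiment ::
  "keyed_class \<Rightarrow> prog \<Rightarrow> (nat \<Rightarrow> (bits \<times> bits) pmf) \<Rightarrow>
   prog \<Rightarrow> prog \<Rightarrow> prog \<Rightarrow> prog \<Rightarrow> nat \<Rightarrow> bool spmf" where
  "upo_experiment \<CC> Obf D A1 A2 B C l = do {
     b \<leftarrow> coin_spmf;
     (s, Q) \<leftarrow> run A1 (load [sec_param l] []) vacuum;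
     let k = creg s 0;
     let wB = creg s 1;
     let wC = creg s 2;
     if k \<in> keys \<CC> l \<and> is_circuit_code (inlen \<CC> l) (outlen \<CC> l) wB \<and>
        is_circuit_code (inlen \<CC> l) (outlen \<CC> l) wC
     then do {
       (xB, xC) \<leftarrow> spmf_of_pmf (D l);
       let G = gen_puncture \<CC> l k xB xC (decode_circuit wB) (decode_circuit wC);
       (\<rho>, Q') \<leftarrow> obfuscate Obf l (if b then G else circ \<CC> l k) Q;
       (s', Q'') \<leftarrow> run A2 (receive \<rho> s) Q';
       (bB, bC) \<leftarrow> split_guess B C l xB xC s' Q'';
       return_spmf (bB = b \<and> bC = b)
     }
     else return_spmf False
   }"

definition upo_secure ::
  "keyed_class \<Rightarrow> prog \<Rightarrow> (nat \<Rightarrow> (bits \<times> bits) pmf) \<Rightarrow> bool" where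
  "upo_secure \<CC> Obf D \<longleftrightarrow> (\<forall>A1 A2 B C. qpt A1 \<and> qpt A2 \<and> qpt B \<and> qpt C \<longrightarrow>
     (\<exists>\<nu>. negligible \<nu> \<and> (\<forall>l. spmf (upo_experiment \<CC> Obf D A1 A2 B C l) True \<le> 1 / 2 + \<nu> l)))"

definition generalized_upo ::
  "keyed_class \<Rightarrow> (nat \<Rightarrow> (bits \<times> bits) pmf) \<Rightarrow> prog \<Rightarrow> prog \<Rightarrow> bool" where
  "generalized_upo \<CC> D Obf Eval \<longleftrightarrow>
     qpt Obf \<and> qpt Eval \<and> upo_correct \<CC> Obf Eval \<and> upo_secure \<CC> Obf D"

definition identical_uniform :: "(nat \<Rightarrow> nat) \<Rightarrow> nat \<Rightarrow> (bits \<times> bits) pmf" where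
  "identical_uniform n l = map_pmf (\<lambda>x. (x, x)) (pmf_of_set {x. length x = n l})"

text \<open>The identical uniform challenge on \<open>n\<close> bits is guessed with probability \<open>2 ^ - n\<close>. If this is
  not negligible, e.g. for constant \<open>n\<close>, an adversary that evaluates the obfuscated
  circuit at a guessed point can break every scheme. The assumption is about
  the classes for which the challenge is unpredictable.\<close>

definition generalized_upo_for_P_poly :: bool where
  "generalized_upo_for_P_poly \<longleftrightarrow> (\<forall>\<CC>.
     generalized_puncturable \<CC> \<and> negligible (\<lambda>l. 1 / 2 ^ inlen \<CC> l) \<longrightarrow>
     (\<exists>Obf Eval. generalized_upo \<CC> (identical_uniform (inlen \<CC>)) Obf Eval))"


section \<open>One-time unclonable bit encryption\<close>

text \<open>The key is classical, so the qubits used by key generation are discarded.\<close>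

definition keygen :: "prog \<Rightarrow> nat \<Rightarrow> bits spmf" where
  "keygen Gen l = map_spmf (\<lambda>(s, Q). creg s 0) (run Gen (load [sec_param l] []) vacuum)"

definition encrypt :: "prog \<Rightarrow> nat \<Rightarrow> bits \<Rightarrow> bool \<Rightarrow> qsys \<Rightarrow> (qmsg \<times> qsys) spmf" where
  "encrypt Enc l sk m Q = map_spmf (\<lambda>(s, Q'). (msg_out 0 s, Q'))
     (run Enc (load [sec_param l, sk, [m]] []) Q)"

definition decrypt :: "prog \<Rightarrow> nat \<Rightarrow> bits \<Rightarrow> qmsg \<Rightarrow> qsys \<Rightarrow> bool spmf" where
  "decrypt Dec l sk ct Q = map_spmf (\<lambda>(s, Q'). bit_of (creg s 0))
     (run Dec (load [sec_param l, sk, fst ct] (snd ct)) Q)"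

definition ue_correct :: "prog \<Rightarrow> prog \<Rightarrow> prog \<Rightarrow> bool" where
  "ue_correct Gen Enc Dec \<longleftrightarrow> (\<exists>\<nu>. negligible \<nu> \<and> (\<forall>l m.
     spmf (do {
       sk \<leftarrow> keygen Gen l;
       (ct, Q) \<leftarrow> encrypt Enc l sk m vacuum;
       m' \<leftarrow> decrypt Dec l sk ct Q;
       return_spmf (m' = m)
     }) True \<ge> 1 - \<nu> l))"

definition ue_experiment ::
  "prog \<Rightarrow> prog \<Rightarrow> prog \<Rightarrow> prog \<Rightarrow> prog \<Rightarrow> prog \<Rightarrow> nat \<Rightarrow> bool spmf" where
  "ue_experiment Gen Enc A1 A2 B C l = do {
     sk \<leftarrow> keygen Gen l;
     (s, Q) \<leftarrow> run A1 (load [sec_param l] []) vacuum;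
     let m0 = bit_of (creg s 0);
     let m1 = bit_of (creg s 1);
     b \<leftarrow> coin_spmf;
     (ct, Q') \<leftarrow> encrypt Enc l sk (if b then m1 else m0) Q;
     (s', Q'') \<leftarrow> run A2 (receive ct s) Q';
     (bB, bC) \<leftarrow> split_guess B C l sk sk s' Q'';
     return_spmf (bB = b \<and> bC = b)
   }"

definition ue_secure :: "prog \<Rightarrow> prog \<Rightarrow> bool" where
  "ue_secure Gen Enc \<longleftrightarrow> (\<forall>A1 A2 B C. qpt A1 \<and> qpt A2 \<and> qpt B \<and> qpt C \<longrightarrow>
     (\<exists>\<nu>. negligible \<nu> \<and> (\<forall>l. spmf (ue_experiment Gen Enc A1 A2 B C l) True \<le> 1 / 2 + \<nu> l)))"

definition one_time_unclonable_bit_encryption :: "prog \<Rightarrow> prog \<Rightarrow> prog \<Rightarrow> bool" where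
  "one_time_unclonable_bit_encryption Gen Enc Dec \<longleftrightarrow>
     qpt Gen \<and> qpt Enc \<and> qpt Dec \<and> ue_correct Gen Enc Dec \<and> ue_secure Gen Enc"

end

theory Submission
  imports Defs
begin

text \<open>The key is a uniform point \<open>x\<close>. The bit 0 is encrypted as an obfuscation of the zero circuit, and
  the bit 1 as an obfuscation of the circuit that outputs 1 only at \<open>x\<close>; decryption evaluates at
  \<open>x\<close>. Puncturing the zero circuit at \<open>x\<close> with the constant 1 gives literally the second circuit, so
  a cloning adversary for the messages 0, 1 is an adversary against the obfuscation. For the messages
  1, 0 the reduction flips both guesses, and for equal messages, where no one wins with probability
  above 1/2, it lets both parties guess 0. Which case applies is passed on in flags that are kept
  in registers that the adversary's programs do not mention.

  The circuits of the class must be closed under puncturing in the concrete machine model. They are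
  tables of three points in which later entries override earlier ones, and puncturing evaluates the
  two given circuits at the punctured points.\<close>

section \<open>Invariants of quantum programs\<close>

text \<open>Nothing in the assumption relates obfuscations of two different circuits for the same
  function, so the circuit that encrypts 1 has to agree with the punctured circuit gate by gate.
  Correctness of the obfuscator, however, is promised only for circuits of the class, so the
  punctured zero circuit must itself have a key. This is why zero circuits and point circuits share
  one class. A further constraint is the order of the game: the key is sent before the challenge
  point is drawn, so the circuit that encrypts 0 may not depend on the secret point. Three table
  entries are one base entry and two punctured points; unpunctured circuits are padded to that
  length because all sizes must agree. Much of the work comes from the machine model. Running times
  must be bounded on arbitrary memories, not only on the intended ones. For equal messages the
  reduction has to reach 1/2 exactly, so no probability may be lost to non-termination. Both need an
  invariant that bounds register lengths, keeps states normalized and keeps the qubits of different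
  registers disjoint.\<close>

lemma while_spmf_map:
  assumes g: "\<And>s. g' (h s) = g s" and f: "\<And>s. f' (h s) = map_spmf h (f s)"
  shows "while_spmf g' f' (h s) = map_spmf h (while_spmf g f s)"
proof -
  \<comment> \<open>A loop is a least fixed point, so equality is proved as two inequalities, each
    by fixed-point induction on one side while the other side is unfolded once.\<close>
  have "ord_spmf (=) (map_spmf h (while_spmf g f s)) (while_spmf g' f' (h s))" for s
  proof -
    have "\<forall>s. ord_spmf (=) (map_spmf h (while_spmf g f s)) (while_spmf g' f' (h s))"
    proof (rule while_spmf.fixp_induct[where P = "\<lambda>w. \<forall>s. ord_spmf (=) (map_spmf h (w g f s)) (while_spmf g' f' (h s))"])
      show "spmf.admissible (\<lambda>w. \<forall>s. ord_spmf (=) (map_spmf h (curry (curry w) g f s)) (while_spmf g' f' (h s)))"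
        unfolding curry_def by (intro cont_intro)
    next
      fix w
      assume IH: "\<forall>s. ord_spmf (=) (map_spmf h (w g f s)) (while_spmf g' f' (h s))"
      show "\<forall>s. ord_spmf (=) (map_spmf h (if g s then bind_spmf (f s) (w g f) else return_spmf s)) (while_spmf g' f' (h s))"
      proof
        fix s
        show "ord_spmf (=) (map_spmf h (if g s then bind_spmf (f s) (w g f) else return_spmf s)) (while_spmf g' f' (h s))"
          unfolding while_spmf.simps[of g' f' "h s"] using IH
          by (simp add: g f map_spmf_bind_spmf bind_map_spmf o_def bind_spmf_mono')
      qed
    qed simp
    then show ?thesis by simp
  qed
  moreover have "ord_spmf (=) (while_spmf g' f' (h s)) (map_spmf h (while_spmf g f s))" for s
  proof -
    have "\<forall>s. ord_spmf (=) (while_spmf g' f' (h s)) (map_spmf h (while_spmf g f s))"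
    proof (rule while_spmf.fixp_induct[where P = "\<lambda>w. \<forall>s. ord_spmf (=) (w g' f' (h s)) (map_spmf h (while_spmf g f s))"])
      show "spmf.admissible (\<lambda>w. \<forall>s. ord_spmf (=) (curry (curry w) g' f' (h s)) (map_spmf h (while_spmf g f s)))"
        unfolding curry_def by (intro cont_intro)
    next
      fix w
      assume IH: "\<forall>s. ord_spmf (=) (w g' f' (h s)) (map_spmf h (while_spmf g f s))"
      show "\<forall>s. ord_spmf (=) (if g' (h s) then bind_spmf (f' (h s)) (w g' f') else return_spmf (h s)) (map_spmf h (while_spmf g f s))"
      proof
        fix s
        show "ord_spmf (=) (if g' (h s) then bind_spmf (f' (h s)) (w g' f') else return_spmf (h s)) (map_spmf h (while_spmf g f s))"
          unfolding while_spmf.simps[of g f s] using IH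
          by (simp add: g f map_spmf_bind_spmf bind_map_spmf o_def bind_spmf_mono')
      qed
    qed simp
    then show ?thesis by simp
  qed
  ultimately show ?thesis by (blast intro: spmf.leq_antisym)
qed

text \<open>Fixed-point induction starts from the empty subdistribution, whose support is empty. The
  result is therefore partial correctness and claims nothing about termination.\<close>

lemma while_spmf_invariant:
  assumes "\<And>x y. I x \<Longrightarrow> g x \<Longrightarrow> y \<in> set_spmf (f x) \<Longrightarrow> I y"
  shows "\<forall>s. I s \<longrightarrow> (\<forall>y \<in> set_spmf (while_spmf g f s). I y)"
proof (rule while_spmf.fixp_induct[where P = "\<lambda>w. \<forall>s. I s \<longrightarrow> (\<forall>y \<in> set_spmf (w g f s). I y)"])
  show "spmf.admissible (\<lambda>w. \<forall>s. I s \<longrightarrow> (\<forall>y\<in>set_spmf (curry (curry w) g f s). I y))"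
    unfolding curry_def
  proof (rule ccpo.admissibleI, intro allI impI ballI)
    fix A s y
    assume chain: "Complete_Partial_Order.chain (fun_ord (ord_spmf (=))) A" and
      A: "\<forall>w\<in>A. \<forall>s. I s \<longrightarrow> (\<forall>y\<in>set_spmf (w ((g, f), s)). I y)" and
      "I s" and y: "y \<in> set_spmf (fun_lub lub_spmf A ((g, f), s))"
    \<comment> \<open>Admissibility: an outcome of the limit of a chain is already an outcome of
      some member of the chain.\<close>
    have "set_spmf (lub_spmf {z. \<exists>w\<in>A. z = w ((g, f), s)}) = (\<Union>z\<in>{z. \<exists>w\<in>A. z = w ((g, f), s)}. set_spmf z)"
      by (rule set_lub_spmf) (rule chain_fun[OF chain])
    then obtain w where "w \<in> A" "y \<in> set_spmf (w ((g, f), s))"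
      using y unfolding fun_lub_def by blast
    then show "I y" using A \<open>I s\<close> by blast
  qed
next
  fix w
  assume IH: "\<forall>s. I s \<longrightarrow> (\<forall>y\<in>set_spmf (w g f s). I y)"
  show "\<forall>s. I s \<longrightarrow> (\<forall>y\<in>set_spmf (if g s then bind_spmf (f s) (w g f) else return_spmf s). I y)"
  proof (intro allI impI ballI)
    fix s y
    assume "I s" and y: "y \<in> set_spmf (if g s then bind_spmf (f s) (w g f) else return_spmf s)"
    show "I y"
    proof (cases "g s")
      case True
      then obtain z where "z \<in> set_spmf (f s)" "y \<in> set_spmf (w g f z)"
        using y by (auto simp: set_bind_spmf bind_UNION)
      then show ?thesis using assms[OF \<open>I s\<close> True] IH by blast
    next
      case False
      then show ?thesis using y \<open>I s\<close> by simp
    qed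
  qed
qed simp

definition fits :: "nat \<Rightarrow> mem \<Rightarrow> bool" where
  "fits N s \<longleftrightarrow> (\<forall>r. length (creg s r) \<le> N \<and> length (qreg s r) \<le> N)"

definition qubits :: "mem \<Rightarrow> nat set" where
  "qubits s = (\<Union>q. set (qreg s q))"

text \<open>What an arbitrary program preserves is collected in one reflexive and transitive
  relation, so that a single loop invariant suffices. The clause on \<open>fits\<close> expresses
  that a register grows by at most one per tick, the clause on \<open>qubits\<close> that a program
  holds only what it held before or allocated itself.\<close>

definition evolves :: "(mem \<times> qsys) \<times> nat \<Rightarrow> (mem \<times> qsys) \<times> nat \<Rightarrow> bool" where
  "evolves x y \<longleftrightarrow> (case (x, y) of (((s, Q), t), ((s', Q'), t')) \<Rightarrow>
     nqubits Q \<le> nqubits Q' \<and> t \<le> t' \<and>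
     qubits s' \<subseteq> qubits s \<union> {nqubits Q..<nqubits Q'} \<and>
     (\<forall>N. fits N s \<longrightarrow> fits (N + (t' - t)) s') \<and>
     (unit_state Q \<and> owns s Q \<longrightarrow> unit_state Q' \<and> owns s' Q'))"

lemma evolves_refl: "evolves x x"
  by (cases x; cases "fst x") (simp add: evolves_def)

lemma evolves_trans: "evolves x y \<Longrightarrow> evolves y z \<Longrightarrow> evolves x z"
proof -
  obtain s Q t s' Q' t' s'' Q'' t'' where [simp]: "x = ((s,Q),t)" "y = ((s',Q'),t')" "z = ((s'',Q''),t'')"
    by (metis prod.exhaust)
  assume a: "evolves x y" "evolves y z"
  have "fits (N + (t'' - t)) s''" if "fits N s" for N
  proof -
    have "fits (N + (t' - t) + (t'' - t')) s''" "t \<le> t'" "t' \<le> t''" using a that by (auto simp: evolves_def)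
    then show ?thesis by simp
  qed
  moreover have "qubits s'' \<subseteq> qubits s \<union> {nqubits Q..<nqubits Q''}"
  proof -
    have "qubits s' \<subseteq> qubits s \<union> {nqubits Q..<nqubits Q'}" "qubits s'' \<subseteq> qubits s' \<union> {nqubits Q'..<nqubits Q''}"
      "nqubits Q \<le> nqubits Q'" "nqubits Q' \<le> nqubits Q''" using a by (auto simp: evolves_def)
    then show ?thesis by fastforce
  qed
  ultimately show ?thesis using a by (simp add: evolves_def)
qed

text \<open>A guard test costs a tick before the branch starts; moving the starting time back only
  weakens the growth bound.\<close>

lemma evolves_later: "evolves (c, t) y \<Longrightarrow> t' \<le> t \<Longrightarrow> evolves (c, t') y"
proof -
  assume a: "evolves (c, t) y" "t' \<le> t"
  obtain s Q s' Q' u where [simp]: "c = (s, Q)" "y = ((s', Q'), u)" by (metis prod.exhaust)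
  have "fits (N + (u - t')) s'" if "fits N s" for N
  proof -
    have "\<forall>N. fits N s \<longrightarrow> fits (N + (u - t)) s'" using a(1) unfolding evolves_def by auto
    then have "fits (N + (u - t)) s'" using that by blast
    moreover have "N + (u - t) \<le> N + (u - t')" using a(2) by simp
    ultimately show ?thesis unfolding fits_def using order_trans by blast
  qed
  with a show ?thesis by (simp add: evolves_def)
qed

section \<open>Normalization under gates, measurement and allocation\<close>

lemma unit_state_hadamard:
  assumes "unit_state Q" and i: "i < nqubits Q"
  shows "unit_state (hadamard i Q)"
proof -
  let ?a = "amp Q" and ?U = "{..<nqubits Q} - {i}"
  have U: "{..<nqubits Q} = insert i ?U" using i by auto
  \<comment> \<open>Basis states are paired as \<open>S\<close> and \<open>insert i S\<close>. The
    gate mixes only the two amplitudes of a pair, and the parallelogram law below preserves their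
    total weight.\<close>
  have sum_split: "sum f (Pow {..<nqubits Q}) = (\<Sum>S\<in>Pow ?U. f S + f (insert i S))" for f :: "nat set \<Rightarrow> real"
  proof -
    have "sum f (Pow (insert i ?U)) = sum f (Pow ?U) + sum f (insert i ` Pow ?U)"
      unfolding Pow_insert by (rule sum.union_disjoint) auto
    also have "sum f (insert i ` Pow ?U) = (\<Sum>S\<in>Pow ?U. f (insert i S))"
      by (subst sum.reindex) (auto simp: inj_on_def o_def)
    finally show ?thesis using U by (simp add: sum.distrib)
  qed
  have par: "(cmod ((x + y) / complex_of_real (sqrt 2)))\<^sup>2 + (cmod ((x - y) / complex_of_real (sqrt 2)))\<^sup>2 = (cmod x)\<^sup>2 + (cmod y)\<^sup>2" for x y
    proof -
    have half: "(cmod (z / complex_of_real (sqrt 2)))\<^sup>2 = (cmod z)\<^sup>2 / 2" for z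
      by (simp add: norm_divide power_divide)
    have "(cmod (x + y))\<^sup>2 + (cmod (x - y))\<^sup>2 = 2 * (cmod x)\<^sup>2 + 2 * (cmod y)\<^sup>2"
      unfolding cmod_power2 by (simp add: power2_eq_square algebra_simps)
    then show ?thesis unfolding half by simp
  qed
  have "(\<Sum>S\<in>Pow {..<nqubits Q}. (cmod (amp (hadamard i Q) S))\<^sup>2) = (\<Sum>S\<in>Pow ?U. (cmod (?a S))\<^sup>2 + (cmod (?a (insert i S)))\<^sup>2)"
    unfolding sum_split
  proof (rule sum.cong)
    fix S assume "S \<in> Pow ?U"
    then have "S - {i} = S" "i \<notin> S" by auto
    then show "(cmod (amp (hadamard i Q) S))\<^sup>2 + (cmod (amp (hadamard i Q) (insert i S)))\<^sup>2 = (cmod (?a S))\<^sup>2 + (cmod (?a (insert i S)))\<^sup>2"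
      using par[of "?a S" "?a (insert i S)"] by (simp add: hadamard_def)
  qed simp
  also have "\<dots> = 1" using assms(1) sum_split[of "\<lambda>S. (cmod (?a S))\<^sup>2"] by (simp add: unit_state_def)
  finally have 1: "(\<Sum>S\<in>Pow {..<nqubits Q}. (cmod (amp (hadamard i Q) S))\<^sup>2) = 1" .
  have "amp (hadamard i Q) S = 0" if "\<not> S \<subseteq> {..<nqubits Q}" for S
  proof -
    have "\<not> S - {i} \<subseteq> {..<nqubits Q}" "\<not> insert i S \<subseteq> {..<nqubits Q}" using that i by auto
    then show ?thesis using assms(1) by (simp add: unit_state_def hadamard_def)
  qed
  with 1 show ?thesis by (simp add: unit_state_def hadamard_def)
qed

lemma unit_state_t_gate: "unit_state Q \<Longrightarrow> unit_state (t_gate i Q)"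
proof -
  have "cmod ((if i \<in> S then cis (pi / 4) else 1) * amp Q S) = cmod (amp Q S)" for S
    by (simp add: norm_mult)
  then show "unit_state Q \<Longrightarrow> unit_state (t_gate i Q)"
    by (simp add: unit_state_def t_gate_def)
qed

lemma unit_state_cnot:
  assumes "unit_state Q" "i < nqubits Q" "j < nqubits Q" "i \<noteq> j"
  shows "unit_state (cnot i j Q)"
proof -
  define \<pi> where "\<pi> = (\<lambda>S. if i \<in> S then (if j \<in> S then S - {j} else insert j S) else S)"
  \<comment> \<open>CNOT permutes the basis states by an involution, because control and target
    differ.\<close>
  have \<pi>: "\<pi> (\<pi> S) = S" for S using assms(4) by (auto simp: \<pi>_def)
  have sub: "\<pi> S \<subseteq> {..<nqubits Q} \<longleftrightarrow> S \<subseteq> {..<nqubits Q}" for S using assms(2,3) by (auto simp: \<pi>_def)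
  have amp: "amp (cnot i j Q) S = amp Q (\<pi> S)" for S by (simp add: cnot_def \<pi>_def)
  have "(\<Sum>S\<in>Pow {..<nqubits Q}. (cmod (amp Q (\<pi> S)))\<^sup>2) = (\<Sum>S\<in>Pow {..<nqubits Q}. (cmod (amp Q S))\<^sup>2)"
    by (rule sum.reindex_bij_witness[where i = \<pi> and j = \<pi>]) (simp_all add: \<pi> sub)
  moreover have "nqubits (cnot i j Q) = nqubits Q" by (simp add: cnot_def)
  ultimately show ?thesis using assms(1) sub by (simp add: unit_state_def amp)
qed

lemma prob_outcome_complement:
  assumes "unit_state Q"
  shows "prob_outcome i True Q + prob_outcome i False Q = 1"
proof -
  have "prob_outcome i True Q + prob_outcome i False Q =
    sum (\<lambda>S. (cmod (amp Q S))\<^sup>2) ({S. S \<subseteq> {..<nqubits Q} \<and> (i \<in> S) = True} \<union> {S. S \<subseteq> {..<nqubits Q} \<and> (i \<in> S) = False})"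
    unfolding prob_outcome_def by (rule sum.union_disjoint[symmetric]) auto
  also have "{S. S \<subseteq> {..<nqubits Q} \<and> (i \<in> S) = True} \<union> {S. S \<subseteq> {..<nqubits Q} \<and> (i \<in> S) = False} = Pow {..<nqubits Q}"
    by auto
  finally show ?thesis using assms by (simp add: unit_state_def)
qed

lemma prob_outcome_nonneg: "0 \<le> prob_outcome i b Q"
  by (simp add: prob_outcome_def sum_nonneg)

lemma unit_state_collapse:
  assumes "unit_state Q" and p: "prob_outcome i b Q \<noteq> 0"
  shows "unit_state (collapse i b Q)"
proof -
  let ?p = "prob_outcome i b Q"
  have pos: "?p > 0" using p prob_outcome_nonneg[of i b Q] by linarith
  have "(\<Sum>S\<in>Pow {..<nqubits Q}. (cmod (amp (collapse i b Q) S))\<^sup>2) =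
    (\<Sum>S\<in>Pow {..<nqubits Q}. if (i \<in> S) = b then (cmod (amp Q S))\<^sup>2 / ?p else 0)"
    using pos by (intro sum.cong) (auto simp: collapse_def norm_divide power_divide)
  also have "\<dots> = (\<Sum>S\<in>{S\<in>Pow {..<nqubits Q}. (i \<in> S) = b}. (cmod (amp Q S))\<^sup>2 / ?p)"
    by (rule sum.inter_filter[symmetric]) simp
  also have "\<dots> = ?p / ?p" by (simp add: prob_outcome_def flip: sum_divide_distrib)
  finally show ?thesis using assms by (auto simp: unit_state_def collapse_def)
qed

lemma unit_state_new: "unit_state Q \<Longrightarrow> unit_state (Q\<lparr>nqubits := Suc (nqubits Q)\<rparr>)"
proof -
  assume u: "unit_state Q"
  have "(\<Sum>S\<in>Pow {..<Suc (nqubits Q)}. (cmod (amp Q S))\<^sup>2) = (\<Sum>S\<in>Pow {..<nqubits Q}. (cmod (amp Q S))\<^sup>2)"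
    using u by (intro sum.mono_neutral_right) (auto simp: unit_state_def)
  then show ?thesis using u unfolding unit_state_def by (auto simp: subset_eq less_Suc_eq)
qed

lemma evolves_stepI:
  assumes "nqubits Q \<le> nqubits Q'" "\<And>q. set (qreg s' q) \<subseteq> qubits s \<union> {nqubits Q..<nqubits Q'}"
    "\<And>N r. fits N s \<Longrightarrow> length (creg s' r) \<le> Suc N"
    "\<And>N r. fits N s \<Longrightarrow> length (qreg s' r) \<le> Suc N"
    "unit_state Q \<Longrightarrow> owns s Q \<Longrightarrow> unit_state Q' \<and> owns s' Q'"
  shows "evolves ((s, Q), t) ((s', Q'), Suc t)"
  using assms by (auto simp: evolves_def qubits_def fits_def)

lemma fitsD: "fits N s \<Longrightarrow> length (creg s r) \<le> N" "fits N s \<Longrightarrow> length (qreg s r) \<le> N"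
  by (auto simp: fits_def)

lemma evolves_tick: "evolves (x, t) (x, Suc t)"
  by (cases x) (auto intro!: evolves_stepI simp: fitsD le_SucI qubits_def)

lemma evolves_step:
  assumes "y \<in> set_spmf (step i (s, Q))"
  shows "evolves ((s, Q), t) (y, Suc t)"
proof (cases i)
  case (Push r b)
  then show ?thesis using assms
    by (auto intro!: evolves_stepI simp: qubits_def owns_def simp: fitsD le_SucI)
next
  case (Pop r)
  then show ?thesis using assms
    by (auto intro!: evolves_stepI simp: qubits_def owns_def simp: fitsD le_SucI le_diff_conv)
next
  case (Copy r r')
  then show ?thesis using assms
    by (auto intro!: evolves_stepI simp: qubits_def owns_def simp: fitsD le_SucI)
next
  case (New q)
  note unit_state_new
  moreover have "nqubits Q \<notin> set (qreg s q)" if "owns s Q" for q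
    using that unfolding owns_def by auto
  ultimately show ?thesis using assms New
    by (auto intro!: evolves_stepI simp: qubits_def simp: fitsD le_SucI split: if_splits)
      (auto simp: owns_def subset_eq intro: less_SucI)
next
  case (Move q q')
  show ?thesis
  proof (cases "qreg s q")
    case Nil
    then show ?thesis using assms Move by (auto intro: evolves_tick)
  next
    case (Cons j js)
    then have y: "y = (s\<lparr>qreg := (let f = (qreg s)(q := js) in f(q' := j # f q'))\<rparr>, Q)"
      using assms Move by (auto simp: Let_def)
    let ?s = "fst y"
    have len: "length (qreg ?s r) \<le> Suc N" if "fits N s" for r N
    proof -
      have "length (qreg s r) \<le> N" "length (j # js) \<le> N" "length (qreg s q') \<le> N" using that Cons unfolding fits_def by metis+
      then show ?thesis by (auto simp: y Let_def)
    qed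
    have jq: "j \<in> set (qreg s q)" "set js \<subseteq> set (qreg s q)" using Cons by auto
    have sub: "set (qreg ?s r) \<subseteq> qubits s" for r
      using jq by (auto simp: y Let_def qubits_def)
    have own: "owns ?s Q" if o: "owns s Q"
    proof -
      have d: "distinct (j # js)" using o Cons unfolding owns_def by metis
      have lt: "qubits s \<subseteq> {..<nqubits Q}" using o unfolding owns_def qubits_def by blast
      have dis: "r \<noteq> q \<Longrightarrow> set (j # js) \<inter> set (qreg s r) = {}" for r using o Cons unfolding owns_def by metis
      show ?thesis unfolding owns_def
      proof (intro conjI allI impI)
        fix r show "distinct (qreg ?s r)" using o d dis[of q'] by (auto simp: y Let_def owns_def)
        show "set (qreg ?s r) \<subseteq> {..<nqubits Q}" using sub lt by blast
      next
        fix r r' :: nat assume "r \<noteq> r'"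
        then show "set (qreg ?s r) \<inter> set (qreg ?s r') = {}" using o d dis[of r] dis[of r'] dis[of q'] by (auto simp: y Let_def owns_def)
      qed
    qed
    have "evolves ((s, Q), t) ((?s, Q), Suc t)"
      using sub own len by (intro evolves_stepI) (auto simp: y Let_def simp: fitsD le_SucI)
    then show ?thesis by (simp add: y)
  qed
next
  case (Had q)
  show ?thesis
  proof (cases "qreg s q")
    case Nil
    then show ?thesis using assms Had by (auto intro: evolves_tick)
  next
    case (Cons j js)
    have "owns s Q \<Longrightarrow> j < nqubits Q" using Cons unfolding owns_def by (metis lessThan_iff list.set_intros(1) subsetD)
    moreover have "nqubits (hadamard j Q) = nqubits Q" by (simp add: hadamard_def)
    ultimately show ?thesis using assms Had Cons unit_state_hadamard
      by (auto intro!: evolves_stepI simp: qubits_def simp: fitsD le_SucI) (auto simp: owns_def)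
  qed
next
  case (Tgate q)
  show ?thesis
  proof (cases "qreg s q")
    case Nil
    then show ?thesis using assms Tgate by (auto intro: evolves_tick)
  next
    case (Cons j js)
    have "nqubits (t_gate j Q) = nqubits Q" by (simp add: t_gate_def)
    then show ?thesis using assms Tgate Cons unit_state_t_gate
      by (auto intro!: evolves_stepI simp: qubits_def simp: fitsD le_SucI) (auto simp: owns_def)
  qed
next
  case (Cnot q q')
  show ?thesis
  proof (cases "q = q' \<or> qreg s q = [] \<or> qreg s q' = []")
    case True
    then show ?thesis using assms Cnot by (auto intro: evolves_tick)
  next
    case False
    let ?i = "hd (qreg s q)" and ?j = "hd (qreg s q')"
    have y: "y = (s, cnot ?i ?j Q)" using False assms Cnot by auto
    have nq: "nqubits (cnot ?i ?j Q) = nqubits Q" by (simp add: cnot_def)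
    have "unit_state (cnot ?i ?j Q)" if "unit_state Q" "owns s Q"
    proof (rule unit_state_cnot[OF that(1)])
      have ij: "?i \<in> set (qreg s q)" "?j \<in> set (qreg s q')" using False by auto
      have sub: "set (qreg s p) \<subseteq> {..<nqubits Q}" for p using that(2) unfolding owns_def by blast
      show "?i < nqubits Q" using ij(1) sub[of q] by blast
      show "?j < nqubits Q" using ij(2) sub[of q'] by blast
      have "set (qreg s q) \<inter> set (qreg s q') = {}" using that(2) False unfolding owns_def by blast
      then show "?i \<noteq> ?j" using ij by auto
    qed
    then show ?thesis unfolding y
      by (intro evolves_stepI) (auto simp: qubits_def nq owns_def simp: fitsD le_SucI)
  qed
next
  case (Measure q r)
  show ?thesis
  proof (cases "qreg s q")
    case Nil
    then show ?thesis using assms Measure by (auto intro: evolves_tick)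
  next
    case (Cons j js)
    let ?p = "prob_outcome j True Q"
    obtain b where b: "b \<in> set_pmf (bernoulli_pmf ?p)" and
      y: "y = (s\<lparr>creg := (creg s)(r := b # creg s r), qreg := (qreg s)(q := js)\<rparr>, collapse j b Q)"
      using assms Measure Cons by auto
    have "unit_state (collapse j b Q)" if u: "unit_state Q"
    proof (rule unit_state_collapse[OF u])
      \<comment> \<open>\<open>bernoulli_pmf\<close> truncates its parameter to the unit interval.
        As the parameter lies in that interval, an outcome in the support has nonzero probability,
        and the collapse divides by a nonzero number.\<close>
      have "0 \<le> ?p" "?p \<le> 1" using prob_outcome_complement[OF u, of j] prob_outcome_nonneg[of j _ Q] by (smt (verit))+
      then show "prob_outcome j b Q \<noteq> 0" using b prob_outcome_complement[OF u, of j]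
        by (cases b) (auto simp: set_pmf_iff)
    qed
    moreover have "length js \<le> N" if "fits N s" for N using fitsD(2)[OF that, of q] Cons by simp
    moreover have "set js \<subseteq> set (qreg s q)" "distinct (qreg s q) \<Longrightarrow> distinct js" using Cons by auto
    moreover have "owns (s\<lparr>creg := (creg s)(r := b # creg s r), qreg := (qreg s)(q := js)\<rparr>) (collapse j b Q)" if "owns s Q"
      using that \<open>set js \<subseteq> set (qreg s q)\<close> \<open>distinct (qreg s q) \<Longrightarrow> distinct js\<close>
      unfolding owns_def by (simp add: collapse_def) blast
    ultimately show ?thesis unfolding y
      by (intro evolves_stepI) (auto simp: collapse_def qubits_def simp: fitsD le_SucI)
  qed
qed (use assms in \<open>auto intro: evolves_tick\<close>)

lemma evolves_exec: "y \<in> set_spmf (exec c x) \<Longrightarrow> evolves x y"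
proof (induction c arbitrary: x y)
  case (Do i)
  then show ?case by (cases x) (auto intro: evolves_step)
next
  case (Seq c d)
  obtain s t where x: "x = (s, t)" by fastforce
  then obtain z where "z \<in> set_spmf (exec c x)" "y \<in> set_spmf (exec d z)"
    using Seq.prems by (auto simp: set_bind_spmf bind_UNION)
  then show ?case using Seq.IH evolves_trans by blast
next
  case (Cond g c d)
  obtain s Q t where [simp]: "x = ((s, Q), t)" by (metis prod.exhaust)
  have "evolves ((s, Q), Suc t) y" using Cond by (simp split: if_splits)
  then show ?case by (auto intro: evolves_later)
next
  case (While g c)
  obtain s t where x: "x = (s, t)" by fastforce
  have step: "evolves x y'" if "evolves x z" "y' \<in> set_spmf (case z of (s, t) \<Rightarrow> exec c (s, Suc t))" for y' z
  proof -
    obtain s t where z: "z = (s, t)" by fastforce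
    then have "evolves (s, Suc t) y'" using that(2) While.IH by simp
    then have "evolves z y'" unfolding z by (rule evolves_later) simp
    then show ?thesis using that(1) evolves_trans by blast
  qed
  \<comment> \<open>The invariant refers to the initial configuration \<open>x\<close>, so that
    transitivity yields its preservation.\<close>
  have "\<forall>s. evolves x s \<longrightarrow>
    (\<forall>y \<in> set_spmf (while_spmf (\<lambda>(s, t). holds g (fst s)) (\<lambda>(s, t). exec c (s, Suc t)) s). evolves x y)"
    by (rule while_spmf_invariant) (rule step)
  then show ?case using While.prems evolves_refl[of x] unfolding x exec.simps by blast
qed

section \<open>Frame properties and running times of composed programs\<close>

text \<open>Only classical registers are restricted, because the reduction hides only classical
  strings.\<close>

fun instr_below :: "nat \<Rightarrow> instr \<Rightarrow> bool" where
  "instr_below m (Push r b) \<longleftrightarrow> r < m"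
| "instr_below m (Pop r) \<longleftrightarrow> r < m"
| "instr_below m (Copy r r') \<longleftrightarrow> r < m \<and> r' < m"
| "instr_below m (Measure q r) \<longleftrightarrow> r < m"
| "instr_below m _ \<longleftrightarrow> True"

fun guard_below :: "nat \<Rightarrow> guard \<Rightarrow> bool" where
  "guard_below m (Nonempty r) \<longleftrightarrow> r < m"
| "guard_below m (Top r) \<longleftrightarrow> r < m"
| "guard_below m (QNonempty q) \<longleftrightarrow> True"

fun prog_below :: "nat \<Rightarrow> prog \<Rightarrow> bool" where
  "prog_below m (Do i) \<longleftrightarrow> instr_below m i"
| "prog_below m (Seq c d) \<longleftrightarrow> prog_below m c \<and> prog_below m d"
| "prog_below m (Cond g c d) \<longleftrightarrow> guard_below m g \<and> prog_below m c \<and> prog_below m d"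
| "prog_below m (While g c) \<longleftrightarrow> guard_below m g \<and> prog_below m c"

lemma instr_below_mono: "instr_below m i \<Longrightarrow> m \<le> n \<Longrightarrow> instr_below n i"
  by (cases i) auto

lemma guard_below_mono: "guard_below m g \<Longrightarrow> m \<le> n \<Longrightarrow> guard_below n g"
  by (cases g) auto

lemma prog_below_mono: "prog_below m c \<Longrightarrow> m \<le> n \<Longrightarrow> prog_below n c"
  by (induction c) (auto intro: instr_below_mono guard_below_mono)

text \<open>A program is a finite text and mentions finitely many registers. The bound depends on
  neither the security parameter nor the input, so there is always room above it for hidden
  data.\<close>

lemma prog_below_exists: "\<exists>m. prog_below m c"
proof (induction c)
  case (Do i)
  have "\<exists>m. instr_below m i"
  proof (cases i)
    case (Copy r r')
    then show ?thesis by (auto intro: exI[of _ "Suc (max r r')"])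
  qed auto
  then show ?case by simp
next
  case (Seq c d)
  then obtain m n where "prog_below m c" "prog_below n d" by blast
  then have "prog_below (max m n) (Seq c d)" by (auto intro: prog_below_mono)
  then show ?case ..
next
  case (Cond g c d)
  then obtain m n where mn: "prog_below m c" "prog_below n d" by blast
  obtain k where "guard_below k g" by (cases g) auto
  with mn have "prog_below (max k (max m n)) (Cond g c d)" by (auto intro: prog_below_mono guard_below_mono)
  then show ?case ..
next
  case (While g c)
  then obtain m where m: "prog_below m c" by blast
  obtain k where "guard_below k g" by (cases g) auto
  with m have "prog_below (max k m) (While g c)" by (auto intro: prog_below_mono guard_below_mono)
  then show ?case ..
qed

section \<open>Hidden registers and shifts of the clock\<close>

definition patch :: "nat \<Rightarrow> (nat \<Rightarrow> bits) \<Rightarrow> mem \<Rightarrow> mem" where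
  "patch m h s = s\<lparr>creg := (\<lambda>r. if r < m then creg s r else h r)\<rparr>"

lemma step_patch:
  assumes "instr_below m i"
  shows "step i (patch m h s, Q) = map_spmf (\<lambda>(s', Q'). (patch m h s', Q')) (step i (s, Q))"
proof (cases i)
  case (Measure q r)
  then show ?thesis using assms
    by (cases "qreg s q") (auto simp: patch_def pmf.map_comp o_def fun_eq_iff intro!: arg_cong[where f = spmf_of_pmf] map_pmf_cong)
qed (use assms in \<open>auto simp: patch_def fun_eq_iff Let_def split: list.splits\<close>)

lemma holds_patch: "guard_below m g \<Longrightarrow> holds g (patch m h s) = holds g s"
  by (cases g) (auto simp: patch_def)

lemma exec_patch:
  "prog_below m c \<Longrightarrow> exec c ((patch m h s, Q), t + k) =
     map_spmf (\<lambda>((s', Q'), t'). ((patch m h s', Q'), t' + k)) (exec c ((s, Q), t))"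
proof (induction c arbitrary: s Q t)
  case (Do i)
  then show ?case by (simp add: step_patch spmf.map_comp o_def split_def)
next
  case (Seq c d)
  then show ?case
    by (auto simp: bind_map_spmf map_spmf_bind_spmf o_def intro!: bind_spmf_cong)
next
  case (Cond g c d)
  then show ?case using Cond.IH(1)[of s Q "Suc t"] Cond.IH(2)[of s Q "Suc t"] by (simp add: holds_patch)
next
  case (While g c)
  let ?h = "\<lambda>((s, Q), t). ((patch m h s, Q), t + k)"
  let ?g = "\<lambda>(s :: mem \<times> qsys, t :: nat). holds g (fst s)" and ?f = "\<lambda>(s, t). exec c (s, Suc t)"
  have "while_spmf ?g ?f (?h ((s, Q), t)) = map_spmf ?h (while_spmf ?g ?f ((s, Q), t))"
  proof (rule while_spmf_map)
    fix x :: "(mem \<times> qsys) \<times> nat"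
    obtain s Q t where x: "x = ((s, Q), t)" by (metis prod.exhaust)
    show "?g (?h x) = ?g x" using While.prems by (simp add: x holds_patch)
    have "Suc (t + k) = Suc t + k" by simp
    then show "?f (?h x) = map_spmf ?h (?f x)" using While by (simp only: x prod.case prog_below.simps)
  qed
  then show ?case by simp
qed

text \<open>The clock is counted but never read. A run can therefore be restarted at time 0, which
  makes running times additive under composition.\<close>

lemma exec_time_shift:
  "exec c (x, t + k) = map_spmf (\<lambda>(y, t'). (y, t' + k)) (exec c (x, t))"
proof (induction c arbitrary: x t)
  case (Do i)
  then show ?case by (simp add: spmf.map_comp o_def split_def)
next
  case (Seq c d)
  then show ?case
    by (auto simp: bind_map_spmf map_spmf_bind_spmf o_def intro!: bind_spmf_cong)
next
  case (Cond g c d)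
  then show ?case using Cond.IH(1)[of x "Suc t"] Cond.IH(2)[of x "Suc t"] by simp
next
  case (While g c)
  let ?h = "\<lambda>(x :: mem \<times> qsys, t). (x, t + k)"
  let ?g = "\<lambda>(s :: mem \<times> qsys, t :: nat). holds g (fst s)" and ?f = "\<lambda>(s, t). exec c (s, Suc t)"
  have "while_spmf ?g ?f (?h (x, t)) = map_spmf ?h (while_spmf ?g ?f (x, t))"
  proof (rule while_spmf_map)
    fix y :: "(mem \<times> qsys) \<times> nat"
    obtain x t where y: "y = (x, t)" by fastforce
    show "?g (?h y) = ?g y" by (simp add: y)
    have "Suc (t + k) = Suc t + k" by simp
    then show "?f (?h y) = map_spmf ?h (?f y)" using While by (simp only: y prod.case)
  qed
  then show ?case by simp
qed

lemma run_patch: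
  assumes "prog_below m c"
  shows "run c (patch m h s) Q = map_spmf (\<lambda>(s', Q'). (patch m h s', Q')) (run c s Q)"
  using exec_patch[OF assms, of h s Q 0 0] by (simp add: run_def spmf.map_comp o_def split_def)

lemma map_fst_exec: "map_spmf fst (exec c ((s, Q), t)) = run c s Q"
  using exec_time_shift[of c "(s, Q)" 0 t] by (simp add: run_def spmf.map_comp o_def split_def)

lemma run_Seq: "run (Seq c d) s Q = bind_spmf (run c s Q) (\<lambda>(s', Q'). run d s' Q')"
proof -
  have "run (Seq c d) s Q = bind_spmf (exec c ((s, Q), 0)) (\<lambda>x. map_spmf fst (exec d x))"
    by (simp add: run_def map_spmf_bind_spmf o_def)
  also have "\<dots> = bind_spmf (exec c ((s, Q), 0)) (\<lambda>x. case fst x of (s', Q') \<Rightarrow> run d s' Q')"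
    by (rule bind_spmf_cong) (auto simp: map_fst_exec)
  finally show ?thesis by (simp add: run_def bind_map_spmf o_def)
qed

lemma run_Cond: "run (Cond g c d) s Q = (if holds g s then run c s Q else run d s Q)"
  by (simp add: run_def[of "Cond g c d"] map_fst_exec)

lemma run_Do: "run (Do i) s Q = step i (s, Q)"
  by (simp add: run_def spmf.map_comp o_def)

section \<open>Polynomial time and losslessness of compositions\<close>

definition valid :: "mem \<Rightarrow> qsys \<Rightarrow> bool" where
  "valid s Q \<longleftrightarrow> unit_state Q \<and> owns s Q \<and> (\<exists>N. fits N s)"

lemma evolves_run: "(s', Q') \<in> set_spmf (run c s Q) \<Longrightarrow> \<exists>t. evolves ((s, Q), 0) ((s', Q'), t)"
  by (auto simp: run_def) (blast intro: evolves_exec)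

lemma evolvesD:
  assumes "evolves ((s, Q), t) ((s', Q'), t')"
  shows "nqubits Q \<le> nqubits Q'" "t \<le> t'" "qubits s' \<subseteq> qubits s \<union> {nqubits Q..<nqubits Q'}"
    "fits N s \<Longrightarrow> fits (N + (t' - t)) s'"
    "unit_state Q \<Longrightarrow> owns s Q \<Longrightarrow> unit_state Q'" "unit_state Q \<Longrightarrow> owns s Q \<Longrightarrow> owns s' Q'"
  using assms unfolding evolves_def prod.case by blast+

lemma valid_run: "valid s Q \<Longrightarrow> (s', Q') \<in> set_spmf (run c s Q) \<Longrightarrow> valid s' Q'"
  unfolding valid_def using evolvesD evolves_run by metis

lemma nqubits_run: "(s', Q') \<in> set_spmf (run c s Q) \<Longrightarrow> nqubits Q \<le> nqubits Q'"
  using evolvesD(1) evolves_run by blast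

lemma qubits_run: "(s', Q') \<in> set_spmf (run c s Q) \<Longrightarrow> qubits s' \<subseteq> qubits s \<union> {nqubits Q..<nqubits Q'}"
  using evolvesD(3) evolves_run by blast

lemma fits_mono: "fits N s \<Longrightarrow> N \<le> M \<Longrightarrow> fits M s"
  unfolding fits_def by (meson order_trans)

lemma qpt_iff: "qpt c \<longleftrightarrow> (\<exists>p. \<forall>s Q N. unit_state Q \<and> owns s Q \<and> fits N s \<longrightarrow> runs_within c s Q (poly p N))"
  by (simp add: qpt_def fits_def)

lemma qptE:
  assumes "qpt c"
  obtains p where "\<And>s Q N. unit_state Q \<Longrightarrow> owns s Q \<Longrightarrow> fits N s \<Longrightarrow> runs_within c s Q (poly p N)"
  using assms unfolding qpt_iff by blast

lemma qpt_lossless: "qpt c \<Longrightarrow> valid s Q \<Longrightarrow> lossless_spmf (run c s Q)"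
  by (auto elim!: qptE simp: valid_def runs_within_def run_def)

lemma runs_within_mono: "runs_within c s Q T \<Longrightarrow> T \<le> T' \<Longrightarrow> runs_within c s Q T'"
  by (fastforce simp: runs_within_def)

lemma lossless_exec_shift: "lossless_spmf (exec c (x, t)) \<longleftrightarrow> lossless_spmf (exec c (x, 0))"
  using exec_time_shift[of c x 0 t] by simp

lemma set_exec_shift: "set_spmf (exec c (x, t)) = (\<lambda>(y, u). (y, u + t)) ` set_spmf (exec c (x, 0))"
  using exec_time_shift[of c x 0 t] by simp

lemma runs_within_Seq:
  assumes c: "runs_within c s Q T"
    and d: "\<And>s' Q' t. ((s', Q'), t) \<in> set_spmf (exec c ((s, Q), 0)) \<Longrightarrow> t \<le> T \<Longrightarrow> runs_within d s' Q' T'"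
  shows "runs_within (Seq c d) s Q (T + T')"
proof -
  have *: "lossless_spmf (exec d ((s', Q'), t)) \<and> (\<forall>(y, u) \<in> set_spmf (exec d ((s', Q'), t)). u \<le> T + T')"
    if "((s', Q'), t) \<in> set_spmf (exec c ((s, Q), 0))" for s' Q' t
  proof -
    have t: "t \<le> T" using c that by (auto simp: runs_within_def)
    from d[OF that t] have "lossless_spmf (exec d ((s', Q'), 0))"
      and "\<forall>(y, u) \<in> set_spmf (exec d ((s', Q'), 0)). u \<le> T'" by (auto simp: runs_within_def)
    with t show ?thesis by (subst lossless_exec_shift, subst set_exec_shift) fastforce
  qed
  show ?thesis unfolding runs_within_def exec.simps lossless_bind_spmf
  proof (intro conjI ballI)
    show "lossless_spmf (exec c ((s, Q), 0))" using c by (simp add: runs_within_def)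
    show "lossless_spmf (exec d x)" if "x \<in> set_spmf (exec c ((s, Q), 0))" for x
      using that * by (metis prod.exhaust)
    fix y assume "y \<in> set_spmf (bind_spmf (exec c ((s, Q), 0)) (exec d))"
    then obtain x where "x \<in> set_spmf (exec c ((s, Q), 0))" "y \<in> set_spmf (exec d x)"
      by (auto simp: set_bind_spmf bind_UNION)
    with * show "case y of (s', t) \<Rightarrow> t \<le> T + T'" by (metis prod.exhaust)
  qed
qed

lemma runs_within_Cond:
  assumes "holds g s \<Longrightarrow> runs_within c s Q T" "\<not> holds g s \<Longrightarrow> runs_within d s Q T"
  shows "runs_within (Cond g c d) s Q (Suc T)"
proof -
  have "runs_within c s Q T \<Longrightarrow> lossless_spmf (exec c ((s, Q), Suc 0)) \<and> (\<forall>(y, u) \<in> set_spmf (exec c ((s, Q), Suc 0)). u \<le> Suc T)" for c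
    unfolding runs_within_def by (subst lossless_exec_shift, subst set_exec_shift) fastforce
  with assms show ?thesis by (auto simp: runs_within_def[of "Cond g c d"])
qed

lemma qpt_Seq:
  assumes "qpt c" "qpt d"
  shows "qpt (Seq c d)"
proof -
  obtain p where p: "\<And>s Q N. unit_state Q \<Longrightarrow> owns s Q \<Longrightarrow> fits N s \<Longrightarrow> runs_within c s Q (poly p N)"
    using assms(1) unfolding qpt_iff by blast
  obtain q where q: "\<And>s Q N. unit_state Q \<Longrightarrow> owns s Q \<Longrightarrow> fits N s \<Longrightarrow> runs_within d s Q (poly q N)"
    using assms(2) unfolding qpt_iff by blast
  \<comment> \<open>The second program starts with registers of length at most
    \<open>N + poly p N\<close>, because each step of the first lengthens a register by at most
    one.\<close>
  have "runs_within (Seq c d) s Q (poly (p + q \<circ>\<^sub>p ([:0, 1:] + p)) N)"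
    if *: "unit_state Q" "owns s Q" "fits N s" for s Q N
  proof -
    have "runs_within (Seq c d) s Q (poly p N + poly q (N + poly p N))"
    proof (rule runs_within_Seq[OF p[OF *]])
      fix s' Q' t assume "((s', Q'), t) \<in> set_spmf (exec c ((s, Q), 0))" and t: "t \<le> poly p N"
      then have e: "evolves ((s, Q), 0) ((s', Q'), t)" by (intro evolves_exec)
      have "fits (N + poly p N) s'" using evolvesD(4)[OF e *(3)] t by (auto intro: fits_mono)
      then show "runs_within d s' Q' (poly q (N + poly p N))"
        using q evolvesD(5,6)[OF e] * by blast
    qed
    then show ?thesis by (simp add: poly_pcompose)
  qed
  then show ?thesis unfolding qpt_iff by blast
qed

lemma qpt_Cond:
  assumes "qpt c" "qpt d"
  shows "qpt (Cond g c d)"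
proof -
  obtain p where p: "\<And>s Q N. unit_state Q \<Longrightarrow> owns s Q \<Longrightarrow> fits N s \<Longrightarrow> runs_within c s Q (poly p N)"
    using assms(1) unfolding qpt_iff by blast
  obtain q where q: "\<And>s Q N. unit_state Q \<Longrightarrow> owns s Q \<Longrightarrow> fits N s \<Longrightarrow> runs_within d s Q (poly q N)"
    using assms(2) unfolding qpt_iff by blast
  have "runs_within (Cond g c d) s Q (poly (1 + p + q) N)"
    if *: "unit_state Q" "owns s Q" "fits N s" for s Q N
  proof -
    have "runs_within (Cond g c d) s Q (Suc (poly p N + poly q N))"
      by (rule runs_within_Cond) (auto intro: runs_within_mono[OF p[OF *]] runs_within_mono[OF q[OF *]])
    then show ?thesis by simp
  qed
  then show ?thesis unfolding qpt_iff by blast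
qed

lemma lossless_step: "lossless_spmf (step i x)"
  by (cases x; cases i) (auto simp: Let_def split: list.splits)

lemma qpt_Do: "qpt (Do i)"
proof -
  have "runs_within (Do i) s Q (poly 1 N)" for s Q N
    by (auto simp: runs_within_def lossless_step)
  then show ?thesis unfolding qpt_iff by blast
qed

section \<open>Semantics and running times of classical programs\<close>

fun guard_reg :: "guard \<Rightarrow> nat" where
  "guard_reg (Nonempty r) = r"
| "guard_reg (Top r) = r"
| "guard_reg (QNonempty q) = q"

fun instr_sem :: "instr \<Rightarrow> (nat \<Rightarrow> bits) \<Rightarrow> nat \<Rightarrow> bits" where
  "instr_sem (Push r b) f = f(r := b # f r)"
| "instr_sem (Pop r) f = f(r := tl (f r))"
| "instr_sem (Copy r r') f = f(r' := f r)"
| "instr_sem _ f = f"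

fun guard_sem :: "guard \<Rightarrow> (nat \<Rightarrow> bits) \<Rightarrow> bool" where
  "guard_sem (Nonempty r) f \<longleftrightarrow> f r \<noteq> []"
| "guard_sem (Top r) f \<longleftrightarrow> f r \<noteq> [] \<and> hd (f r)"
| "guard_sem (QNonempty q) f \<longleftrightarrow> False"

text \<open>A loop is iterated as often as its guard register is long. This is adequate for the programs that
  satisfy \<open>counted\<close> below, whose loop bodies pop the guard register exactly once.\<close>

primrec sem :: "prog \<Rightarrow> (nat \<Rightarrow> bits) \<Rightarrow> nat \<Rightarrow> bits" where
  "sem (Do i) = instr_sem i"
| "sem (Seq c d) = (\<lambda>f. sem d (sem c f))"
| "sem (Cond g c d) = (\<lambda>f. if guard_sem g f then sem c f else sem d f)"
| "sem (While g c) = (\<lambda>f. ((\<lambda>f. if guard_sem g f then sem c f else f) ^^ length (f (guard_reg g))) f)"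

primrec time :: "prog \<Rightarrow> (nat \<Rightarrow> bits) \<Rightarrow> nat" where
  "time (Do i) = (\<lambda>f. 1)"
| "time (Seq c d) = (\<lambda>f. time c f + time d (sem c f))"
| "time (Cond g c d) = (\<lambda>f. Suc (if guard_sem g f then time c f else time d f))"
| "time (While g c) = (\<lambda>f. \<Sum>k<length (f (guard_reg g)).
     let h = ((\<lambda>f. if guard_sem g f then sem c f else f) ^^ k) f
     in if guard_sem g h then Suc (time c h) else 0)"

fun written :: "prog \<Rightarrow> nat set" where
  "written (Do (Push r b)) = {r}"
| "written (Do (Pop r)) = {r}"
| "written (Do (Copy r r')) = {r'}"
| "written (Do _) = {}"
| "written (Seq c d) = written c \<union> written d"
| "written (Cond g c d) = written c \<union> written d"
| "written (While g c) = written c"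

definition pops :: "nat \<Rightarrow> prog \<Rightarrow> bool" where
  "pops r c \<longleftrightarrow> (\<exists>d. c = Seq d (Do (Pop r)) \<and> r \<notin> written d)"

lemma pops_Seq [simp]: "pops r (Seq d (Do (Pop r'))) \<longleftrightarrow> r' = r \<and> r \<notin> written d"
  by (auto simp: pops_def)

fun counted :: "prog \<Rightarrow> bool" where
  "counted (Do i) \<longleftrightarrow> classical_instr i"
| "counted (Seq c d) \<longleftrightarrow> counted c \<and> counted d"
| "counted (Cond g c d) \<longleftrightarrow> classical_guard g \<and> counted c \<and> counted d"
| "counted (While g c) \<longleftrightarrow> classical_guard g \<and> counted c \<and> pops (guard_reg g) c"

lemma counted_classical: "counted c \<Longrightarrow> classical c"
  by (induction c) auto

lemma sem_frame: "r \<notin> written c \<Longrightarrow> sem c f r = f r"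
proof (induction c arbitrary: f)
  case (Do i)
  then show ?case by (cases i) auto
next
  case (While g c)
  have "((\<lambda>f. if guard_sem g f then sem c f else f) ^^ k) f r = f r" for k
    by (induction k) (use While in auto)
  then show ?case by simp
qed auto

lemma pops_sem: "pops r c \<Longrightarrow> sem c f r = tl (f r)"
  by (auto simp: pops_def sem_frame)

lemma guard_sem_nonempty: "guard_sem g f \<Longrightarrow> f (guard_reg g) \<noteq> []"
  by (cases g) auto

text \<open>The body shortens the guard register by one, so after one round the prescribed number of
  iterations is one less, and the bounded iteration obeys the recursion equation of the loop. Once
  the guard fails, every iteration is the identity.\<close>

lemma sem_While:
  assumes "pops (guard_reg g) c"
  shows "sem (While g c) f = (if guard_sem g f then sem (While g c) (sem c f) else f)"
proof (cases "guard_sem g f")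
  case True
  then obtain n where n: "length (f (guard_reg g)) = Suc n"
    using guard_sem_nonempty[OF True] by (cases "f (guard_reg g)") auto
  then have "length (sem c f (guard_reg g)) = n" by (simp add: pops_sem[OF assms])
  with n True show ?thesis by (simp add: funpow_Suc_right del: funpow.simps)
next
  case False
  have "((\<lambda>f. if guard_sem g f then sem c f else f) ^^ k) f = f" for k
    by (induction k) (use False in auto)
  with False show ?thesis by simp
qed

lemma time_While:
  assumes "pops (guard_reg g) c"
  shows "time (While g c) f = (if guard_sem g f then Suc (time c f) + time (While g c) (sem c f) else 0)"
proof (cases "guard_sem g f")
  case True
  then obtain n where n: "length (f (guard_reg g)) = Suc n"
    using guard_sem_nonempty[OF True] by (cases "f (guard_reg g)") auto
  then have "length (sem c f (guard_reg g)) = n" by (simp add: pops_sem[OF assms])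
  with n True show ?thesis by (simp add: funpow_Suc_right sum.lessThan_Suc_shift del: funpow.simps(2) sum.lessThan_Suc)
next
  case False
  have "((\<lambda>f. if guard_sem g f then sem c f else f) ^^ k) f = f" for k
    by (induction k) (use False in auto)
  with False show ?thesis by simp
qed

lemma holds_guard_sem: "classical_guard g \<Longrightarrow> holds g s = guard_sem g (creg s)"
  by (cases g) auto

text \<open>Replaces the probabilistic semantics by the functions \<open>sem\<close> and
  \<open>time\<close>, so that the concrete classical programs below can be verified by rewriting.
  Loops terminate because the guard register shrinks.\<close>

lemma exec_counted:
  "counted c \<Longrightarrow> exec c ((s, Q), t) = return_spmf ((s\<lparr>creg := sem c (creg s)\<rparr>, Q), t + time c (creg s))"
proof (induction c arbitrary: s t)
  case (Do i)
  then show ?case by (cases i) (auto simp: fun_upd_def)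
next
  case (Seq c d)
  then show ?case by (simp add: add.assoc)
next
  case (Cond g c d)
  then show ?case by (simp add: holds_guard_sem)
next
  case (While g c)
  then have pop: "pops (guard_reg g) c" by simp
  have "while_spmf (\<lambda>(s, t). holds g (fst s)) (\<lambda>(s, t). exec c (s, Suc t)) ((s, Q), t) =
    return_spmf ((s\<lparr>creg := sem (While g c) (creg s)\<rparr>, Q), t + time (While g c) (creg s))" for s t
  proof (induction "length (creg s (guard_reg g))" arbitrary: s t rule: less_induct)
    case less
    show ?case
    proof (cases "guard_sem g (creg s)")
      case True
      let ?s = "s\<lparr>creg := sem c (creg s)\<rparr>"
      have "length (creg ?s (guard_reg g)) < length (creg s (guard_reg g))"
        using guard_sem_nonempty[OF True] by (simp add: pops_sem[OF pop])
      from less[OF this, of "Suc t + time c (creg s)"] show ?thesis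
        using True While
        by (subst while_spmf.simps, subst sem_While[OF pop], subst time_While[OF pop])
          (simp add: holds_guard_sem ac_simps del: sem.simps time.simps)
    next
      case False
      then show ?thesis using While
        by (subst while_spmf.simps, subst sem_While[OF pop], subst time_While[OF pop])
          (simp add: holds_guard_sem)
    qed
  qed
  then show ?case by simp
qed

lemma run_counted: "counted c \<Longrightarrow> run c s Q = return_spmf (s\<lparr>creg := sem c (creg s)\<rparr>, Q)"
  by (simp add: run_def exec_counted)

section \<open>Polynomial bounds for nested loops\<close>

definition lens_le :: "nat set \<Rightarrow> nat \<Rightarrow> (nat \<Rightarrow> bits) \<Rightarrow> bool" where
  "lens_le X N f \<longleftrightarrow> (\<forall>r\<in>X. length (f r) \<le> N)"

text \<open>\<open>X\<close> contains the registers that control loops. They grow in no inner loop, so that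
  nested loops keep a polynomial bound; other registers may grow arbitrarily.\<close>

fun growth :: "nat set \<Rightarrow> prog \<Rightarrow> nat" where
  "growth X (Do (Push r b)) = (if r \<in> X then 1 else 0)"
| "growth X (Do _) = 0"
| "growth X (Seq c d) = growth X c + growth X d"
| "growth X (Cond g c d) = max (growth X c) (growth X d)"
| "growth X (While g c) = 0"

fun steady :: "nat set \<Rightarrow> prog \<Rightarrow> bool" where
  "steady X (Do (Copy r r')) \<longleftrightarrow> (r' \<in> X \<longrightarrow> r \<in> X)"
| "steady X (Do _) \<longleftrightarrow> True"
| "steady X (Seq c d) \<longleftrightarrow> steady X c \<and> steady X d"
| "steady X (Cond g c d) \<longleftrightarrow> steady X c \<and> steady X d"
| "steady X (While g c) \<longleftrightarrow> guard_reg g \<in> X \<and> steady X c \<and> growth X c = 0"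

lemma lens_le_mono: "lens_le X N f \<Longrightarrow> N \<le> M \<Longrightarrow> lens_le X M f"
  unfolding lens_le_def using order_trans by blast

lemma lens_le_funpow:
  assumes "\<And>f N. lens_le X N f \<Longrightarrow> lens_le X (N + a) (sem c f)" "lens_le X N f"
  shows "lens_le X (N + k * a) (((\<lambda>f. if guard_sem g f then sem c f else f) ^^ k) f)"
proof (induction k)
  case (Suc k)
  then show ?case using assms(1)[OF Suc.IH]
    by (auto simp: algebra_simps intro: lens_le_mono)
qed (simp add: assms(2))

text \<open>The guard register limits the number of rounds to \<open>N\<close>, and before each
  round the controlling registers have length at most \<open>N + N * a\<close>. A polynomial bound
  for one round thus gives one for the loop.\<close>

lemma time_While_le:
  assumes "\<And>f N. lens_le X N f \<Longrightarrow> lens_le X (N + a) (sem c f)" "\<And>f N. lens_le X N f \<Longrightarrow> time c f \<le> poly p N"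
    and f: "lens_le X N f" and g: "guard_reg g \<in> X"
  shows "time (While g c) f \<le> poly ([:0, 1:] * (1 + p \<circ>\<^sub>p [:0, 1 + a:])) N"
proof -
  let ?F = "\<lambda>f. if guard_sem g f then sem c f else f"
  have len: "length (f (guard_reg g)) \<le> N" using f g by (simp add: lens_le_def)
  have "(let h = (?F ^^ k) f in if guard_sem g h then Suc (time c h) else 0) \<le> Suc (poly p (N + N * a))"
    if "k < length (f (guard_reg g))" for k
  proof -
    have "lens_le X (N + k * a) ((?F ^^ k) f)" using assms(1) f by (rule lens_le_funpow)
    moreover have "N + k * a \<le> N + N * a" using that len by simp
    ultimately have "lens_le X (N + N * a) ((?F ^^ k) f)" by (rule lens_le_mono)
    then show ?thesis using assms(2) by (simp add: Let_def)
  qed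
  then have "time (While g c) f \<le> (\<Sum>k<length (f (guard_reg g)). Suc (poly p (N + N * a)))"
    unfolding time.simps by (intro sum_mono) auto
  also have "\<dots> \<le> N * Suc (poly p (N + N * a))"
    using mult_le_mono1[OF len, of "Suc (poly p (N + N * a))"] by simp
  finally show ?thesis by (simp add: poly_pcompose algebra_simps)
qed

lemma steady_bound:
  assumes "counted c" "steady X c"
  shows "(\<forall>f N. lens_le X N f \<longrightarrow> lens_le X (N + growth X c) (sem c f)) \<and>
    (\<exists>p. \<forall>f N. lens_le X N f \<longrightarrow> time c f \<le> poly p N)"
  using assms
proof (induction c)
  case (Do i)
  have "lens_le X (N + growth X (Do i)) (sem (Do i) f)" if "lens_le X N f" for f N
    using that Do by (cases i) (auto simp: lens_le_def le_SucI le_diff_conv)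
  moreover have "\<forall>f N. lens_le X N f \<longrightarrow> time (Do i) f \<le> poly 1 N" by simp
  ultimately show ?case by blast
next
  case (Seq c d)
  then obtain p q where c: "\<And>f N. lens_le X N f \<Longrightarrow> lens_le X (N + growth X c) (sem c f)"
    and d: "\<And>f N. lens_le X N f \<Longrightarrow> lens_le X (N + growth X d) (sem d f)"
    and p: "\<And>f N. lens_le X N f \<Longrightarrow> time c f \<le> poly p N"
    and q: "\<And>f N. lens_le X N f \<Longrightarrow> time d f \<le> poly q N" by auto
  have "time (Seq c d) f \<le> poly (p + q \<circ>\<^sub>p [:growth X c, 1:]) N" if "lens_le X N f" for f N
    using p[OF that] q[OF c[OF that]] by (simp add: poly_pcompose add.commute add_mono)
  moreover have "lens_le X (N + growth X (Seq c d)) (sem (Seq c d) f)" if "lens_le X N f" for f N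
    using d[OF c[OF that]] by (simp add: add.assoc)
  ultimately show ?case by blast
next
  case (Cond g c d)
  then obtain p q where c: "\<And>f N. lens_le X N f \<Longrightarrow> lens_le X (N + growth X c) (sem c f)"
    and d: "\<And>f N. lens_le X N f \<Longrightarrow> lens_le X (N + growth X d) (sem d f)"
    and p: "\<And>f N. lens_le X N f \<Longrightarrow> time c f \<le> poly p N"
    and q: "\<And>f N. lens_le X N f \<Longrightarrow> time d f \<le> poly q N" by auto
  have "time (Cond g c d) f \<le> poly (1 + p + q) N" if "lens_le X N f" for f N
    using p[OF that] q[OF that] by auto
  moreover have "lens_le X (N + growth X (Cond g c d)) (sem (Cond g c d) f)" if "lens_le X N f" for f N
    using c[OF that] d[OF that] by (auto intro: lens_le_mono)
  ultimately show ?case by blast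
next
  case (While g c)
  then obtain p where c: "\<And>f N. lens_le X N f \<Longrightarrow> lens_le X (N + growth X c) (sem c f)"
    and p: "\<And>f N. lens_le X N f \<Longrightarrow> time c f \<le> poly p N" by auto
  have "lens_le X (N + growth X (While g c)) (sem (While g c) f)" if "lens_le X N f" for f N
    using lens_le_funpow[OF c that] While.prems by simp
  moreover have "time (While g c) f \<le> poly ([:0, 1:] * (1 + p \<circ>\<^sub>p [:0, 1 + growth X c:])) N" if "lens_le X N f" for f N
    by (rule time_While_le[OF c p that]) (use While.prems in auto)
  ultimately show ?case by blast
qed

lemma qpt_counted:
  assumes "counted c" and p: "\<And>f N. lens_le X N f \<Longrightarrow> time c f \<le> poly p N"
  shows "qpt c"
proof -
  have "runs_within c s Q (poly p N)" if "fits N s" for s Q N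
    using p[of N "creg s"] that by (simp add: runs_within_def exec_counted[OF assms(1)] lens_le_def fits_def)
  then show ?thesis unfolding qpt_iff by blast
qed

lemma qpt_steady: "counted c \<Longrightarrow> steady X c \<Longrightarrow> qpt c"
  using steady_bound[of c X] qpt_counted[of c X] by blast

text \<open>In contrast to \<open>steady\<close>, the body may lengthen controlling registers. An
  outermost loop adds at most a constant per round, hence a linear amount in total; only a further
  loop around it could compound the growth.\<close>

lemma qpt_While:
  assumes "counted (While g c)" "steady X c" "guard_reg g \<in> X"
  shows "qpt (While g c)"
proof -
  have "counted c" using assms(1) by simp
  from steady_bound[OF this assms(2)] obtain p where
    c: "\<And>f N. lens_le X N f \<Longrightarrow> lens_le X (N + growth X c) (sem c f)"
    and p: "\<And>f N. lens_le X N f \<Longrightarrow> time c f \<le> poly p N" by blast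
  show ?thesis using qpt_counted[OF assms(1)] time_While_le[OF c p _ assms(3)] by blast
qed

section \<open>Table circuits and their puncturing\<close>

definition wires :: "bits \<Rightarrow> gate list \<Rightarrow> bits" where
  "wires vs gs = foldl (\<lambda>vs g. vs @ [gate_value vs g]) vs gs"

lemma wires_simps [simp]:
  "wires vs [] = vs"
  "wires vs (g # gs) = wires (vs @ [gate_value vs g]) gs"
  by (simp_all add: wires_def)

lemma wires_append: "wires vs (gs @ hs) = wires (wires vs gs) hs"
  by (simp add: wires_def)

lemma length_wires [simp]: "length (wires vs gs) = length vs + length gs"
  by (induction gs arbitrary: vs) auto

lemma nth_wires: "i < length vs \<Longrightarrow> wires vs gs ! i = vs ! i"
  by (induction gs arbitrary: vs) (auto simp: nth_append)

lemma eval_circuit_wires: "eval_circuit C x = map ((!) (wires x (gates C))) (outputs C)"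
  by (simp add: eval_circuit_def wires_def)

fun gates_ok :: "nat \<Rightarrow> gate list \<Rightarrow> bool" where
  "gates_ok w [] \<longleftrightarrow> True"
| "gates_ok w (g # gs) \<longleftrightarrow> gate_ok w g \<and> gates_ok (Suc w) gs"

lemma gates_ok_iff: "gates_ok w gs \<longleftrightarrow> (\<forall>i < length gs. gate_ok (w + i) (gs ! i))"
  by (induction w gs rule: gates_ok.induct) (auto simp: less_Suc_eq_0_disj)

lemma gates_ok_append: "gates_ok w (gs @ hs) \<longleftrightarrow> gates_ok w gs \<and> gates_ok (w + length gs) hs"
  by (induction gs arbitrary: w) auto

text \<open>A chain of multiplexers, four gates for every bit \<open>p\<close> of a point: wire \<open>t + 4\<close> carries the
  value of \<open>t\<close> if input \<open>i\<close> equals \<open>p\<close>, and the value of \<open>r\<close> otherwise.\<close>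

fun mux_gates :: "nat \<Rightarrow> nat \<Rightarrow> nat \<Rightarrow> bits \<Rightarrow> gate list" where
  "mux_gates t r i [] = []"
| "mux_gates t r i (p # ps) =
     [Nand i i, Nand i (if p then t else r), Nand (Suc t) (if p then r else t), Nand (t + 2) (t + 3)] @
     mux_gates (t + 4) r (Suc i) ps"

lemma length_mux_gates [simp]: "length (mux_gates t r i ps) = 4 * length ps"
  by (induction ps arbitrary: t i) auto

lemma gates_ok_mux: "r \<le> t \<Longrightarrow> i + length ps \<le> Suc t \<Longrightarrow> gates_ok (Suc t) (mux_gates t r i ps)"
proof (induction ps arbitrary: t i)
  case (Cons p ps)
  then have "gates_ok (Suc (t + 4)) (mux_gates (t + 4) r (Suc i) ps)" by (intro Cons.IH) auto
  then show ?case using Cons.prems by (simp add: numeral_eq_Suc)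
qed simp

text \<open>The four NANDs compute "\<open>i\<close> and \<open>a\<close>, or not \<open>i\<close>
  and \<open>b\<close>". Exchanging \<open>a\<close> and \<open>b\<close> according to the bit
  \<open>p\<close> turns agreement of input \<open>i\<close> with \<open>p\<close> into selection of
  wire \<open>t\<close>.\<close>

lemma wires_mux_step:
  assumes "length vs = Suc t" "i \<le> t" "r \<le> t"
  shows "wires vs [Nand i i, Nand i (if p then t else r), Nand (Suc t) (if p then r else t), Nand (t + 2) (t + 3)] =
    (let a = vs ! (if p then t else r); b = vs ! (if p then r else t)
     in vs @ [\<not> vs ! i, \<not> (vs ! i \<and> a), \<not> (\<not> vs ! i \<and> b), vs ! i \<and> a \<or> \<not> vs ! i \<and> b])"
  using assms by (cases p) (simp_all add: nth_append numeral_2_eq_2 numeral_3_eq_3 Let_def)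

text \<open>Once a bit disagrees, the carried value is that of wire \<open>r\<close>, and all later
  multiplexers choose between two copies of it. The value of \<open>t\<close> survives exactly when
  all bits agree.\<close>

lemma wires_mux:
  assumes "length (x @ ws) = Suc t" "r \<le> t" "i + length ps \<le> length x"
  shows "wires (x @ ws) (mux_gates t r i ps) ! (t + 4 * length ps) =
    (if take (length ps) (drop i x) = ps then (x @ ws) ! t else (x @ ws) ! r)"
  using assms
proof (induction ps arbitrary: ws t i)
  case (Cons p ps)
  let ?vs = "x @ ws"
  let ?gs = "[Nand i i, Nand i (if p then t else r), Nand (Suc t) (if p then r else t), Nand (t + 2) (t + 3)]"
  have i: "i < length x" using Cons.prems by simp
  have idx: "i < length ?vs" "r < length ?vs" "t < length ?vs" using Cons.prems by auto
  define ws' where "ws' = ws @ (let a = ?vs ! (if p then t else r); b = ?vs ! (if p then r else t)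
     in [\<not> ?vs ! i, \<not> (?vs ! i \<and> a), \<not> (\<not> ?vs ! i \<and> b), ?vs ! i \<and> a \<or> \<not> ?vs ! i \<and> b])"
  have ws': "wires ?vs ?gs = x @ ws'"
  proof -
    have "i \<le> t" "r \<le> t" using idx Cons.prems(1) by auto
    from wires_mux_step[OF Cons.prems(1) this, of p] show ?thesis
      unfolding ws'_def Let_def append_assoc .
  qed
  have len: "length (x @ ws') = Suc (t + 4)" using Cons.prems by (simp add: ws'_def Let_def)
  have "(x @ ws') ! (t + 4) = (if x ! i = p then ?vs ! t else ?vs ! r)"
  proof -
    have *: "(vs @ [a, b, c, d]) ! (t + 4) = d" if "length vs = Suc t" for vs a b c and d :: bool
      using that by (simp add: nth_append numeral_eq_Suc)
    have "?vs ! i = x ! i" using i by (simp add: nth_append)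
    then show ?thesis
      unfolding ws'_def Let_def append_assoc[symmetric] *[OF Cons.prems(1)] by auto
  qed
  moreover have "(x @ ws') ! r = ?vs ! r"
    unfolding ws'_def append_assoc[symmetric] using idx(2) by (rule nth_append_left)
  moreover have "take (length (p # ps)) (drop i x) = p # ps \<longleftrightarrow> x ! i = p \<and> take (length ps) (drop (Suc i) x) = ps"
    using i by (simp flip: Cons_nth_drop_Suc)
  moreover have "wires (x @ ws') (mux_gates (t + 4) r (Suc i) ps) ! (t + 4 + 4 * length ps) =
     (if take (length ps) (drop (Suc i) x) = ps then (x @ ws') ! (t + 4) else (x @ ws') ! r)"
    using Cons.prems by (intro Cons.IH len) auto
  moreover have "wires ?vs (mux_gates t r i (p # ps)) = wires (x @ ws') (mux_gates (t + 4) r (Suc i) ps)"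
    unfolding mux_gates.simps wires_append ws' ..
  ultimately show ?case by (simp add: ac_simps)
qed simp

text \<open>Wire \<open>t\<close> is the last one so far and carries the value of the entries read
  before. The constant of the next entry lies on wire \<open>Suc t\<close>, and the chain prefers it
  to wire \<open>t\<close> if the input is \<open>p\<close>; hence later entries win. One entry
  takes \<open>1 + 4 * length p\<close> wires.\<close>

fun point_gates :: "nat \<Rightarrow> (bits \<times> bool) list \<Rightarrow> gate list" where
  "point_gates t [] = []"
| "point_gates t ((p, v) # tbl) = Const v # mux_gates (Suc t) t 0 p @ point_gates (Suc t + 4 * length p) tbl"

definition table_value :: "(bits \<times> bool) list \<Rightarrow> bits \<Rightarrow> bool" where
  "table_value tbl x = foldl (\<lambda>d (p, v). if x = p then v else d) False tbl"

definition table_circuit :: "nat \<Rightarrow> (bits \<times> bool) list \<Rightarrow> circuit" where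
  "table_circuit n tbl =
     Circuit n (Const False # point_gates n tbl) [n + length tbl * Suc (4 * n)]"

lemma length_point_gates:
  "(\<And>p v. (p, v) \<in> set tbl \<Longrightarrow> length p = n) \<Longrightarrow> length (point_gates t tbl) = length tbl * Suc (4 * n)"
proof (induction t tbl rule: point_gates.induct)
  case (2 t p v tbl)
  then have "length p = n" "length (point_gates (Suc t + 4 * length p) tbl) = length tbl * Suc (4 * n)" by auto
  then show ?case by simp
qed simp

lemma gates_ok_point:
  "(\<And>p v. (p, v) \<in> set tbl \<Longrightarrow> length p = n) \<Longrightarrow> n \<le> Suc t \<Longrightarrow> gates_ok (Suc t) (point_gates t tbl)"
proof (induction t tbl rule: point_gates.induct)
  case (2 t p v tbl)
  then have "length p = n" "gates_ok (Suc (Suc t + 4 * length p)) (point_gates (Suc t + 4 * length p) tbl)" by auto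
  then show ?case using 2(3) by (simp add: gates_ok_append gates_ok_mux)
qed simp

lemma wires_point:
  "(\<And>p v. (p, v) \<in> set tbl \<Longrightarrow> length p = length x) \<Longrightarrow> length (x @ ws) = Suc t \<Longrightarrow>
   wires (x @ ws) (point_gates t tbl) ! (t + length tbl * Suc (4 * length x)) =
     foldl (\<lambda>d (p, v). if x = p then v else d) ((x @ ws) ! t) tbl"
proof (induction t tbl arbitrary: ws rule: point_gates.induct)
  case (2 t p v tbl)
  have p: "length p = length x" using 2(2)[of p v] by simp
  let ?ws = "ws @ [v]"
  have len: "length (x @ ?ws) = Suc (Suc t)" using 2(3) by simp
  \<comment> \<open>The input stays a prefix of the wires, which brings them into the form
    \<open>x @ ws'\<close> of the induction hypothesis.\<close>
  obtain ws' where ws': "wires (x @ ?ws) (mux_gates (Suc t) t 0 p) = x @ ws'"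
  proof
    have "take (length x) (wires (x @ ?ws) (mux_gates (Suc t) t 0 p)) = x"
      by (rule nth_equalityI) (auto simp: nth_wires nth_append)
    then show "wires (x @ ?ws) (mux_gates (Suc t) t 0 p) = x @ drop (length x) (wires (x @ ?ws) (mux_gates (Suc t) t 0 p))"
      by (metis append_take_drop_id)
  qed
  have len': "length (x @ ws') = Suc (Suc t + 4 * length p)"
    using arg_cong[OF ws', of length] len by simp
  have "(x @ ws') ! (Suc t + 4 * length p) = (if x = p then (x @ ?ws) ! Suc t else (x @ ?ws) ! t)"
    using wires_mux[OF len, of t 0 p] p unfolding ws' by auto
  also have "\<dots> = (if x = p then v else (x @ ws) ! t)"
  proof -
    have *: "(vs @ [v]) ! Suc t = v" "(vs @ [v]) ! t = vs ! t" if "length vs = Suc t" for vs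
      using that by (simp_all add: nth_append)
    have "x @ ws @ [v] = (x @ ws) @ [v]" by simp
    then show ?thesis by (simp only: *[OF 2(3)])
  qed
  finally have val: "(x @ ws') ! (Suc t + 4 * length p) = (if x = p then v else (x @ ws) ! t)" .
  have "wires (x @ ws') (point_gates (Suc t + 4 * length p) tbl) ! (Suc t + 4 * length p + length tbl * Suc (4 * length x)) =
     foldl (\<lambda>d (p, v). if x = p then v else d) ((x @ ws') ! (Suc t + 4 * length p)) tbl"
    by (rule 2(1)[OF _ len']) (use 2(2) in auto)
  moreover have "wires (x @ ws) (point_gates t ((p, v) # tbl)) = wires (x @ ws') (point_gates (Suc t + 4 * length p) tbl)"
    unfolding point_gates.simps wires_simps wires_append gate_value.simps append_assoc ws' ..
  moreover have "t + length ((p, v) # tbl) * Suc (4 * length x) = Suc t + 4 * length p + length tbl * Suc (4 * length x)"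
    by (simp add: p)
  ultimately show ?case by (simp only: val foldl_Cons prod.case)
qed simp

lemma eval_table_circuit:
  assumes "\<And>p v. (p, v) \<in> set tbl \<Longrightarrow> length p = n" "length x = n"
  shows "eval_circuit (table_circuit n tbl) x = [table_value tbl x]"
  using wires_point[of tbl x "[False]" n] assms nth_append_length[of x False "[]"]
  by (simp add: eval_circuit_wires table_circuit_def table_value_def)

lemma circuit_io_table:
  assumes "\<And>p v. (p, v) \<in> set tbl \<Longrightarrow> length p = n"
  shows "circuit_io n 1 (table_circuit n tbl)"
proof -
  have "gates_ok n (Const False # point_gates n tbl)"
    using gates_ok_point[of tbl n n, OF assms] by simp
  then show ?thesis using length_point_gates[of tbl n n, OF assms]
    unfolding gates_ok_iff by (simp add: circuit_io_def table_circuit_def)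
qed

lemma circuit_size_table:
  assumes "\<And>p v. (p, v) \<in> set tbl \<Longrightarrow> length p = n"
  shows "circuit_size (table_circuit n tbl) = n + 2 + length tbl * Suc (4 * n)"
  using length_point_gates[of tbl n n, OF assms] by (simp add: circuit_size_def table_circuit_def)

lemma table_value_3:
  "table_value [(p3, v3), (p2, v2), (p1, v1)] x =
     (if x = p1 then v1 else if x = p2 then v2 else x = p3 \<and> v3)"
  by (simp add: table_value_def)

text \<open>These are the entries left by puncturing the zero circuit twice at \<open>y\<close> with
  value \<open>v\<close>: a base entry with value 0 and two equal entries that override it. With
  \<open>v\<close> false, the same shape is the zero circuit.\<close>

definition point_circuit :: "nat \<Rightarrow> bits \<Rightarrow> bool \<Rightarrow> circuit" where
  "point_circuit l y v = table_circuit l [(y, False), (y, v), (y, v)]"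

text \<open>A key starts with the value of the circuit at the point in its tail. When this value is 0 the
  point is immaterial, and the choice of \<open>xB\<close> makes a punctured zero circuit equal, as a circuit, to
  a \<open>point_circuit\<close>.\<close>

definition point_class :: keyed_class where
  "point_class = \<lparr>keys = (\<lambda>l. {k. length k = Suc l}), inlen = (\<lambda>l. l), outlen = (\<lambda>l. 1),
     csize = (\<lambda>l. l + 2 + 3 * Suc (4 * l)),
     circ = (\<lambda>l k. point_circuit l (tl k) (hd k)),
     gen_puncture = (\<lambda>l k xB xC \<mu>B \<mu>C. table_circuit l
       [(if hd k then tl k else xB, hd k), (xC, hd (eval_circuit \<mu>C xC)), (xB, hd (eval_circuit \<mu>B xB))])\<rparr>"

lemma eval_point_circuit: "length y = l \<Longrightarrow> length x = l \<Longrightarrow> eval_circuit (point_circuit l y v) x = [x = y \<and> v]"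
  by (subst point_circuit_def, subst eval_table_circuit) (auto simp: table_value_3)

lemma length_eval_circuit: "circuit_io n m C \<Longrightarrow> length (eval_circuit C x) = m"
  by (simp add: eval_circuit_wires circuit_io_def)

lemma poly_bounded_linear: "poly_bounded (\<lambda>l. a * l + b)"
  unfolding poly_bounded_def by (rule exI[of _ "[:b, a:]"]) simp

lemma keyed_circuit_class_point: "keyed_circuit_class point_class"
proof -
  have "poly_bounded (\<lambda>l. l)" "poly_bounded (\<lambda>l. 1)" "poly_bounded (\<lambda>l. l + 2 + 3 * Suc (4 * l))"
    \<comment> \<open>The size is \<open>l + 2 + 3 * (4 * l + 1) = 13 * l + 5\<close>.\<close>
    using poly_bounded_linear[of 1 0] poly_bounded_linear[of 0 1] poly_bounded_linear[of 13 5]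
    by (simp_all add: algebra_simps)
  moreover have "circuit_io l 1 (point_circuit l y v)" "circuit_size (point_circuit l y v) = l + 2 + 3 * Suc (4 * l)"
    if "length y = l" for l y v
    unfolding point_circuit_def using that by (intro circuit_io_table, auto) (subst circuit_size_table, auto)
  ultimately show ?thesis by (simp add: keyed_circuit_class_def point_class_def)
qed

text \<open>The entry for \<open>xB\<close> is the last, so it prevails when the two points
  coincide, as the specification asks. If the first bit of the key is 0, the base entry only repeats
  the default value, so its point may be chosen freely.\<close>

lemma puncture_correct_point: "puncture_correct point_class"
  unfolding puncture_correct_def
proof (intro allI ballI impI)
  fix l and k xB xC :: bits and \<mu>B \<mu>C :: circuit
  assume k: "k \<in> keys point_class l" and
    *: "length xB = inlen point_class l \<and> length xC = inlen point_class l \<and>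
     circuit_io (inlen point_class l) (outlen point_class l) \<mu>B \<and> circuit_io (inlen point_class l) (outlen point_class l) \<mu>C"
  obtain v y where vy: "k = v # y" "length y = l" using k by (cases k) (auto simp: point_class_def)
  have len: "length xB = l" "length xC = l" "length (eval_circuit \<mu>B xB) = 1" "length (eval_circuit \<mu>C xC) = 1"
    using * by (auto simp: point_class_def length_eval_circuit)
  then obtain vB vC where v: "eval_circuit \<mu>B xB = [vB]" "eval_circuit \<mu>C xC = [vC]"
    by (auto simp: length_Suc_conv)
  let ?tbl = "[(if v then y else xB, v), (xC, vC), (xB, vB)]"
  have tbl: "\<And>p u. (p, u) \<in> set ?tbl \<Longrightarrow> length p = l" using vy len by (auto split: if_splits)
  have "eval_circuit (table_circuit l ?tbl) x = [table_value ?tbl x]" if "length x = l" for x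
    using eval_table_circuit[OF tbl that] .
  moreover have "circuit_io l 1 (table_circuit l ?tbl)" by (rule circuit_io_table) (rule tbl)
  moreover have "circuit_size (table_circuit l ?tbl) = l + 2 + 3 * Suc (4 * l)"
    by (subst circuit_size_table[of ?tbl l]) (auto intro: tbl)
  ultimately show "let G = gen_puncture point_class l k xB xC \<mu>B \<mu>C in
      circuit_io (inlen point_class l) (outlen point_class l) G \<and> circuit_size G = csize point_class l \<and>
      (\<forall>x. length x = inlen point_class l \<and> x \<notin> {xB, xC} \<longrightarrow> eval_circuit G x = eval_circuit (circ point_class l k) x) \<and>
      eval_circuit G xB = eval_circuit \<mu>B xB \<and> (xC \<noteq> xB \<longrightarrow> eval_circuit G xC = eval_circuit \<mu>C xC)"
    using len vy v
    by (auto simp: point_class_def table_value_3 eval_point_circuit)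
qed

section \<open>Programs that write and evaluate circuits\<close>

text \<open>The final pop gives every loop the form that \<open>counted\<close> requires, provided
  the body leaves the guard register alone.\<close>

definition loop :: "guard \<Rightarrow> prog \<Rightarrow> prog" where
  "loop g c = While g (Seq c (Do (Pop (guard_reg g))))"

lemma sem_loop:
  assumes "guard_reg g \<notin> written c"
  shows "sem (loop g c) f =
    (if guard_sem g f then sem (loop g c) ((sem c f)(guard_reg g := tl (f (guard_reg g)))) else f)"
  using sem_While[of g "Seq c (Do (Pop (guard_reg g)))" f] assms
  by (simp add: loop_def sem_frame del: sem.simps(4))

lemma counted_loop [simp]:
  "counted (loop g c) \<longleftrightarrow> classical_guard g \<and> counted c \<and> guard_reg g \<notin> written c"
  by (auto simp: loop_def)

lemma written_loop [simp]: "written (loop g c) = insert (guard_reg g) (written c)"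
  by (auto simp: loop_def)

lemma steady_loop [simp]: "steady X (loop g c) \<longleftrightarrow> guard_reg g \<in> X \<and> steady X c \<and> growth X c = 0"
  by (auto simp: loop_def)

lemma growth_loop [simp]: "growth X (loop g c) = 0"
  by (simp add: loop_def)

lemma qpt_loop:
  assumes "counted (loop g c)" "steady X c" "guard_reg g \<in> X"
  shows "qpt (loop g c)"
  using assms qpt_While[of g "Seq c (Do (Pop (guard_reg g)))" X] by (simp add: loop_def)

primrec seq :: "prog list \<Rightarrow> prog" where
  "seq [] = Do Skip"
| "seq (c # cs) = Seq c (seq cs)"

lemma qpt_seq: "(\<And>c. c \<in> set cs \<Longrightarrow> qpt c) \<Longrightarrow> qpt (seq cs)"
  by (induction cs) (auto intro: qpt_Seq qpt_Do)

definition copies :: "nat \<Rightarrow> nat list \<Rightarrow> prog" where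
  "copies r rs = seq (map (\<lambda>r'. Do (Copy r r')) rs)"

lemma copies [simp]:
  "counted (copies r rs)" "steady {} (copies r rs)" "written (copies r rs) = set rs"
  by (induction rs) (auto simp: copies_def)

lemma sem_copies: "r \<notin> set rs \<Longrightarrow> sem (copies r rs) f = (\<lambda>k. if k \<in> set rs then f r else f k)"
  unfolding copies_def by (induction rs arbitrary: f) (auto simp: fun_eq_iff)

definition pushes :: "nat \<Rightarrow> bits \<Rightarrow> prog" where
  "pushes r bs = seq (map (\<lambda>b. Do (Push r b)) bs)"

lemma pushes [simp]: "counted (pushes r bs)" "steady {} (pushes r bs)" "written (pushes r bs) = (if bs = [] then {} else {r})"
    "r \<notin> X \<Longrightarrow> steady X (pushes r bs)" "r \<notin> X \<Longrightarrow> growth X (pushes r bs) = 0"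
  by (induction bs) (auto simp: pushes_def)

lemma sem_pushes [simp]: "sem (pushes r bs) f = f(r := rev bs @ f r)"
  unfolding pushes_def by (induction bs arbitrary: f) auto

lemma qpt_straight [simp]: "qpt (Do i)" "qpt (copies r rs)" "qpt (pushes r bs)"
  by (auto intro: qpt_Do qpt_steady[where X = "{}"])

definition push_top :: "nat \<Rightarrow> nat \<Rightarrow> prog" where
  "push_top a b = Cond (Top a) (Do (Push b True)) (Do (Push b False))"

lemma push_top [simp]: "counted (push_top a b)" "steady X (push_top a b)" "written (push_top a b) = {b}"
    "growth X (push_top a b) = (if b \<in> X then 1 else 0)"
  by (auto simp: push_top_def)

lemma sem_push_top [simp]: "sem (push_top a b) f = f(b := bit_of (f a) # f b)"
  by (auto simp: push_top_def bit_of_def fun_eq_iff)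

definition reverse_onto :: "nat \<Rightarrow> nat \<Rightarrow> prog" where
  "reverse_onto a b = loop (Nonempty a) (push_top a b)"

lemma reverse_onto [simp]: "a \<noteq> b \<Longrightarrow> counted (reverse_onto a b)" "written (reverse_onto a b) = {a, b}"
    "steady X (reverse_onto a b) \<longleftrightarrow> a \<in> X \<and> b \<notin> X" "growth X (reverse_onto a b) = 0"
  by (auto simp: reverse_onto_def)

lemma sem_reverse_onto [simp]:
  assumes "a \<noteq> b"
  shows "sem (reverse_onto a b) f = f(a := [], b := rev (f a) @ f b)"
proof (induction "f a" arbitrary: f)
  case Nil
  then show ?case using assms by (simp add: reverse_onto_def sem_loop fun_upd_idem)
next
  case (Cons x xs)
  let ?f = "f(b := x # f b, a := xs)"
  have "sem (reverse_onto a b) f = sem (reverse_onto a b) ?f"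
    using assms Cons(2) unfolding reverse_onto_def by (subst sem_loop) (auto simp: bit_of_def simp flip: Cons(2))
  also have "\<dots> = ?f(a := [], b := rev (?f a) @ ?f b)" by (rule Cons(1)) (use assms in simp)
  finally show ?case using assms by (simp flip: Cons(2) add: fun_upd_twist)
qed

definition push_each :: "nat \<Rightarrow> nat \<Rightarrow> nat \<Rightarrow> prog" where
  "push_each a m b = loop (Nonempty a) (pushes b (replicate m True))"

lemma push_each [simp]: "a \<noteq> b \<Longrightarrow> counted (push_each a m b)" "m \<noteq> 0 \<Longrightarrow> written (push_each a m b) = {a, b}"
    "b \<notin> X \<Longrightarrow> steady X (push_each a m b) \<longleftrightarrow> a \<in> X" "growth X (push_each a m b) = 0"
  by (auto simp: push_each_def)

lemma sem_push_each [simp]: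
  assumes "a \<noteq> b"
  shows "sem (push_each a m b) f = f(a := [], b := replicate (m * length (f a)) True @ f b)"
proof (induction "f a" arbitrary: f)
  case Nil
  then show ?case using assms by (simp add: push_each_def sem_loop fun_upd_idem)
next
  case (Cons x xs)
  let ?f = "f(b := replicate m True @ f b, a := xs)"
  have "sem (push_each a m b) f = sem (push_each a m b) ?f"
    using assms unfolding push_each_def by (subst sem_loop) (auto simp flip: Cons(2))
  also have "\<dots> = ?f(a := [], b := replicate (m * length (?f a)) True @ ?f b)" by (rule Cons(1)) (use assms in simp)
  also have "\<dots> = f(a := [], b := replicate (m * length xs) True @ replicate m True @ f b)"
    using assms by (auto simp: fun_eq_iff)
  also have "replicate (m * length xs) True @ replicate m True @ f b = replicate (m * length (f a)) True @ f b"
    unfolding Cons(2)[symmetric] append_assoc[symmetric] replicate_add[symmetric] by (simp add: add.commute)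
  finally show ?case .
qed

text \<open>Output is produced in reverse order on register 20. Register 40 is never written and is
  empty in the intended runs.\<close>

definition emit_unary :: "nat \<Rightarrow> prog" where
  "emit_unary a = seq [Do (Copy a 21), push_each 21 1 20, pushes 20 [False]]"

lemma emit_unary [simp]: "counted (emit_unary a)" "written (emit_unary a) = {20, 21}"
    "20 \<notin> X \<Longrightarrow> 21 \<in> X \<Longrightarrow> a \<in> X \<Longrightarrow> steady X (emit_unary a)" "20 \<notin> X \<Longrightarrow> growth X (emit_unary a) = 0"
  by (auto simp: emit_unary_def)

lemma rev_unary: "rev (unary n) = False # replicate n True"
  by (simp add: unary_def)

lemma sem_emit_unary [simp]:
  "a \<noteq> 20 \<Longrightarrow> sem (emit_unary a) f = f(21 := [], 20 := rev (unary (length (f a))) @ f 20)"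
  by (auto simp: emit_unary_def rev_unary fun_eq_iff)

definition emit_nand :: "nat \<Rightarrow> nat \<Rightarrow> prog" where
  "emit_nand a b = seq [pushes 20 [True], emit_unary a, emit_unary b]"

lemma emit_nand [simp]: "counted (emit_nand a b)" "written (emit_nand a b) = {20, 21}"
    "20 \<notin> X \<Longrightarrow> 21 \<in> X \<Longrightarrow> a \<in> X \<Longrightarrow> b \<in> X \<Longrightarrow> steady X (emit_nand a b)" "20 \<notin> X \<Longrightarrow> growth X (emit_nand a b) = 0"
  by (auto simp: emit_nand_def)

lemma sem_emit_nand [simp]:
  "a \<noteq> 20 \<Longrightarrow> b \<noteq> 20 \<Longrightarrow> a \<noteq> 21 \<Longrightarrow> b \<noteq> 21 \<Longrightarrow> sem (emit_nand a b) f =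
    f(21 := [], 20 := rev (encode_gate (Nand (length (f a)) (length (f b)))) @ f 20)"
  by (auto simp: emit_nand_def fun_eq_iff)

text \<open>Registers 22, 23 and 24 hold the arguments \<open>t\<close>, \<open>r\<close> and \<open>i\<close> of \<open>mux_gates\<close> in unary.\<close>

definition emit_mux_step :: "nat \<Rightarrow> prog" where
  "emit_mux_step a = seq
     [emit_nand 24 24,
      Cond (Top a) (emit_nand 24 22) (emit_nand 24 23),
      Do (Copy 22 25), pushes 22 [True],
      Cond (Top a) (emit_nand 22 23) (emit_nand 22 25),
      pushes 22 [True], Do (Copy 22 26), pushes 22 [True],
      emit_nand 26 22, pushes 22 [True], pushes 24 [True]]"

definition emit_mux :: "nat \<Rightarrow> prog" where
  "emit_mux a = loop (Nonempty a) (emit_mux_step a)"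

lemma emit_mux_step [simp]: "counted (emit_mux_step a)" "written (emit_mux_step a) = {20, 21, 22, 24, 25, 26}"
  by (auto simp: emit_mux_step_def)

lemma steady_emit_mux_step [simp]: "20 \<notin> X \<Longrightarrow> {21, 22, 23, 24, 25, 26} \<subseteq> X \<Longrightarrow> steady X (emit_mux_step a)"
  by (simp add: emit_mux_step_def pushes_def)

lemma sem_emit_mux_step:
  assumes "a \<notin> {20..26}" "f a = p # ps" "length (f 22) = t" "length (f 23) = r" "length (f 24) = i"
  shows "sem (emit_mux_step a) f 20 = rev (concat (map encode_gate
      [Nand i i, Nand i (if p then t else r), Nand (Suc t) (if p then r else t), Nand (t + 2) (t + 3)])) @ f 20"
    "length (sem (emit_mux_step a) f 22) = t + 4" "length (sem (emit_mux_step a) f 24) = Suc i"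
    "sem (emit_mux_step a) f 23 = f 23"
  proof -
  have 3: "t + 2 = Suc (Suc t)" "t + 3 = Suc (Suc (Suc t))" "t + 4 = Suc (Suc (Suc (Suc t)))" by simp_all
  have a: "a \<noteq> 20" "a \<noteq> 21" "a \<noteq> 22" "a \<noteq> 25" using assms(1) by auto
  show "sem (emit_mux_step a) f 20 = rev (concat (map encode_gate
      [Nand i i, Nand i (if p then t else r), Nand (Suc t) (if p then r else t), Nand (t + 2) (t + 3)])) @ f 20"
    "length (sem (emit_mux_step a) f 22) = t + 4" "length (sem (emit_mux_step a) f 24) = Suc i"
    "sem (emit_mux_step a) f 23 = f 23"
    unfolding 3 using a assms(2-5) by (simp_all add: emit_mux_step_def del: encode_gate.simps)
qed

lemma sem_emit_mux:
  assumes "a \<notin> {20..26}" "f a = ps" "length (f 22) = t" "length (f 23) = r" "length (f 24) = i"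
  shows "sem (emit_mux a) f 20 = rev (concat (map encode_gate (mux_gates t r i ps))) @ f 20 \<and>
    length (sem (emit_mux a) f 22) = t + 4 * length ps"
  using assms
proof (induction ps arbitrary: f t i)
  case Nil
  then show ?case unfolding emit_mux_def by (subst (1 2) sem_loop) auto
next
  case (Cons p ps)
  let ?f = "(sem (emit_mux_step a) f)(a := ps)"
  have a: "a \<noteq> 20" "a \<noteq> 22" "a \<noteq> 23" "a \<noteq> 24" using Cons.prems(1) by auto
  note step = sem_emit_mux_step[OF Cons.prems]
  have "sem (emit_mux a) f = sem (emit_mux a) ?f"
    using Cons.prems unfolding emit_mux_def by (subst sem_loop) auto
  moreover have "sem (emit_mux a) ?f 20 = rev (concat (map encode_gate (mux_gates (t + 4) r (Suc i) ps))) @ ?f 20 \<and>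
    length (sem (emit_mux a) ?f 22) = t + 4 + 4 * length ps"
    using a step Cons.prems by (intro Cons.IH) auto
  ultimately show ?case using a step(1) by simp
qed

text \<open>The previous last wire becomes \<open>r\<close> and its successor \<open>t\<close>.
  Copying the empty register 40 resets the input index, and the pushed \<open>False\<close> followed
  by the value bit is the code of a \<open>Const\<close> gate.\<close>

definition emit_point :: "nat \<Rightarrow> nat \<Rightarrow> prog" where
  "emit_point a b = seq [Do (Copy 22 23), pushes 22 [True], Do (Copy 40 24), pushes 20 [False], push_top b 20, emit_mux a]"

lemma emit_point [simp]: "a \<notin> {20..26} \<Longrightarrow> counted (emit_point a b)" "written (emit_point a b) = insert a {20..26}"
  by (auto simp: emit_point_def emit_mux_def)

lemma qpt_emit_mux: "a \<notin> {20..26} \<Longrightarrow> qpt (emit_mux a)"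
  \<comment> \<open>Registers 22 and 24 grow in every round, as an outermost loop permits. The
    output register 20 grows in inner loops and is therefore kept out of the set.\<close>
  unfolding emit_mux_def by (rule qpt_loop[where X = "{a, 21, 22, 23, 24, 25, 26}"]) auto

lemma qpt_emit_point: "a \<notin> {20..26} \<Longrightarrow> qpt (emit_point a b)"
  unfolding emit_point_def by (rule qpt_seq) (auto intro: qpt_emit_mux qpt_steady[where X = "{}"])

lemma sem_emit_point:
  assumes "a \<notin> {20..26}" "b \<notin> {20..26}" "length (f a) = n" "length (f 22) = t" "f 40 = []"
  shows "sem (emit_point a b) f 20 = rev (concat (map encode_gate (Const (bit_of (f b)) # mux_gates (Suc t) t 0 (f a)))) @ f 20"
    "length (sem (emit_point a b) f 22) = Suc t + 4 * n"
proof -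
  have ne: "a \<noteq> 20" "a \<noteq> 22" "a \<noteq> 23" "a \<noteq> 24" "b \<noteq> 20" "b \<noteq> 22" "b \<noteq> 23" "b \<noteq> 24" using assms(1,2) by auto
  let ?f = "f(23 := f 22, 22 := True # f 22, 24 := [], 20 := bit_of (f b) # False # f 20)"
  have "sem (emit_point a b) f = sem (emit_mux a) ?f"
    using ne assms(5) by (simp add: emit_point_def fun_upd_twist)
  moreover have "sem (emit_mux a) ?f 20 = rev (concat (map encode_gate (mux_gates (Suc t) t 0 (f a)))) @ ?f 20 \<and>
    length (sem (emit_mux a) ?f 22) = Suc t + 4 * length (f a)"
    by (rule sem_emit_mux) (use ne assms in auto)
  ultimately show "sem (emit_point a b) f 20 = rev (concat (map encode_gate (Const (bit_of (f b)) # mux_gates (Suc t) t 0 (f a)))) @ f 20"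
    "length (sem (emit_point a b) f 22) = Suc t + 4 * n" using assms(3) by auto
qed

text \<open>The gate count is \<open>1 + 3 * (4 * n + 1)\<close>. Of the seven constant bits, four
  \<open>True\<close> and a \<open>False\<close> complete it in reversed unary, and the last two
  encode \<open>Const False\<close>, the first gate. Register 22 starts at \<open>n\<close>, the
  wire of that gate.\<close>

definition emit_header :: prog where
  "emit_header = seq [Do (Copy 40 20), emit_unary 0, Do (Copy 0 28), push_each 28 12 20,
     pushes 20 ([True, True, True, True, False, False, False]), Do (Copy 0 22)]"

definition emit_footer :: prog where
  "emit_footer = seq [pushes 20 [True, False], emit_unary 22, Do (Copy 40 27), reverse_onto 20 27]"

text \<open>Register 0 holds the number of inputs in unary, registers 11, 12, 13 the points and registers
  14, 15, 16 their values. The header announces \<open>12 * n + 4\<close> gates.\<close>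

definition emit_table :: prog where
  "emit_table = seq [emit_header, emit_point 11 14, emit_point 12 15, emit_point 13 16, emit_footer]"

lemma emit_header [simp]: "counted emit_header" "written emit_header = {20, 21, 22, 28}"
  by (auto simp: emit_header_def)

lemma emit_footer [simp]: "counted emit_footer" "written emit_footer = {20, 21, 27}"
  by (auto simp: emit_footer_def)

lemma counted_emit_table [simp]: "counted emit_table"
  by (auto simp: emit_table_def)

lemma written_emit_table [simp]: "written emit_table = {11, 12, 13} \<union> {20..28}"
  by (auto simp: emit_table_def)

lemma qpt_emit_table: "qpt emit_table"
proof -
  have "qpt (push_each 28 12 20)" by (rule qpt_steady[where X = "{28}"]) auto
  moreover have "qpt (reverse_onto 20 27)" by (rule qpt_steady[where X = "{20}"]) auto
  moreover have "qpt (emit_unary 0)" "qpt (emit_unary 22)" by (rule qpt_steady[where X = "{0, 21, 22}"]; simp)+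
  ultimately show ?thesis
    unfolding emit_table_def emit_header_def emit_footer_def
    by (intro qpt_seq) (auto simp del: seq.simps intro!: qpt_emit_point qpt_seq)
qed

lemma sem_emit_table:
  assumes "length (f 0) = n" "length (f 11) = n" "length (f 12) = n" "length (f 13) = n" "f 40 = []"
  shows "sem emit_table f 27 =
    encode_circuit (table_circuit n [(f 11, bit_of (f 14)), (f 12, bit_of (f 15)), (f 13, bit_of (f 16))])"
proof -
  define f1 where "f1 = sem emit_header f"
  define f2 where "f2 = sem (emit_point 11 14) f1"
  define f3 where "f3 = sem (emit_point 12 15) f2"
  define f4 where "f4 = sem (emit_point 13 16) f3"
  note defs = f1_def f2_def f3_def f4_def
  let ?m = "Suc (4 * n)"
  have fr1: "f1 r = f r" if "r \<notin> {20, 21, 22, 28}" for r unfolding f1_def by (rule sem_frame) (use that in simp)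
  have fr2: "f2 r = f1 r" if "r \<notin> insert 11 {20..26}" for r unfolding f2_def by (rule sem_frame) (use that in simp)
  have fr3: "f3 r = f2 r" if "r \<notin> insert 12 {20..26}" for r unfolding f3_def by (rule sem_frame) (use that in simp)
  have fr4: "f4 r = f3 r" if "r \<notin> insert 13 {20..26}" for r unfolding f4_def by (rule sem_frame) (use that in simp)
  have h: "f1 20 = rev (unary n @ unary (12 * n + 4) @ [False, False])" "length (f1 22) = n"
  proof -
    have "replicate (12 * n + 4) True = [True, True, True, True] @ replicate (12 * n) True"
      using replicate_add[of 4 "12 * n" True] by (simp add: numeral_eq_Suc add.commute)
    then have "rev (unary (12 * n + 4)) = False # [True, True, True, True] @ replicate (12 * n) True"
      by (simp only: rev_unary)
    then show "f1 20 = rev (unary n @ unary (12 * n + 4) @ [False, False])" "length (f1 22) = n"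
      using assms by (simp_all add: f1_def emit_header_def)
  qed
  have 2: "f2 20 = rev (concat (map encode_gate (Const (bit_of (f 14)) # mux_gates (Suc n) n 0 (f 11)))) @ f1 20"
      "length (f2 22) = n + ?m"
    using sem_emit_point[of 11 14 f1 n n] h assms by (simp_all add: f2_def fr1)
  have 3: "f3 20 = rev (concat (map encode_gate (Const (bit_of (f 15)) # mux_gates (Suc (n + ?m)) (n + ?m) 0 (f 12)))) @ f2 20"
      "length (f3 22) = n + 2 * ?m"
    using sem_emit_point[of 12 15 f2 n "n + ?m"] 2(2) assms by (simp_all add: f3_def fr1 fr2)
  have 4: "f4 20 = rev (concat (map encode_gate (Const (bit_of (f 16)) # mux_gates (Suc (n + 2 * ?m)) (n + 2 * ?m) 0 (f 13)))) @ f3 20"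
      "length (f4 22) = n + 3 * ?m"
    using sem_emit_point[of 13 16 f3 n "n + 2 * ?m"] 3(2) assms by (simp_all add: f4_def fr1 fr2 fr3)
  have num: "3 + k = Suc (Suc (Suc k))" "4 + k = Suc (Suc (Suc (Suc k)))" for k :: nat by simp_all
  have "sem emit_table f 27 = rev (f4 20) @ unary 1 @ unary (length (f4 22))"
    using assms(5) fr4[of 40] fr3[of 40] fr2[of 40] fr1[of 40]
    by (simp add: emit_table_def emit_footer_def flip: defs) (simp add: rev_unary unary_def)
  also have "\<dots> = encode_circuit (table_circuit n [(f 11, bit_of (f 14)), (f 12, bit_of (f 15)), (f 13, bit_of (f 16))])"
    unfolding 4(1) 3(1) 2(1) h(1) 4(2)
    using assms by (simp add: num encode_circuit_def table_circuit_def algebra_simps)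
  finally show ?thesis .
qed

text \<open>The evaluator reads the description of a circuit from register 30 and the input from register 31.
  Register 32 holds the wires in reverse order. Loops over the leading \<open>True\<close>s of register 30 read
  a unary number.\<close>

definition read_unary :: "prog \<Rightarrow> prog" where
  "read_unary c = seq [loop (Top 30) c, Do (Pop 30)]"

lemma written_read_unary [simp]: "written (read_unary c) = insert 30 (written c)"
  by (auto simp: read_unary_def)

lemma unary_Suc: "unary (Suc n) = True # unary n" and unary_0: "unary 0 = [False]"
  by (simp_all add: unary_def)

text \<open>Since \<open>c\<close> commutes with updates of register 30, the pops can be collected
  into a single update after the \<open>n\<close> iterations of \<open>c\<close>.\<close>

lemma sem_read_unary:
  assumes "30 \<notin> written c" "f 30 = unary n @ u" and c: "\<And>f x. sem c (f(30 := x)) = (sem c f)(30 := x)"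
  shows "sem (read_unary c) f = ((sem c ^^ n) f)(30 := u)"
  using assms(2)
proof (induction n arbitrary: f)
  case 0
  then show ?case using assms(1) by (simp add: read_unary_def sem_loop unary_0)
next
  case (Suc n)
  let ?f = "(sem c f)(30 := unary n @ u)"
  have "sem (read_unary c) f = sem (read_unary c) ?f"
    using assms(1) Suc.prems unfolding read_unary_def seq.simps sem.simps(2) by (subst sem_loop) (auto simp: unary_Suc)
  also have "\<dots> = ((sem c ^^ n) ?f)(30 := u)" by (rule Suc.IH) simp
  also have "(sem c ^^ k) (h(30 := x)) = ((sem c ^^ k) h)(30 := x)" for k h x
    by (induction k) (simp_all add: c del: fun_upd_apply)
  finally show ?case by (simp add: funpow_swap1 fun_eq_iff)
qed

definition skip_unary :: prog where
  "skip_unary = read_unary (Do Skip)"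

lemma sem_skip_unary: "f 30 = unary n @ u \<Longrightarrow> sem skip_unary f = f(30 := u)"
proof -
  have "(instr_sem Skip ^^ n) f = f" by (induction n) auto
  then show "f 30 = unary n @ u \<Longrightarrow> sem skip_unary f = f(30 := u)"
    unfolding skip_unary_def by (subst sem_read_unary) auto
qed

lemma written_skip_unary [simp]: "written skip_unary = {30}"
  by (simp add: skip_unary_def)

section \<open>Evaluation of a circuit from its description\<close>

definition load_wires :: prog where
  "load_wires = seq [Do (Copy 32 34), Do (Copy 40 33), reverse_onto 34 33]"

lemma sem_load_wires: "f 40 = [] \<Longrightarrow> sem load_wires f = f(34 := [], 33 := rev (f 32))"
  by (auto simp: load_wires_def fun_eq_iff)

text \<open>Register 33 holds the wires in their original order; popping a copy once for each
  \<open>True\<close> of a unary index \<open>i\<close> brings wire \<open>i\<close> to the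
  front.\<close>

definition lookup :: "nat \<Rightarrow> prog" where
  "lookup a = seq [Do (Copy 33 a), read_unary (Do (Pop a))]"

lemma sem_lookup:
  assumes "a \<noteq> 30" "a \<noteq> 33" "f 30 = unary i @ u"
  shows "sem (lookup a) f = f(a := drop i (f 33), 30 := u)"
proof -
  have "(instr_sem (Pop a) ^^ i) f = f(a := drop i (f a))" for f
    by (induction i) (auto simp: drop_Suc tl_drop)
  then show ?thesis using assms unfolding lookup_def seq.simps sem.simps(1,2)
    by (subst sem_read_unary) (auto simp: fun_upd_twist)
qed

definition eval_gate :: prog where
  "eval_gate = seq [load_wires, Cond (Top 30)
     (seq [Do (Pop 30), lookup 35, lookup 36,
       Cond (Top 35) (Cond (Top 36) (pushes 32 [False]) (pushes 32 [True])) (pushes 32 [True])])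
     (seq [Do (Pop 30), push_top 30 32, Do (Pop 30)])]"

lemma bit_of_drop: "i < length vs \<Longrightarrow> drop i vs \<noteq> [] \<and> hd (drop i vs) = vs ! i"
  by (simp add: hd_drop_conv_nth)

lemma sem_eval_gate:
  assumes "f 40 = []" "f 30 = encode_gate g @ u" "f 32 = rev vs" "gate_ok (length vs) g"
  shows "sem eval_gate f 30 = u \<and> sem eval_gate f 32 = rev (vs @ [gate_value vs g])"
proof (cases g)
  case (Const b)
  with assms show ?thesis by (simp add: eval_gate_def sem_load_wires bit_of_def)
next
  case (Nand i j)
  let ?f = "f(34 := [], 33 := vs, 30 := unary i @ unary j @ u)"
  let ?g = "f(34 := [], 33 := vs, 35 := drop i vs, 30 := unary j @ u)"
  let ?h = "f(34 := [], 33 := vs, 35 := drop i vs, 36 := drop j vs, 30 := u)"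
  have 1: "sem (lookup 35) ?f = ?g"
    by (subst sem_lookup[of _ _ i "unary j @ u"]) (auto simp: fun_eq_iff)
  have 2: "sem (lookup 36) ?g = ?h"
    by (subst sem_lookup[of _ _ j u]) (auto simp: fun_eq_iff)
  have "sem eval_gate f = sem (Cond (Top 35) (Cond (Top 36) (pushes 32 [False]) (pushes 32 [True])) (pushes 32 [True]))
    (sem (lookup 36) (sem (lookup 35) ?f))"
    using assms(1-3) Nand by (simp add: eval_gate_def sem_load_wires)
  then show ?thesis
    unfolding 1 2 using assms(3,4) Nand bit_of_drop[of i vs] bit_of_drop[of j vs] by simp
qed

definition eval_gates :: prog where
  "eval_gates = loop (Nonempty 37) eval_gate"

lemma written_eval_gate [simp]: "written eval_gate = {30, 32, 33, 34, 35, 36}"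
  by (auto simp: eval_gate_def load_wires_def lookup_def)

lemma sem_eval_gates:
  assumes "f 40 = []" "f 30 = concat (map encode_gate gs) @ u" "f 32 = rev vs" "gates_ok (length vs) gs"
    "length (f 37) = length gs"
  shows "sem eval_gates f 30 = u \<and> sem eval_gates f 32 = rev (wires vs gs)"
  using assms
proof (induction gs arbitrary: f vs)
  case Nil
  then show ?case unfolding eval_gates_def by (subst (1 2) sem_loop) auto
next
  case (Cons g gs)
  let ?f = "(sem eval_gate f)(37 := tl (f 37))"
  have step: "sem eval_gate f 30 = concat (map encode_gate gs) @ u" "sem eval_gate f 32 = rev (vs @ [gate_value vs g])"
    using sem_eval_gate[of f g "concat (map encode_gate gs) @ u" vs] Cons.prems by auto
  have "sem eval_gates f = sem eval_gates ?f"
    using Cons.prems unfolding eval_gates_def by (subst sem_loop) auto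
  moreover have "sem eval_gates ?f 30 = u \<and> sem eval_gates ?f 32 = rev (wires (vs @ [gate_value vs g]) gs)"
    using step Cons.prems sem_frame[of 40 eval_gate f] by (intro Cons.IH) auto
  ultimately show ?case by simp
qed

text \<open>The gate count moves to register 37, because the body of the gate loop consumes register
  30. The numbers of inputs and outputs are known and only skipped.\<close>

definition eval_prog :: prog where
  "eval_prog = seq [Do (Copy 40 32), reverse_onto 31 32, skip_unary, Do (Copy 40 37),
     read_unary (pushes 37 [True]), eval_gates, skip_unary, load_wires, lookup 35]"

lemma sem_eval_prog:
  assumes "f 40 = []" "f 30 = encode_circuit C" "f 31 = x" "circuit_io n 1 C" "length x = n"
  shows "bit_of (sem eval_prog f 35) = hd (eval_circuit C x)"
proof -
  obtain w where w: "outputs C = [w]" using assms(4) by (auto simp: circuit_io_def length_Suc_conv)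
  have ok: "gates_ok n (gates C)" and lt: "w < n + length (gates C)" and inp: "inputs C = n"
    using assms(4) by (simp_all add: circuit_io_def gates_ok_iff w)
  let ?gs = "gates C"
  let ?u1 = "unary (length ?gs) @ concat (map encode_gate ?gs) @ unary 1 @ unary w @ []"
  let ?f1 = "f(31 := [], 32 := rev x)"
  let ?f2 = "f(31 := [], 32 := rev x, 30 := ?u1, 37 := [])"
  let ?f3 = "f(31 := [], 32 := rev x, 37 := replicate (length ?gs) True, 30 := concat (map encode_gate ?gs) @ unary 1 @ unary w @ [])"
  define f4 where "f4 = sem eval_gates ?f3"
  have code: "f 30 = unary n @ ?u1" using assms(2) by (simp add: encode_circuit_def w inp)
  have 1: "sem skip_unary ?f1 = ?f1(30 := ?u1)"
    by (rule sem_skip_unary) (use code in simp)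
  have "(sem (pushes 37 [True]) ^^ k) h = h(37 := replicate k True @ h 37)" for k h
    by (induction k) auto
  then have 2: "sem (read_unary (pushes 37 [True])) ?f2 = ?f3"
    by (subst sem_read_unary[of _ _ "length ?gs"]) (auto simp: fun_eq_iff)
  have 4: "f4 30 = unary 1 @ unary w @ []" "f4 32 = rev (wires x ?gs)"
    using sem_eval_gates[of ?f3 ?gs "unary 1 @ unary w @ []" x] assms ok by (simp_all add: f4_def)
  have z: "f4 40 = []" using assms(1) unfolding f4_def eval_gates_def by (subst sem_frame) auto
  have 5: "sem skip_unary f4 = f4(30 := unary w @ [])" by (rule sem_skip_unary) (rule 4)
  have 6: "sem (lookup 35) (f4(30 := unary w @ [], 34 := [], 33 := wires x ?gs)) 35 = drop w (wires x ?gs)"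
    by (subst sem_lookup[of _ _ w "[]"]) auto
  have "sem eval_prog f = sem (lookup 35) (sem load_wires (sem skip_unary (sem eval_gates (sem (read_unary (pushes 37 [True])) ((sem skip_unary ?f1)(37 := []))))))"
    using assms(1,3) sem_frame[of 40 skip_unary ?f1] by (simp add: eval_prog_def)
  also have "\<dots> = sem (lookup 35) (sem load_wires (f4(30 := unary w @ [])))"
    by (simp only: 1 2 5 flip: f4_def)
  also have "sem load_wires (f4(30 := unary w @ [])) = f4(30 := unary w @ [], 34 := [], 33 := wires x ?gs)"
    using z 4(2) by (simp add: sem_load_wires)
  finally have "sem eval_prog f 35 = drop w (wires x ?gs)" by (simp only: 6)
  then show ?thesis using bit_of_drop[of w "wires x ?gs"] lt assms(5)
    by (simp add: bit_of_def eval_circuit_wires w)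
qed

lemma counted_read_unary [simp]: "counted (read_unary c) \<longleftrightarrow> counted c \<and> 30 \<notin> written c"
  by (auto simp: read_unary_def)

lemma counted_load_wires [simp]: "counted load_wires" "written load_wires = {33, 34}"
  by (auto simp: load_wires_def)

lemma counted_lookup [simp]: "a \<noteq> 30 \<Longrightarrow> counted (lookup a)" "written (lookup a) = {a, 30}"
  by (auto simp: lookup_def)

lemma counted_eval_gate [simp]: "counted eval_gate"
  by (simp add: eval_gate_def)

lemma qpt_eval_prog: "qpt eval_prog"
proof -
  have r: "qpt (read_unary c)" if "counted c" "30 \<notin> written c" "steady {30} c" for c
    unfolding read_unary_def using that by (intro qpt_seq) (auto intro!: qpt_loop[where X = "{30}"])
  have "qpt eval_gates" unfolding eval_gates_def
    \<comment> \<open>Registers 30 and 34 control inner loops; register 32 is copied to 34 and gains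
      one wire per gate.\<close>
    by (rule qpt_loop[where X = "{37, 30, 32, 34}"])
      (simp_all add: eval_gate_def load_wires_def lookup_def read_unary_def pushes_def)
  moreover have "qpt (reverse_onto 31 32)" "qpt load_wires"
    by (auto intro: qpt_steady[where X = "{31}"] qpt_steady[where X = "{32, 34}"] simp: load_wires_def)
  moreover have "qpt skip_unary" "qpt (read_unary (pushes 37 [True]))" "qpt (lookup 35)"
    unfolding skip_unary_def lookup_def by (auto intro!: r qpt_seq simp del: seq.simps)
  ultimately show ?thesis unfolding eval_prog_def by (intro qpt_seq) auto
qed

lemma counted_eval_prog [simp]: "counted eval_prog" "written eval_prog = {30..37}"
  by (auto simp: eval_prog_def skip_unary_def eval_gates_def)

definition puncture_prog :: prog where
  "puncture_prog = seq
     [seq [Do (Copy 4 30), Do (Copy 2 31), eval_prog],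
      seq [Do (Copy 35 16), Do (Copy 5 30), Do (Copy 3 31), eval_prog],
      seq [Do (Copy 35 15), Do (Copy 2 13), Do (Copy 3 12), Do (Copy 2 11), Do (Copy 40 14),
        Cond (Top 1) (seq [Do (Copy 1 14), Do (Copy 1 11), Do (Pop 11)]) (Do Skip)],
      emit_table, Do (Copy 27 0)]"

lemma sem_puncture_prog:
  assumes "f 0 = sec_param l" "f 1 = v # y" "length y = l" "f 2 = xB" "length xB = l" "f 3 = xC" "length xC = l"
    "f 4 = encode_circuit \<mu>B" "circuit_io l 1 \<mu>B" "f 5 = encode_circuit \<mu>C" "circuit_io l 1 \<mu>C" "f 40 = []"
  shows "sem puncture_prog f 0 = encode_circuit (gen_puncture point_class l (v # y) xB xC \<mu>B \<mu>C)"
proof -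
  define f1 where "f1 = sem (seq [Do (Copy 4 30), Do (Copy 2 31), eval_prog]) f"
  define f2 where "f2 = sem (seq [Do (Copy 35 16), Do (Copy 5 30), Do (Copy 3 31), eval_prog]) f1"
  define f3 where "f3 = sem (seq [Do (Copy 35 15), Do (Copy 2 13), Do (Copy 3 12), Do (Copy 2 11), Do (Copy 40 14),
        Cond (Top 1) (seq [Do (Copy 1 14), Do (Copy 1 11), Do (Pop 11)]) (Do Skip)]) f2"
  have fr1: "f1 r = f r" if "r \<notin> {30..37}" for r
    unfolding f1_def by (subst sem_frame) (use that in auto)
  have fr2: "f2 r = f r" if "r \<notin> {30..37}" "r \<noteq> 16" for r
    using fr1[OF that(1)] unfolding f2_def by (subst sem_frame) (use that in auto)
  have "bit_of (sem eval_prog (f(30 := f 4, 31 := f 2)) 35) = hd (eval_circuit \<mu>B xB)"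
    by (rule sem_eval_prog) (use assms in auto)
  then have v1: "bit_of (f1 35) = hd (eval_circuit \<mu>B xB)" by (simp add: f1_def)
  have "bit_of (sem eval_prog (f1(16 := f1 35, 30 := f 5, 31 := f 3)) 35) = hd (eval_circuit \<mu>C xC)"
    by (rule sem_eval_prog) (use assms fr1[of 40] in auto)
  then have v2: "bit_of (f2 35) = hd (eval_circuit \<mu>C xC)" by (simp add: f2_def fr1)
  have "f2 16 = (f1(16 := f1 35, 30 := f 5, 31 := f 3)) 16"
    unfolding f2_def seq.simps sem.simps(1,2) instr_sem.simps by (subst sem_frame) (simp_all add: fr1)
  then have "f3 16 = f1 35" by (simp add: f3_def)
  moreover have "f3 0 = sec_param l" "f3 11 = (if v then y else xB)" "f3 12 = xC" "f3 13 = xB"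
    "f3 14 = (if v then v # y else [])" "f3 15 = f2 35" "f3 40 = []"
    using assms by (auto simp: f3_def fr2)
  moreover have "sem emit_table f3 27 = encode_circuit (table_circuit l
      [(f3 11, bit_of (f3 14)), (f3 12, bit_of (f3 15)), (f3 13, bit_of (f3 16))])"
    by (rule sem_emit_table) (use assms calculation in \<open>auto simp: sec_param_def\<close>)
  moreover have "sem puncture_prog f 0 = sem emit_table f3 27"
    unfolding puncture_prog_def seq.simps(2)[of _ "_ # _"] sem.simps(2) f1_def f2_def f3_def by simp
  ultimately show ?thesis using v1 v2
    by (simp add: point_class_def bit_of_def)
qed

lemma puncture_poly_time_point: "puncture_poly_time point_class"
  unfolding puncture_poly_time_def
proof (intro exI[of _ puncture_prog] conjI allI ballI impI)
  have c: "counted puncture_prog" by (auto simp: puncture_prog_def)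
  then show "classical puncture_prog" by (rule counted_classical)
  show "qpt puncture_prog" unfolding puncture_prog_def
    by (intro qpt_seq) (auto simp del: seq.simps intro!: qpt_Cond qpt_seq qpt_eval_prog qpt_emit_table)
  fix l and k xB xC :: bits and \<mu>B \<mu>C :: circuit and z
  assume k: "k \<in> keys point_class l" and
    *: "length xB = inlen point_class l \<and> length xC = inlen point_class l \<and>
     circuit_io (inlen point_class l) (outlen point_class l) \<mu>B \<and> circuit_io (inlen point_class l) (outlen point_class l) \<mu>C"
    and z: "z \<in> set_spmf (run puncture_prog
      (load [sec_param l, k, xB, xC, encode_circuit \<mu>B, encode_circuit \<mu>C] []) vacuum)"
  obtain v y where vy: "k = v # y" "length y = l" using k by (cases k) (auto simp: point_class_def)
  have "sem puncture_prog (creg (load [sec_param l, k, xB, xC, encode_circuit \<mu>B, encode_circuit \<mu>C] [])) 0 =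
    encode_circuit (gen_puncture point_class l k xB xC \<mu>B \<mu>C)"
    unfolding vy(1) by (rule sem_puncture_prog) (use vy * in \<open>auto simp: load_def point_class_def\<close>)
  then show "case z of (s, Q) \<Rightarrow> creg s 0 = encode_circuit (gen_puncture point_class l k xB xC \<mu>B \<mu>C)"
    using z by (auto simp: run_counted[OF c])
qed

lemma generalized_puncturable_point: "generalized_puncturable point_class"
  by (simp add: generalized_puncturable_def keyed_circuit_class_point puncture_correct_point puncture_poly_time_point)

section \<open>The encryption scheme\<close>

definition uniform_bits :: "nat \<Rightarrow> bits pmf" where
  "uniform_bits n = pmf_of_set {x. length x = n}"

lemma finite_bits: "finite {x :: bits. length x = n}"
  using finite_lists_length_eq[of "UNIV :: bool set" n] by simp

lemma set_uniform_bits [simp]: "set_pmf (uniform_bits n) = {x. length x = n}"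
  unfolding uniform_bits_def by (rule set_pmf_of_set[OF _ finite_bits]) (auto intro: Ex_list_of_length)

lemma uniform_bits_0: "uniform_bits 0 = return_pmf []"
  by (simp add: uniform_bits_def pmf_of_set_singleton)

text \<open>The separate bit stands at the end because key generation pushes its bits on a stack,
  where the first toss ends up last.\<close>

lemma uniform_bits_Suc:
  "uniform_bits (Suc n) = bind_pmf (pmf_of_set UNIV) (\<lambda>b. map_pmf (\<lambda>x. x @ [b]) (uniform_bits n))"
proof -
  let ?f = "\<lambda>(b, x :: bits). x @ [b]"
  have ne: "{x :: bits. length x = n} \<noteq> {}" by (auto intro: Ex_list_of_length)
  have img: "?f ` (UNIV \<times> {x. length x = n}) = {x. length x = Suc n}"
  proof (intro equalityI subsetI)
    fix z :: bits assume "z \<in> {x. length x = Suc n}"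
    then have "z = ?f (last z, butlast z)" "(last z, butlast z) \<in> UNIV \<times> {x. length x = n}"
      by (auto intro: append_butlast_last_id[symmetric])
    then show "z \<in> ?f ` (UNIV \<times> {x. length x = n})" by blast
  qed auto
  have "bind_pmf (pmf_of_set UNIV) (\<lambda>b. map_pmf (\<lambda>x. x @ [b]) (uniform_bits n)) =
    map_pmf ?f (pair_pmf (pmf_of_set UNIV) (uniform_bits n))"
    by (simp add: pair_pmf_def map_bind_pmf map_pmf_def bind_assoc_pmf bind_return_pmf)
  also have "pair_pmf (pmf_of_set (UNIV :: bool set)) (uniform_bits n) = pmf_of_set (UNIV \<times> {x. length x = n})"
  proof (rule pmf_eqI)
    fix z :: "bool \<times> bits"
    define L where "L = {x :: bits. length x = n}"
    have "finite L" "L \<noteq> {}" using finite_bits ne by (simp_all add: L_def)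
    then have "pmf (pair_pmf (pmf_of_set UNIV) (pmf_of_set L)) z = pmf (pmf_of_set (UNIV \<times> L)) z"
      by (cases z) (auto simp: pmf_pair pmf_of_set card_cartesian_product split: split_indicator)
    then show "pmf (pair_pmf (pmf_of_set UNIV) (uniform_bits n)) z = pmf (pmf_of_set (UNIV \<times> {x. length x = n})) z"
      by (simp add: uniform_bits_def L_def)
  qed
  also have "map_pmf ?f \<dots> = pmf_of_set (?f ` (UNIV \<times> {x. length x = n}))"
    by (rule map_pmf_of_set_inj) (use ne finite_bits in \<open>auto simp: inj_on_def\<close>)
  finally show ?thesis unfolding img uniform_bits_def ..
qed

definition fresh_plus :: "qsys \<Rightarrow> qsys" where
  "fresh_plus Q = hadamard (nqubits Q) (Q\<lparr>nqubits := Suc (nqubits Q)\<rparr>)"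

text \<open>In a normalized state all amplitudes in which the new qubit is 1 vanish, so the Hadamard
  gate splits the weight of each basis state evenly, however the other qubits are entangled.\<close>

lemma prob_fresh_plus:
  assumes u: "unit_state Q"
  shows "prob_outcome (nqubits Q) True (fresh_plus Q) = 1 / 2"
proof -
  let ?n = "nqubits Q"
  have nq: "nqubits (fresh_plus Q) = Suc ?n" by (simp add: fresh_plus_def hadamard_def)
  have "prob_outcome ?n True (fresh_plus Q) = (\<Sum>S\<in>insert ?n ` Pow {..<?n}. (cmod (amp (fresh_plus Q) S))\<^sup>2)"
    unfolding prob_outcome_def
  proof (rule sum.cong)
    show "{S. S \<subseteq> {..<nqubits (fresh_plus Q)} \<and> (?n \<in> S) = True} = insert ?n ` Pow {..<?n}"
    proof (intro equalityI subsetI)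
      fix S assume "S \<in> {S. S \<subseteq> {..<nqubits (fresh_plus Q)} \<and> (?n \<in> S) = True}"
      then have S: "S \<subseteq> {..<Suc ?n}" "?n \<in> S" by (auto simp: nq)
      have "S - {?n} \<in> Pow {..<?n}" using S(1) by (auto simp: less_Suc_eq)
      moreover have "S = insert ?n (S - {?n})" using S(2) by (simp add: insert_absorb)
      ultimately show "S \<in> insert ?n ` Pow {..<?n}" by blast
    next
      fix S assume "S \<in> insert ?n ` Pow {..<?n}"
      then obtain T where "S = insert ?n T" "T \<subseteq> {..<?n}" by blast
      then show "S \<in> {S. S \<subseteq> {..<nqubits (fresh_plus Q)} \<and> (?n \<in> S) = True}" by (auto simp: nq)
    qed
  qed simp
  also have "\<dots> = (\<Sum>S\<in>Pow {..<?n}. (cmod (amp (fresh_plus Q) (insert ?n S)))\<^sup>2)"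
  proof (subst sum.reindex)
    show "inj_on (insert ?n) (Pow {..<?n})"
    proof (rule inj_on_inverseI[where g = "\<lambda>S. S - {?n}"])
      fix S assume "S \<in> Pow {..<?n}"
      then have "?n \<notin> S" by blast
      then show "insert ?n S - {?n} = S" by simp
    qed
  qed simp
  also have "\<dots> = (\<Sum>S\<in>Pow {..<?n}. (cmod (amp Q S))\<^sup>2 / 2)"
  proof (rule sum.cong)
    fix S assume S: "S \<in> Pow {..<?n}"
    then have "insert ?n S - {?n} = S" by auto
    moreover have "amp Q (insert ?n S) = 0" using u by (simp add: unit_state_def)
    ultimately show "(cmod (amp (fresh_plus Q) (insert ?n S)))\<^sup>2 = (cmod (amp Q S))\<^sup>2 / 2"
      by (simp add: fresh_plus_def hadamard_def norm_divide power_divide)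
  qed simp
  also have "\<dots> = 1 / 2" using u by (simp add: unit_state_def flip: sum_divide_distrib)
  finally show ?thesis .
qed

definition toss :: "bool \<Rightarrow> qsys \<Rightarrow> qsys" where
  "toss b Q = collapse (nqubits Q) b (fresh_plus Q)"

lemma unit_state_toss:
  assumes "unit_state Q"
  shows "unit_state (toss b Q)"
proof -
  have u: "unit_state (fresh_plus Q)"
    unfolding fresh_plus_def by (rule unit_state_hadamard[OF unit_state_new[OF assms]]) simp
  then show ?thesis unfolding toss_def
    using prob_fresh_plus[OF assms] prob_outcome_complement[OF u, of "nqubits Q"]
    by (cases b) (auto intro!: unit_state_collapse)
qed

definition toss_prog :: prog where
  "toss_prog = Seq (Do (New 0)) (Seq (Do (Had 0)) (Do (Measure 0 1)))"

lemma exec_toss_prog: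
  assumes "unit_state Q"
  shows "exec toss_prog ((s, Q), t) =
    map_spmf (\<lambda>b. ((s\<lparr>creg := (creg s)(1 := b # creg s 1)\<rparr>, toss b Q), t + 3)) coin_spmf"
proof -
  have "exec toss_prog ((s, Q), t) =
    map_spmf (\<lambda>b. ((s\<lparr>creg := (creg s)(1 := b # creg s 1)\<rparr>, toss b Q), t + 3))
      (spmf_of_pmf (bernoulli_pmf (prob_outcome (nqubits Q) True (fresh_plus Q))))"
    by (simp add: toss_prog_def toss_def fresh_plus_def pmf.map_comp o_def numeral_3_eq_3)
  then show ?thesis by (simp add: prob_fresh_plus[OF assms] bernoulli_pmf_half_conv_pmf_of_set)
qed

lemma exec_While:
  "exec (While g c) x = (if holds g (fst (fst x))
     then bind_spmf (exec c (fst x, Suc (snd x))) (exec (While g c)) else return_spmf x)"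
proof -
  have "exec (While g c) = while_spmf (\<lambda>(s, t). holds g (fst s)) (\<lambda>(s, t). exec c (s, Suc t))"
    by (auto simp: fun_eq_iff)
  then have "exec (While g c) x = (if (\<lambda>(s, t). holds g (fst s)) x
     then bind_spmf ((\<lambda>(s, t). exec c (s, Suc t)) x) (exec (While g c)) else return_spmf x)"
    by (simp only: while_spmf.simps[of _ _ x])
  then show ?thesis by (simp only: split_def)
qed

definition keygen_loop :: prog where
  "keygen_loop = loop (Nonempty 0) toss_prog"

lemma coin_bind: "bind_spmf coin_spmf f = bind_pmf (pmf_of_set UNIV) f"
  using bind_spmf_of_pmf[of "pmf_of_set UNIV" f] by (simp add: spmf_of_pmf_pmf_of_set)

text \<open>The loop is not classical, so its distribution and running time are derived directly. A
  round takes five ticks: the guard, three quantum instructions and the pop. The last bit of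
  \<open>x\<close> is tossed first, which is the order in which \<open>foldr\<close> applies the
  tosses.\<close>

lemma exec_keygen_loop:
  assumes "unit_state Q"
  shows "exec keygen_loop ((s, Q), t) =
    map_spmf (\<lambda>x. ((s\<lparr>creg := (creg s)(0 := [], 1 := x @ creg s 1)\<rparr>, foldr toss x Q), t + 5 * length (creg s 0)))
      (spmf_of_pmf (uniform_bits (length (creg s 0))))"
  using assms
proof (induction "creg s 0" arbitrary: s Q t)
  case Nil
  then have "(creg s)(0 := [], 1 := [] @ creg s 1) = creg s" by (auto simp: fun_eq_iff)
  moreover have "exec keygen_loop ((s, Q), t) = return_spmf ((s, Q), t)"
    using Nil by (simp add: keygen_loop_def loop_def while_spmf.simps)
  ultimately show ?case by (simp add: uniform_bits_0 del: fun_upd_apply flip: Nil(1))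
next
  case (Cons a w)
  let ?s = "\<lambda>b. s\<lparr>creg := (creg s)(0 := w, 1 := b # creg s 1)\<rparr>"
  have unfold: "exec keygen_loop ((s, Q), t) =
    bind_spmf (exec (Seq toss_prog (Do (Pop 0))) ((s, Q), Suc t)) (exec keygen_loop)"
    using Cons.hyps(2)[symmetric] unfolding keygen_loop_def loop_def
    by (subst exec_While) (simp del: exec.simps)
  have "exec (Seq toss_prog (Do (Pop 0))) ((s, Q), Suc t) = map_spmf (\<lambda>b. ((?s b, toss b Q), t + 5)) coin_spmf"
    using Cons.hyps(2)[symmetric]
    by (simp add: exec_toss_prog[OF Cons.prems] bind_map_spmf map_spmf_conv_bind_spmf o_def fun_upd_twist add.commute)
  then have "exec keygen_loop ((s, Q), t) = bind_spmf coin_spmf (\<lambda>b. exec keygen_loop ((?s b, toss b Q), t + 5))"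
    by (simp add: unfold bind_map_spmf o_def)
  also have "\<dots> = bind_spmf coin_spmf (\<lambda>b. map_spmf
      (\<lambda>x. ((s\<lparr>creg := (creg s)(0 := [], 1 := (x @ [b]) @ creg s 1)\<rparr>, foldr toss (x @ [b]) Q), t + 5 * length (creg s 0)))
      (spmf_of_pmf (uniform_bits (length w))))"
  proof (rule bind_spmf_cong[OF refl])
    fix b
    have "w = creg (?s b) 0" by simp
    from Cons.hyps(1)[OF this unit_state_toss[OF Cons.prems], of b "t + 5"]
    show "exec keygen_loop ((?s b, toss b Q), t + 5) = map_spmf
      (\<lambda>x. ((s\<lparr>creg := (creg s)(0 := [], 1 := (x @ [b]) @ creg s 1)\<rparr>, foldr toss (x @ [b]) Q), t + 5 * length (creg s 0)))
      (spmf_of_pmf (uniform_bits (length w)))"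
      by (simp add: fun_upd_twist add.assoc flip: Cons.hyps(2))
  qed
  also have "\<dots> = map_spmf
      (\<lambda>x. ((s\<lparr>creg := (creg s)(0 := [], 1 := x @ creg s 1)\<rparr>, foldr toss x Q), t + 5 * length (creg s 0)))
      (spmf_of_pmf (uniform_bits (length (creg s 0))))"
    unfolding Cons.hyps(2)[symmetric] list.size(4) add_Suc_right add_0_right uniform_bits_Suc
    by (simp add: map_bind_pmf pmf.map_comp o_def spmf_of_pmf_bind coin_bind)
  finally show ?case .
qed

definition keygen_prog :: prog where
  "keygen_prog = Seq keygen_loop (Do (Copy 1 0))"

lemma qpt_keygen_prog: "qpt keygen_prog"
proof -
  have "runs_within keygen_loop s Q (poly [:0, 5:] N)" if "unit_state Q" "fits N s" for s Q N
    using fitsD(1)[OF that(2), of 0] by (auto simp: runs_within_def exec_keygen_loop[OF that(1)])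
  then have "qpt keygen_loop" unfolding qpt_iff by blast
  then show ?thesis unfolding keygen_prog_def by (intro qpt_Seq qpt_Do)
qed

lemma unit_state_vacuum: "unit_state vacuum"
  by (auto simp: unit_state_def vacuum_def)

lemma keygen_uniform: "keygen keygen_prog l = spmf_of_pmf (uniform_bits l)"
proof -
  define p where "p = spmf_of_pmf (uniform_bits l)"
  let ?s = "load [sec_param l] []"
  have "run keygen_loop ?s vacuum =
    map_spmf (\<lambda>x. (?s\<lparr>creg := (creg ?s)(0 := [], 1 := x)\<rparr>, foldr toss x vacuum)) p"
    unfolding run_def exec_keygen_loop[OF unit_state_vacuum]
    by (simp add: p_def pmf.map_comp o_def load_def sec_param_def)
  then show ?thesis
    by (simp add: keygen_def keygen_prog_def run_Seq run_Do map_spmf_conv_bind_spmf flip: p_def)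
qed

text \<open>For the bit 0 the point may not depend on \<open>x\<close>, because the reduction has to
  send this key before the challenge point is drawn; \<open>sec_param l\<close> is simply an
  available string of length \<open>l\<close>.\<close>

definition plain_key :: "nat \<Rightarrow> bits \<Rightarrow> bool \<Rightarrow> bits" where
  "plain_key l x m = m # (if m then x else sec_param l)"

text \<open>The final copies clear all auxiliary registers, so that the obfuscator starts from
  exactly the memory that \<open>obfuscate\<close> loads, and encryption is obfuscation as a
  distribution.\<close>

definition enc_prep :: prog where
  "enc_prep = seq [Cond (Top 2) (Do Skip) (Do (Copy 0 1)),
     copies 1 [11, 12, 13], copies 40 [14], copies 2 [15, 16], emit_table, Do (Copy 27 1),
     copies 40 ([2, 11, 12, 13, 14, 15, 16] @ [20..<29])]"

lemma sem_enc_prep: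
  assumes "length x = l"
  shows "sem enc_prep (creg (load [sec_param l, x, [m]] qs)) =
    creg (load [sec_param l, encode_circuit (circ point_class l (plain_key l x m))] qs)"
proof -
  let ?f = "creg (load [sec_param l, x, [m]] qs)"
  let ?pre = "seq [Cond (Top 2) (Do Skip) (Do (Copy 0 1)), copies 1 [11, 12, 13], copies 40 [14], copies 2 [15, 16]]"
  define y where "y = (if m then x else sec_param l)"
  define g where "g = sem ?pre ?f"
  have y: "length y = l" using assms by (simp add: y_def sec_param_def)
  have g: "g 0 = sec_param l" "g 11 = y" "g 12 = y" "g 13 = y" "g 14 = []" "g 15 = [m]" "g 16 = [m]" "g 40 = []"
    by (auto simp: g_def sem_copies load_def y_def)
  have fr: "g r = []" if "r \<notin> {0, 1, 2, 11, 12, 13, 14, 15, 16}" for r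
    unfolding g_def by (subst sem_frame) (use that in \<open>auto simp: load_def\<close>)
  have "sem emit_table g 27 = encode_circuit (table_circuit l [(g 11, bit_of (g 14)), (g 12, bit_of (g 15)), (g 13, bit_of (g 16))])"
    by (rule sem_emit_table) (simp_all add: g y, simp add: sec_param_def)
  then have table: "sem emit_table g 27 = encode_circuit (circ point_class l (plain_key l x m))"
    by (simp add: g point_class_def point_circuit_def plain_key_def y_def bit_of_def)
  define h where "h = (sem emit_table g)(1 := sem emit_table g 27)"
  have h40: "h 40 = []" using fr[of 40] by (simp add: h_def sem_frame)
  have "sem enc_prep ?f = sem (copies 40 ([2, 11, 12, 13, 14, 15, 16] @ [20..<29])) h"
    by (simp add: enc_prep_def h_def g_def)
  also have "\<dots> = (\<lambda>k. if k \<in> set ([2, 11, 12, 13, 14, 15, 16] @ [20..<29]) then [] else h k)"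
    by (subst sem_copies) (simp, simp only: h40)
  also have "\<dots> = creg (load [sec_param l, encode_circuit (circ point_class l (plain_key l x m))] qs)"
  proof
    fix k
    consider "k = 0" | "k = 1" | "k \<in> set ([2, 11, 12, 13, 14, 15, 16] @ [20..<29])" |
      "k \<notin> {0, 1}" "k \<notin> set ([2, 11, 12, 13, 14, 15, 16] @ [20..<29])" by blast
    then show "(if k \<in> set ([2, 11, 12, 13, 14, 15, 16] @ [20..<29]) then [] else h k) =
      creg (load [sec_param l, encode_circuit (circ point_class l (plain_key l x m))] qs) k"
    proof cases
      case 1
      then show ?thesis by (simp add: h_def sem_frame g load_def)
    next
      case 2
      then show ?thesis by (simp add: h_def table load_def)
    next
      case 3
      then show ?thesis by (auto simp: load_def)
    next
      case 4
      have "k \<notin> {20..28}" using 4(2) unfolding set_append set_upt by auto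
      with 4 have "h k = g k" by (auto simp: h_def sem_frame)
      also have "\<dots> = []" by (rule fr) (use 4 in auto)
      finally show ?thesis using 4 by (simp add: load_def less_Suc_eq)
    qed
  qed
  finally show ?thesis .
qed

lemma counted_enc_prep: "counted enc_prep"
  by (simp add: enc_prep_def)

lemma qpt_enc_prep: "qpt enc_prep"
  unfolding enc_prep_def by (intro qpt_seq) (auto intro!: qpt_Cond qpt_emit_table)

lemma load_creg_eq: "(load args qs)\<lparr>creg := creg (load args' qs)\<rparr> = load args' qs"
  by (simp add: load_def)

lemma encrypt_eq:
  assumes "length x = l"
  shows "encrypt (Seq enc_prep Obf) l x m Q = obfuscate Obf l (circ point_class l (plain_key l x m)) Q"
  unfolding encrypt_def obfuscate_def run_Seq run_counted[OF counted_enc_prep] sem_enc_prep[OF assms] load_creg_eq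
  by simp

text \<open>Decryption receives the key before the ciphertext, while evaluation expects the
  obfuscated circuit before the point.\<close>

definition dec_prep :: prog where
  "dec_prep = seq [Do (Copy 1 3), Do (Copy 2 1), Do (Copy 3 2), Do (Copy 40 3)]"

definition dec_prog :: "prog \<Rightarrow> prog" where
  "dec_prog Eval = Seq dec_prep (Seq Eval (Do (Copy 1 0)))"

lemma decrypt_eq:
  "decrypt (dec_prog Eval) l x ct Q = map_spmf (\<lambda>((\<rho>, y), Q'). bit_of y) (evaluate Eval l ct x Q)"
proof -
  have c: "counted dec_prep" by (simp add: dec_prep_def)
  have "sem dec_prep (creg (load [sec_param l, x, fst ct] (snd ct))) = creg (load [sec_param l, fst ct, x] (snd ct))"
    by (auto simp: dec_prep_def load_def fun_eq_iff less_Suc_eq numeral_eq_Suc)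
  moreover have "step (Copy 1 0) y = return_spmf ((fst y)\<lparr>creg := (creg (fst y))(0 := creg (fst y) 1)\<rparr>, snd y)" for y
    by (cases y) simp
  ultimately show ?thesis
    unfolding decrypt_def dec_prog_def evaluate_def run_Seq run_counted[OF c]
    by (simp del: step.simps add: load_creg_eq run_Do map_spmf_bind_spmf spmf.map_comp o_def split_def map_spmf_conv_bind_spmf)
qed

lemma qpt_dec_prog: "qpt Eval \<Longrightarrow> qpt (dec_prog Eval)"
  unfolding dec_prog_def dec_prep_def by (intro qpt_Seq qpt_seq) auto

lemma spmf_bind_mono:
  assumes "\<And>x. x \<in> set_spmf p \<Longrightarrow> spmf (f x) a \<le> spmf (g x) b"
  shows "spmf (bind_spmf p f) a \<le> spmf (bind_spmf p g) b"
proof -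
  have "ennreal (spmf (bind_spmf p f) a) \<le> ennreal (spmf (bind_spmf p g) b)"
    unfolding ennreal_spmf_bind
    by (rule nn_integral_mono_AE) (use assms in \<open>auto intro!: ennreal_leI\<close>)
  then show ?thesis by simp
qed

lemma spmf_bind_pmf_ge:
  assumes "\<And>x. x \<in> set_pmf p \<Longrightarrow> c \<le> spmf (f x) a"
  shows "c \<le> spmf (bind_spmf (spmf_of_pmf p) f) a"
proof -
  have "c \<le> (\<integral>x. pmf (f x) (Some a) \<partial>measure_pmf p)"
    by (rule measure_pmf.integral_ge_const)
      (use assms in \<open>auto simp: AE_measure_pmf_iff intro!: measure_pmf.integrable_const_bound[where B = 1] simp: pmf_le_1\<close>)
  then show ?thesis by (simp add: pmf_bind)
qed

lemma plain_key_in: "length x = l \<Longrightarrow> plain_key l x m \<in> keys point_class l"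
  by (simp add: plain_key_def point_class_def sec_param_def)

lemma eval_plain_key: "length x = l \<Longrightarrow> eval_circuit (circ point_class l (plain_key l x m)) x = [m]"
  by (cases m) (simp_all add: plain_key_def point_class_def eval_point_circuit sec_param_def)

text \<open>Both plaintexts are encrypted by circuits of the class. The obfuscator's correctness
  bound therefore holds for each fixed key \<open>x\<close>, and so on average over uniform
  keys.\<close>

lemma ue_correct_scheme:
  assumes "upo_correct point_class Obf Eval"
  shows "ue_correct keygen_prog (Seq enc_prep Obf) (dec_prog Eval)"
proof -
  obtain \<nu> where \<nu>: "negligible \<nu>" and
    corr: "\<And>l k x. k \<in> keys point_class l \<Longrightarrow> length x = inlen point_class l \<Longrightarrow> spmf (do {
          (\<rho>, Q) \<leftarrow> obfuscate Obf l (circ point_class l k) vacuum;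
          ((\<rho>', y), Q') \<leftarrow> evaluate Eval l \<rho> x Q;
          return_spmf (y = eval_circuit (circ point_class l k) x)
        }) True \<ge> 1 - \<nu> l"
    using assms unfolding upo_correct_def by blast
  have "1 - \<nu> l \<le> spmf (do {
       sk \<leftarrow> keygen keygen_prog l;
       (ct, Q) \<leftarrow> encrypt (Seq enc_prep Obf) l sk m vacuum;
       m' \<leftarrow> decrypt (dec_prog Eval) l sk ct Q;
       return_spmf (m' = m)
     }) True" for l m
    unfolding keygen_uniform
  proof (rule spmf_bind_pmf_ge)
    fix x assume "x \<in> set_pmf (uniform_bits l)"
    then have x: "length x = l" by simp
    let ?C = "circ point_class l (plain_key l x m)"
    have "1 - \<nu> l \<le> spmf (do {
          (\<rho>, Q) \<leftarrow> obfuscate Obf l ?C vacuum;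
          ((\<rho>', y), Q') \<leftarrow> evaluate Eval l \<rho> x Q;
          return_spmf (y = eval_circuit ?C x)
        }) True"
      by (rule corr[OF plain_key_in[OF x]]) (simp add: x point_class_def)
    \<comment> \<open>Output exactly \<open>[m]\<close> forces the first output bit to be
      \<open>m\<close>.\<close>
    also have "\<dots> \<le> spmf (do {
          (\<rho>, Q) \<leftarrow> obfuscate Obf l ?C vacuum;
          ((\<rho>', y), Q') \<leftarrow> evaluate Eval l \<rho> x Q;
          return_spmf (bit_of y = m)
        }) True"
      unfolding eval_plain_key[OF x]
      by (intro spmf_bind_mono) (auto simp: split_def bit_of_def intro!: spmf_bind_mono split: split_indicator)
    finally show "1 - \<nu> l \<le> spmf (do {
       (ct, Q) \<leftarrow> encrypt (Seq enc_prep Obf) l x m vacuum;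
       m' \<leftarrow> decrypt (dec_prog Eval) l x ct Q;
       return_spmf (m' = m)
     }) True"
      by (simp add: encrypt_eq[OF x] decrypt_eq bind_map_spmf o_def split_def)
  qed
  with \<nu> show ?thesis unfolding ue_correct_def by blast
qed

section \<open>The reduction\<close>

definition const_true :: "nat \<Rightarrow> circuit" where
  "const_true l = Circuit l [Const True] [l]"

lemma const_true: "circuit_io l 1 (const_true l)" "length x = l \<Longrightarrow> eval_circuit (const_true l) x = [True]"
  by (auto simp: const_true_def circuit_io_def eval_circuit_def nth_append)

text \<open>The six bits in the middle read: one gate, \<open>Const True\<close>, one output. The
  output is wire \<open>l\<close>, the first after the inputs.\<close>

lemma encode_const_true:
  "encode_circuit (const_true l) = unary l @ [True, False, False, True, True, False] @ unary l"
  by (simp add: encode_circuit_def const_true_def unary_def)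

text \<open>An equality of circuits, not just of their functions. The point \<open>x'\<close>
  disappears because the base entry of a zero circuit is moved to the punctured point.\<close>

lemma gen_puncture_plain_key:
  "length x = l \<Longrightarrow>
   gen_puncture point_class l (plain_key l x' False) x x (const_true l) (const_true l) =
   circ point_class l (plain_key l x True)"
  by (simp add: plain_key_def point_class_def point_circuit_def const_true)

definition challenge_bits :: "mem \<Rightarrow> bool \<times> bool" where
  "challenge_bits s = (bit_of (creg s 0), bit_of (creg s 1))"

text \<open>The messages are equal, so that both parties guess 0; the messages are 1, 0, so that the
  guesses are flipped.\<close>

definition flags :: "bool \<times> bool \<Rightarrow> bits" where
  "flags ms = [fst ms = snd ms, fst ms \<and> \<not> snd ms]"

definition push_flags :: "nat \<Rightarrow> prog" where
  "push_flags r = Cond (Top 0)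
     (Cond (Top 1) (pushes r [True, False]) (pushes r [False, True]))
     (Cond (Top 1) (pushes r [False, False]) (pushes r [True, False]))"

lemma push_flags [simp]: "counted (push_flags r)" "qpt (push_flags r)"
  by (auto simp: push_flags_def intro!: qpt_Cond)

lemma sem_push_flags [simp]:
  "sem (push_flags r) f = f(r := rev (flags (bit_of (f 0), bit_of (f 1))) @ f r)"
  by (auto simp: push_flags_def flags_def bit_of_def fun_eq_iff)

text \<open>The adversary's programs mention only registers below \<open>m\<close>. The registers from \<open>m\<close> on keep the
  security parameter, the registers 1 and 2, which must carry the circuits for the challenger, and
  the flags.\<close>

definition reduction_setup :: "nat \<Rightarrow> prog" where
  "reduction_setup m = seq
     [Do (Copy 1 (m + 1)), Do (Copy 2 (m + 2)),
      push_flags (m + 3),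
      Do (Copy m 0), pushes 0 [False],
      Do (Copy (m + 5) 1), pushes 1 [False], Do (Copy m (m + 6)), push_each (m + 6) 1 1,
      pushes 1 [False, True, True, False, False, True, False], Do (Copy m (m + 6)), push_each (m + 6) 1 1,
      Do (Copy 1 2)]"

definition reduction_A1 :: "nat \<Rightarrow> prog \<Rightarrow> prog" where
  "reduction_A1 m A1 = Seq (Do (Copy 0 m)) (Seq A1 (reduction_setup m))"

text \<open>Register 0 was not saved, because receiving the state overwrites it in both games. The
  flags are stored reversed, as \<open>reverse_onto\<close> reverses what it moves; it also empties
  its source, hence the two copies.\<close>

definition reduction_A2 :: "nat \<Rightarrow> prog \<Rightarrow> prog" where
  "reduction_A2 m A2 = Seq (seq [Do (Copy (m + 1) 1), Do (Copy (m + 2) 2)])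
     (Seq A2 (seq [Do (Copy (m + 3) (m + 4)), reverse_onto (m + 4) 0, Do (Copy (m + 3) (m + 4)), reverse_onto (m + 4) 1]))"

definition negate_guess :: prog where
  "negate_guess = Cond (Top 0) (pushes 0 [False]) (pushes 0 [True])"

lemma run_negate_guess: "run negate_guess s Q = return_spmf (s\<lparr>creg := (creg s)(0 := (\<not> bit_of (creg s 0)) # creg s 0)\<rparr>, Q)"
proof -
  have "counted negate_guess" by (simp add: negate_guess_def)
  moreover have "sem negate_guess f = f(0 := (\<not> bit_of (f 0)) # f 0)" for f
    by (cases "bit_of (f 0)") (auto simp: negate_guess_def bit_of_def)
  ultimately show ?thesis by (simp add: run_counted del: fun_upd_apply)
qed

text \<open>The flags head the classical share in register 2. Copying the empty register 3 to
  register 0 yields the guess 0. Otherwise both flags are popped before \<open>B\<close> runs, so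
  that \<open>B\<close> starts from exactly the memory of the cloning game.\<close>

definition reduction_guess :: "prog \<Rightarrow> prog" where
  "reduction_guess B = Cond (Top 2) (Do (Copy 3 0)) (Seq (Do (Pop 2))
     (Cond (Top 2)
       (Seq (Do (Pop 2)) (Seq B negate_guess))
       (Seq (Do (Pop 2)) B)))"

lemma counted_reduction_setup: "3 \<le> m \<Longrightarrow> counted (reduction_setup m)"
  by (simp add: reduction_setup_def)

lemma qpt_push_each: "a \<noteq> b \<Longrightarrow> qpt (push_each a k b)"
  by (rule qpt_steady[where X = "{a}"]) auto

lemma qpt_reverse_onto: "a \<noteq> b \<Longrightarrow> qpt (reverse_onto a b)"
  by (rule qpt_steady[where X = "{a}"]) auto

lemma qpt_reduction:
  assumes "3 \<le> m"
  shows "qpt A1 \<Longrightarrow> qpt (reduction_A1 m A1)" "qpt A2 \<Longrightarrow> qpt (reduction_A2 m A2)" "qpt B \<Longrightarrow> qpt (reduction_guess B)"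
proof -
  have "qpt (reduction_setup m)" unfolding reduction_setup_def using assms
    by (intro qpt_seq) (auto intro!: qpt_push_each)
  then show "qpt A1 \<Longrightarrow> qpt (reduction_A1 m A1)" unfolding reduction_A1_def by (intro qpt_Seq qpt_Do)
  show "qpt A2 \<Longrightarrow> qpt (reduction_A2 m A2)" unfolding reduction_A2_def using assms
    by (intro qpt_Seq qpt_seq) (auto intro!: qpt_reverse_onto)
  show "qpt B \<Longrightarrow> qpt (reduction_guess B)" unfolding reduction_guess_def
    by (intro qpt_Seq qpt_Cond) (auto simp: negate_guess_def intro: qpt_Cond)
qed

definition scratch :: "nat \<Rightarrow> nat \<Rightarrow> mem \<Rightarrow> nat \<Rightarrow> bits" where
  "scratch m l s = (\<lambda>r. if r = m then sec_param l else if r = m + 1 then creg s 1 else if r = m + 2 then creg s 2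
     else if r = m + 3 then rev (flags (challenge_bits s)) else [])"

definition setup_mem :: "nat \<Rightarrow> nat \<Rightarrow> mem \<Rightarrow> mem" where
  "setup_mem m l s = patch m (scratch m l s)
     (s\<lparr>creg := (creg s)(0 := False # sec_param l, 1 := encode_circuit (const_true l), 2 := encode_circuit (const_true l))\<rparr>)"

text \<open>The flags are computed before registers 0 and 1 are overwritten. The code of the
  constant circuit is pushed from back to front; for either \<open>unary l\<close>, a
  \<open>False\<close> is followed by one \<open>True\<close> per element of a copy of the security
  parameter.\<close>

lemma sem_reduction_setup:
  assumes "3 \<le> m"
  shows "sem (reduction_setup m) (creg (patch m (\<lambda>r. if r = m then sec_param l else []) s)) = creg (setup_mem m l s)"
proof -
  have u: "unary l @ xs = replicate l True @ False # xs" for xs by (simp add: unary_def)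
  show ?thesis
    using assms
    by (auto simp: reduction_setup_def setup_mem_def patch_def scratch_def fun_eq_iff challenge_bits_def
        encode_const_true u sec_param_def unary_def)
qed

lemma run_reduction_A1:
  assumes m: "3 \<le> m" "prog_below m A1"
  shows "run (reduction_A1 m A1) (load [sec_param l] []) Q =
    map_spmf (\<lambda>(s, Q'). (setup_mem m l s, Q')) (run A1 (load [sec_param l] []) Q)"
proof -
  let ?h = "\<lambda>r. if r = m then sec_param l else []"
  have "(load [sec_param l] [])\<lparr>creg := (creg (load [sec_param l] []))(m := sec_param l)\<rparr> = patch m ?h (load [sec_param l] [])"
    using m(1) by (auto simp: patch_def load_def fun_eq_iff)
  moreover have "creg (load [sec_param l] []) 0 = sec_param l" by (simp add: load_def)
  ultimately have 1: "step (Copy 0 m) (load [sec_param l] [], Q) = return_spmf (patch m ?h (load [sec_param l] []), Q)"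
    by simp
  have 2: "(patch m ?h s)\<lparr>creg := creg (setup_mem m l s)\<rparr> = setup_mem m l s" for s
    by (simp add: setup_mem_def patch_def)
  show ?thesis
    unfolding reduction_A1_def run_Seq run_Do 1
    by (simp add: run_patch[OF m(2)] bind_map_spmf o_def split_def run_counted[OF counted_reduction_setup[OF m(1)]]
        sem_reduction_setup[OF m(1)] 2 map_spmf_conv_bind_spmf)
qed

definition add_flags :: "bits \<Rightarrow> mem \<Rightarrow> mem" where
  "add_flags fl s = s\<lparr>creg := (creg s)(0 := fl @ creg s 0, 1 := fl @ creg s 1)\<rparr>"

text \<open>Only the registers handed to the two guessing parties are compared, since the final
  memories may differ elsewhere by the hidden data.\<close>

lemma run_reduction_A2:
  assumes m: "3 \<le> m" "prog_below m A2"
  shows "map_spmf (\<lambda>(s', Q'). ((creg s' 0, creg s' 1), (qreg s' 0, qreg s' 1), Q'))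
      (run (reduction_A2 m A2) (receive \<rho> (setup_mem m l s)) Q) =
    map_spmf (\<lambda>(s', Q'). ((flags (challenge_bits s) @ creg s' 0, flags (challenge_bits s) @ creg s' 1), (qreg s' 0, qreg s' 1), Q'))
      (run A2 (receive \<rho> s) Q)"
proof -
  let ?pre = "seq [Do (Copy (m + 1) 1), Do (Copy (m + 2) 2)]"
  let ?post = "seq [Do (Copy (m + 3) (m + 4)), reverse_onto (m + 4) 0, Do (Copy (m + 3) (m + 4)), reverse_onto (m + 4) 1]"
  have c: "counted ?pre" "counted ?post" using m(1) by auto
  have pre: "(receive \<rho> (setup_mem m l s))\<lparr>creg := sem ?pre (creg (receive \<rho> (setup_mem m l s)))\<rparr> =
    patch m (scratch m l s) (receive \<rho> s)"
    using m(1) by (auto simp: receive_def setup_mem_def patch_def scratch_def fun_eq_iff)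
  have post: "sem ?post (creg (patch m (scratch m l s) s')) r = flags (challenge_bits s) @ creg s' r" if "r \<in> {0, 1}" for s' r
    using that m(1) by (auto simp: patch_def scratch_def)
  have q: "qreg (patch m h s') q = qreg s' q" "creg (s'\<lparr>creg := f\<rparr>) = f" "qreg (s'\<lparr>creg := f\<rparr>) = qreg s'" for h s' q f
    by (simp_all add: patch_def)
  show ?thesis
    unfolding reduction_A2_def run_Seq run_counted[OF c(1)] run_counted[OF c(2)]
    by (simp only: return_bind_spmf prod.case pre run_patch[OF m(2)] bind_map_spmf o_def split_def
        map_spmf_conv_bind_spmf fst_conv snd_conv bind_spmf_assoc q post insert_iff simp_thms)
qed

definition guess :: "prog \<Rightarrow> nat \<Rightarrow> bits \<Rightarrow> bits \<Rightarrow> nat list \<Rightarrow> qsys \<Rightarrow> (bool \<times> qsys) spmf" where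
  "guess B l w c qs Q = map_spmf (\<lambda>(s, Q'). (bit_of (creg s 0), Q')) (run B (load [sec_param l, w, c] qs) Q)"

lemma split_guess_eq:
  "split_guess B C l wB wC s Q = do {
     (b, Q') \<leftarrow> guess B l wB (creg s 0) (qreg s 0) Q;
     (c, Q'') \<leftarrow> guess C l wC (creg s 1) (qreg s 1) Q';
     return_spmf (b, c)
   }"
  by (simp add: split_guess_def guess_def bind_map_spmf o_def split_def)

lemma guess_reduction:
  "guess (reduction_guess B) l w (flags ms @ c) qs Q =
    (if fst ms = snd ms then return_spmf (False, Q)
     else if fst ms then map_spmf (\<lambda>(b, Q'). (\<not> b, Q')) (guess B l w c qs Q)
     else guess B l w c qs Q)"
proof -
  have pop: "step (Pop 2) (load [sec_param l, w, a # c] qs, Q) = return_spmf (load [sec_param l, w, c] qs, Q)" for a c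
    by (auto simp: load_def fun_eq_iff less_Suc_eq numeral_2_eq_2)
  have top: "holds (Top 2) (load [sec_param l, w, a # c] qs) = a" for a c
    by (simp add: load_def)
  have copy: "step (Copy 3 0) (load [sec_param l, w, a # c] qs, Q) =
      return_spmf ((load [sec_param l, w, a # c] qs)\<lparr>creg := (creg (load [sec_param l, w, a # c] qs))(0 := [])\<rparr>, Q)" for a c
    by (simp add: load_def)
  show ?thesis
    unfolding guess_def reduction_guess_def run_Cond flags_def append_Cons append_Nil top run_Do copy run_Seq pop
      return_bind_spmf prod.case run_negate_guess
    by (auto simp: bit_of_def map_spmf_conv_bind_spmf split_def)
qed

lemma split_guess_reduction:
  assumes "creg s' 0 = flags ms @ creg s 0" "creg s' 1 = flags ms @ creg s 1" "qreg s' 0 = qreg s 0" "qreg s' 1 = qreg s 1"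
  shows "split_guess (reduction_guess B) (reduction_guess C) l wB wC s' Q =
    (if fst ms = snd ms then return_spmf (False, False)
     else if fst ms then map_spmf (\<lambda>(b, c). (\<not> b, \<not> c)) (split_guess B C l wB wC s Q)
     else split_guess B C l wB wC s Q)"
  unfolding split_guess_eq assms guess_reduction
  by (simp add: map_spmf_conv_bind_spmf split_def)

section \<open>The two games in a common form\<close>

definition play :: "prog \<Rightarrow> prog \<Rightarrow> prog \<Rightarrow> prog \<Rightarrow> nat \<Rightarrow> bits \<Rightarrow> mem \<Rightarrow> qsys \<Rightarrow> bool \<Rightarrow> (bool \<times> bool) spmf" where
  "play Obf A2 B C l x s Q c = do {
     (\<rho>, Q') \<leftarrow> obfuscate Obf l (circ point_class l (plain_key l x c)) Q;
     (s', Q'') \<leftarrow> run A2 (receive \<rho> s) Q';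
     split_guess B C l x x s' Q''
   }"

lemma valid_load: "valid s Q \<Longrightarrow> valid (load args []) Q"
proof -
  assume "valid s Q"
  moreover have "fits (Max (insert 0 (length ` set args))) (load args [])"
    by (auto simp: fits_def load_def)
  moreover have "owns (load args []) Q" by (auto simp: owns_def load_def)
  ultimately show ?thesis unfolding valid_def by blast
qed

lemma valid_load_vacuum: "valid (load args []) vacuum"
proof (rule valid_load)
  show "valid \<lparr>creg = (\<lambda>_. []), qreg = (\<lambda>_. [])\<rparr> vacuum"
    by (auto simp: valid_def owns_def fits_def unit_state_vacuum)
qed

text \<open>The obfuscator starts without qubits, so those in its message were allocated during its
  own run and cannot collide with the ones the adversary already holds.\<close>

lemma valid_receive:
  assumes "valid s Q" "(\<rho>, Q') \<in> set_spmf (obfuscate Obf l C Q)"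
  shows "valid (receive \<rho> s) Q'"
proof -
  obtain so where so: "(so, Q') \<in> set_spmf (run Obf (load [sec_param l, encode_circuit C] []) Q)" and \<rho>: "\<rho> = msg_out 0 so"
    using assms(2) by (auto simp: obfuscate_def)
  have v: "valid (load [sec_param l, encode_circuit C] []) Q"
    using assms(1) by (rule valid_load)
  have vo: "valid so Q'" by (rule valid_run[OF v so])
  have n: "nqubits Q \<le> nqubits Q'" by (rule nqubits_run[OF so])
  have fresh: "set (qreg so 0) \<subseteq> {nqubits Q..<nqubits Q'}"
    using qubits_run[OF so] by (auto simp: qubits_def load_def)
  have old: "set (qreg s q) \<subseteq> {..<nqubits Q}" for q
    using assms(1) unfolding valid_def owns_def by blast
  have dis: "set (qreg so 0) \<inter> set (qreg s q) = {}" for q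
    using fresh old[of q] by fastforce
  have "owns (receive \<rho> s) Q'"
    unfolding owns_def
  proof (intro conjI allI impI)
    fix q
    show "distinct (qreg (receive \<rho> s) q)"
      using assms(1) vo unfolding valid_def owns_def by (simp add: receive_def \<rho> msg_out_def)
    show "set (qreg (receive \<rho> s) q) \<subseteq> {..<nqubits Q'}"
      using fresh old[of q] n by (auto simp: receive_def \<rho> msg_out_def)
  next
    fix q q' :: nat
    assume "q \<noteq> q'"
    moreover have "q \<noteq> q' \<Longrightarrow> set (qreg s q) \<inter> set (qreg s q') = {}"
      using assms(1) unfolding valid_def owns_def by blast
    ultimately show "set (qreg (receive \<rho> s) q) \<inter> set (qreg (receive \<rho> s) q') = {}"
      using dis[of q] dis[of q'] by (auto simp: receive_def \<rho> msg_out_def)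
  qed
  moreover obtain M N where "fits M s" "fits N so" using assms(1) vo by (auto simp: valid_def)
  then have "fits (max M N) (receive \<rho> s)"
    by (auto simp: fits_def receive_def \<rho> msg_out_def le_max_iff_disj)
  ultimately show ?thesis using vo by (auto simp: valid_def)
qed

lemma ue_experiment_eq:
  "ue_experiment keygen_prog (Seq enc_prep Obf) A1 A2 B C l = do {
     x \<leftarrow> spmf_of_pmf (uniform_bits l);
     (s, Q) \<leftarrow> run A1 (load [sec_param l] []) vacuum;
     b \<leftarrow> coin_spmf;
     (bB, bC) \<leftarrow> play Obf A2 B C l x s Q (if b then snd (challenge_bits s) else fst (challenge_bits s));
     return_spmf (bB = b \<and> bC = b)
   }"
  unfolding ue_experiment_def keygen_uniform
proof (rule bind_spmf_cong[OF refl])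
  fix x assume "x \<in> set_spmf (spmf_of_pmf (uniform_bits l))"
  then have "length x = l" by simp
  then show "do {
     (s, Q) \<leftarrow> run A1 (load [sec_param l] []) vacuum;
     let m0 = bit_of (creg s 0);
     let m1 = bit_of (creg s 1);
     b \<leftarrow> coin_spmf;
     (ct, Q') \<leftarrow> encrypt (Seq enc_prep Obf) l x (if b then m1 else m0) Q;
     (s', Q'') \<leftarrow> run A2 (receive ct s) Q';
     (bB, bC) \<leftarrow> split_guess B C l x x s' Q'';
     return_spmf (bB = b \<and> bC = b)
   } = do {
     (s, Q) \<leftarrow> run A1 (load [sec_param l] []) vacuum;
     b \<leftarrow> coin_spmf;
     (bB, bC) \<leftarrow> play Obf A2 B C l x s Q (if b then snd (challenge_bits s) else fst (challenge_bits s));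
     return_spmf (bB = b \<and> bC = b)
   }"
    unfolding challenge_bits_def play_def Let_def fst_conv snd_conv by (simp add: encrypt_eq split_def)
qed

definition reduction_play :: "prog \<Rightarrow> prog \<Rightarrow> prog \<Rightarrow> prog \<Rightarrow> nat \<Rightarrow> bits \<Rightarrow> mem \<Rightarrow> qsys \<Rightarrow> bool \<Rightarrow> (bool \<times> bool) spmf" where
  "reduction_play Obf A2 B C l x s Q c = (let ms = challenge_bits s in
     if fst ms = snd ms then do {
       (\<rho>, Q') \<leftarrow> obfuscate Obf l (circ point_class l (plain_key l x c)) Q;
       (s', Q'') \<leftarrow> run A2 (receive \<rho> s) Q';
       return_spmf (False, False)
     }
     else if fst ms then map_spmf (\<lambda>(b, c). (\<not> b, \<not> c)) (play Obf A2 B C l x s Q c)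
     else play Obf A2 B C l x s Q c)"

lemma run_reduction_A2_split_guess:
  assumes m: "3 \<le> m" "prog_below m A2"
  shows "do {
      (s', Q'') \<leftarrow> run (reduction_A2 m A2) (receive \<rho> (setup_mem m l s)) Q';
      split_guess (reduction_guess B) (reduction_guess C) l x x s' Q''
    } = do {
      (s', Q'') \<leftarrow> run A2 (receive \<rho> s) Q';
      if fst (challenge_bits s) = snd (challenge_bits s) then return_spmf (False, False)
      else if fst (challenge_bits s) then map_spmf (\<lambda>(b, c). (\<not> b, \<not> c)) (split_guess B C l x x s' Q'')
      else split_guess B C l x x s' Q''
    }" (is "?L = ?R")
proof -
  \<comment> \<open>The guesses depend only on the four registers and the joint state that
    \<open>run_reduction_A2\<close> compares.\<close>
  define G where "G = (\<lambda>((c0, c1), (q0, q1), Q''). do {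
     (b, Q1) \<leftarrow> guess (reduction_guess B) l x c0 q0 Q'';
     (c, Q2) \<leftarrow> guess (reduction_guess C) l x c1 q1 Q1;
     return_spmf (b, c) })"
  have "?L = bind_spmf (map_spmf (\<lambda>(s', Q'). ((creg s' 0, creg s' 1), (qreg s' 0, qreg s' 1), Q'))
      (run (reduction_A2 m A2) (receive \<rho> (setup_mem m l s)) Q')) G"
    by (simp add: bind_map_spmf o_def split_def G_def split_guess_eq)
  also have "\<dots> = bind_spmf (map_spmf (\<lambda>(s', Q'). ((flags (challenge_bits s) @ creg s' 0, flags (challenge_bits s) @ creg s' 1), (qreg s' 0, qreg s' 1), Q'))
      (run A2 (receive \<rho> s) Q')) G"
    unfolding run_reduction_A2[OF m] ..
  also have "\<dots> = bind_spmf (run A2 (receive \<rho> s) Q') (\<lambda>(s', Q'').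
      split_guess (reduction_guess B) (reduction_guess C) l x x (add_flags (flags (challenge_bits s)) s') Q'')"
    by (simp add: bind_map_spmf o_def split_def G_def split_guess_eq add_flags_def)
  also have "\<dots> = ?R"
  proof (intro bind_spmf_cong refl, clarify)
    fix s' Q''
    show "split_guess (reduction_guess B) (reduction_guess C) l x x (add_flags (flags (challenge_bits s)) s') Q'' =
      (if fst (challenge_bits s) = snd (challenge_bits s) then return_spmf (False, False)
      else if fst (challenge_bits s) then map_spmf (\<lambda>(b, c). (\<not> b, \<not> c)) (split_guess B C l x x s' Q'')
      else split_guess B C l x x s' Q'')"
      by (rule split_guess_reduction) (simp_all add: add_flags_def)
  qed
  finally show ?thesis .
qed

lemma upo_experiment_eq:
  assumes m: "3 \<le> m" "prog_below m A1" "prog_below m A2"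
  shows "upo_experiment point_class Obf (identical_uniform (inlen point_class))
      (reduction_A1 m A1) (reduction_A2 m A2) (reduction_guess B) (reduction_guess C) l = do {
     b \<leftarrow> coin_spmf;
     (s, Q) \<leftarrow> run A1 (load [sec_param l] []) vacuum;
     x \<leftarrow> spmf_of_pmf (uniform_bits l);
     (bB, bC) \<leftarrow> reduction_play Obf A2 B C l x s Q b;
     return_spmf (bB = b \<and> bC = b)
   }"
proof -
  have unif: "spmf_of_pmf (identical_uniform (inlen point_class) l) = map_spmf (\<lambda>x. (x, x)) (spmf_of_pmf (uniform_bits l))"
    by (simp add: identical_uniform_def uniform_bits_def point_class_def)
  have regs: "creg (setup_mem m l s) 0 = False # sec_param l"
    "creg (setup_mem m l s) 1 = encode_circuit (const_true l)"
    "creg (setup_mem m l s) 2 = encode_circuit (const_true l)" for s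
    using m(1) by (simp_all add: setup_mem_def patch_def)
  have ok: "False # sec_param l \<in> keys point_class l"
    "is_circuit_code (inlen point_class l) (outlen point_class l) (encode_circuit (const_true l))"
    using const_true(1)[of l] by (auto simp: point_class_def sec_param_def is_circuit_code_def)
  have key: "False # sec_param l = plain_key l x False" for x by (simp add: plain_key_def)
  have game: "do {
       (xB, xC) \<leftarrow> spmf_of_pmf (identical_uniform (inlen point_class) l);
       let G = gen_puncture point_class l (False # sec_param l) xB xC (const_true l) (const_true l);
       (\<rho>, Q') \<leftarrow> obfuscate Obf l (if b then G else circ point_class l (False # sec_param l)) Q;
       (s', Q'') \<leftarrow> run (reduction_A2 m A2) (receive \<rho> (setup_mem m l s)) Q';
       (bB, bC) \<leftarrow> split_guess (reduction_guess B) (reduction_guess C) l xB xC s' Q'';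
       return_spmf (bB = b \<and> bC = b)
     } = do {
       x \<leftarrow> spmf_of_pmf (uniform_bits l);
       (bB, bC) \<leftarrow> reduction_play Obf A2 B C l x s Q b;
       return_spmf (bB = b \<and> bC = b)
     }" for b s Q
    unfolding unif bind_map_spmf o_def prod.case
  proof (rule bind_spmf_cong[OF refl])
    fix x assume "x \<in> set_spmf (spmf_of_pmf (uniform_bits l))"
    then have x: "length x = l" by simp
    let ?C = "circ point_class l (plain_key l x b)"
    \<comment> \<open>With literally equal circuits, the challenger's choice is an encryption of the
      bit \<open>b\<close> under the key \<open>x\<close>.\<close>
    have C: "(if b then gen_puncture point_class l (False # sec_param l) x x (const_true l) (const_true l)
      else circ point_class l (False # sec_param l)) = ?C"
      using gen_puncture_plain_key[OF x] key by (cases b) auto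
    have "do {
       let G = gen_puncture point_class l (False # sec_param l) x x (const_true l) (const_true l);
       (\<rho>, Q') \<leftarrow> obfuscate Obf l (if b then G else circ point_class l (False # sec_param l)) Q;
       (s', Q'') \<leftarrow> run (reduction_A2 m A2) (receive \<rho> (setup_mem m l s)) Q';
       (bB, bC) \<leftarrow> split_guess (reduction_guess B) (reduction_guess C) l x x s' Q'';
       return_spmf (bB = b \<and> bC = b)
     } = do {
       (\<rho>, Q') \<leftarrow> obfuscate Obf l ?C Q;
       (bB, bC) \<leftarrow> do {
         (s', Q'') \<leftarrow> run (reduction_A2 m A2) (receive \<rho> (setup_mem m l s)) Q';
         split_guess (reduction_guess B) (reduction_guess C) l x x s' Q''
       };
       return_spmf (bB = b \<and> bC = b)
     }"
      unfolding Let_def C by (simp add: split_def)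
    also have "\<dots> = do {
       (bB, bC) \<leftarrow> reduction_play Obf A2 B C l x s Q b;
       return_spmf (bB = b \<and> bC = b)
     }"
      unfolding run_reduction_A2_split_guess[OF m(1,3)] reduction_play_def play_def Let_def
      by (simp add: split_def map_spmf_bind_spmf bind_map_spmf o_def)
    finally show "do {
       let G = gen_puncture point_class l (False # sec_param l) x x (const_true l) (const_true l);
       (\<rho>, Q') \<leftarrow> obfuscate Obf l (if b then G else circ point_class l (False # sec_param l)) Q;
       (s', Q'') \<leftarrow> run (reduction_A2 m A2) (receive \<rho> (setup_mem m l s)) Q';
       (bB, bC) \<leftarrow> split_guess (reduction_guess B) (reduction_guess C) l x x s' Q'';
       return_spmf (bB = b \<and> bC = b)
     } = do {
       (bB, bC) \<leftarrow> reduction_play Obf A2 B C l x s Q b;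
       return_spmf (bB = b \<and> bC = b)
     }" .
  qed
  show ?thesis
    unfolding upo_experiment_def run_reduction_A1[OF m(1,2)] bind_map_spmf o_def
    by (intro bind_spmf_cong refl, clarify)
      (simp only: prod.case regs Let_def decode_encode_circuit game[unfolded Let_def] ok simp_thms if_True)
qed

section \<open>Comparison of the winning probabilities\<close>

lemma spmf_bind_coin: "spmf (bind_spmf coin_spmf f) a = (spmf (f True) a + spmf (f False) a) / 2"
  unfolding coin_bind by (subst pmf_bind_pmf_of_set) (auto simp: UNIV_bool)

lemma spmf_both_guess: "spmf (bind_spmf p (\<lambda>(x, y). return_spmf (x = b \<and> y = b))) True = spmf p (b, b)"
proof -
  have "bind_spmf p (\<lambda>(x, y). return_spmf (x = b \<and> y = b)) = map_spmf (\<lambda>z. z = (b, b)) p"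
    by (simp add: map_spmf_conv_bind_spmf split_def prod_eq_iff)
  moreover have "(\<lambda>z. z = (b, b)) -` {True} = {(b, b)}" by auto
  ultimately show ?thesis by (simp only: spmf_map) (simp add: spmf_conv_measure_spmf)
qed

lemma spmf_map_Not: "spmf (map_spmf (\<lambda>(x, y). (\<not> x, \<not> y)) p) (b, b) = spmf p (\<not> b, \<not> b)"
proof -
  have "(\<lambda>(x, y). (\<not> x, \<not> y)) -` {(b, b)} = {(\<not> b, \<not> b)}" by auto
  then show ?thesis unfolding spmf_map by (simp add: spmf_conv_measure_spmf)
qed

lemma spmf_two_le: "a \<noteq> b \<Longrightarrow> spmf p a + spmf p b \<le> 1"
proof -
  assume "a \<noteq> b"
  then have "spmf p a + spmf p b = measure (measure_spmf p) ({a} \<union> {b})"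
    unfolding spmf_conv_measure_spmf by (intro measure_spmf.finite_measure_Union[symmetric]) auto
  also have "\<dots> \<le> 1" by (rule measure_spmf.subprob_measure_le_1)
  finally show ?thesis .
qed

lemma lossless_bind_const: "lossless_spmf p \<Longrightarrow> bind_spmf p (\<lambda>_. q) = q"
  by (simp add: bind_spmf_const lossless_spmf_def)

text \<open>The reduction is without loss for every \<open>l\<close>, so a negligible bound carries
  over unchanged. Once the point and the first stage are fixed, each game is an average of two
  probabilities, one for each value of the bit.\<close>

lemma ue_le_upo:
  assumes m: "3 \<le> m" "prog_below m A1" "prog_below m A2" and "qpt Obf" "qpt A2"
  shows "spmf (ue_experiment keygen_prog (Seq enc_prep Obf) A1 A2 B C l) True \<le>
    spmf (upo_experiment point_class Obf (identical_uniform (inlen point_class))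
      (reduction_A1 m A1) (reduction_A2 m A2) (reduction_guess B) (reduction_guess C) l) True"
proof -
  let ?p = "\<lambda>x s Q b. bind_spmf (reduction_play Obf A2 B C l x s Q b) (\<lambda>(bB, bC). return_spmf (bB = b \<and> bC = b))"
  let ?A = "run A1 (load [sec_param l] []) vacuum" and ?U = "spmf_of_pmf (uniform_bits l)"
  have "upo_experiment point_class Obf (identical_uniform (inlen point_class))
      (reduction_A1 m A1) (reduction_A2 m A2) (reduction_guess B) (reduction_guess C) l =
    bind_spmf coin_spmf (\<lambda>b. bind_spmf ?A (\<lambda>sQ. bind_spmf ?U (\<lambda>x. ?p x (fst sQ) (snd sQ) b)))"
    unfolding upo_experiment_eq[OF m] by (simp add: split_def)
  \<comment> \<open>The obfuscation game draws the bit before the first stage and the point after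
    it, the encryption game the other way round. The three samplings are independent, so their order
    can be exchanged.\<close>
  also have "\<dots> = bind_spmf ?A (\<lambda>sQ. bind_spmf coin_spmf (\<lambda>b. bind_spmf ?U (\<lambda>x. ?p x (fst sQ) (snd sQ) b)))"
    by (rule bind_commute_spmf)
  also have "\<dots> = bind_spmf ?A (\<lambda>sQ. bind_spmf ?U (\<lambda>x. bind_spmf coin_spmf (\<lambda>b. ?p x (fst sQ) (snd sQ) b)))"
    by (subst bind_commute_spmf) (rule refl)
  also have "\<dots> = bind_spmf ?U (\<lambda>x. bind_spmf ?A (\<lambda>sQ. bind_spmf coin_spmf (\<lambda>b. ?p x (fst sQ) (snd sQ) b)))"
    by (rule bind_commute_spmf)
  finally have upo: "upo_experiment point_class Obf (identical_uniform (inlen point_class))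
      (reduction_A1 m A1) (reduction_A2 m A2) (reduction_guess B) (reduction_guess C) l =
    bind_spmf ?U (\<lambda>x. bind_spmf ?A (\<lambda>(s, Q). bind_spmf coin_spmf (\<lambda>b. ?p x s Q b)))"
    by (simp add: split_def)
  show ?thesis
    unfolding upo ue_experiment_eq
  proof (intro spmf_bind_mono, clarify)
    fix x s Q
    assume sQ: "(s, Q) \<in> set_spmf ?A"
    have v: "valid s Q" by (rule valid_run[OF valid_load_vacuum sQ])
    let ?W = "play Obf A2 B C l x s Q"
    obtain m0 m1 where ms: "challenge_bits s = (m0, m1)" by fastforce
    \<comment> \<open>Losslessness enters here: the results of the obfuscator and of the cloning
      stage are thrown away, and the constant guesses keep full probability because both terminate
      almost surely.\<close>
    have same: "reduction_play Obf A2 B C l x s Q b = return_spmf (False, False)" if "m0 = m1" for b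
    proof -
      let ?O = "obfuscate Obf l (circ point_class l (plain_key l x b)) Q"
      have "lossless_spmf ?O"
        using qpt_lossless[OF assms(4) valid_load[OF v]] by (simp add: obfuscate_def)
      moreover have "lossless_spmf (run A2 (receive \<rho> s) Q')" if "(\<rho>, Q') \<in> set_spmf ?O" for \<rho> Q'
        by (rule qpt_lossless[OF assms(5) valid_receive[OF v that]])
      ultimately have "lossless_spmf (bind_spmf ?O (\<lambda>(\<rho>, Q'). run A2 (receive \<rho> s) Q'))" by auto
      then have "bind_spmf (bind_spmf ?O (\<lambda>(\<rho>, Q'). run A2 (receive \<rho> s) Q')) (\<lambda>_. return_spmf (False, False)) = return_spmf (False, False)"
        by (rule lossless_bind_const)
      then show ?thesis using that by (simp add: reduction_play_def ms split_def)
    qed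
    show "spmf (bind_spmf coin_spmf (\<lambda>b. bind_spmf (?W (if b then snd (challenge_bits s) else fst (challenge_bits s)))
          (\<lambda>(bB, bC). return_spmf (bB = b \<and> bC = b)))) True
      \<le> spmf (bind_spmf coin_spmf (\<lambda>b. ?p x s Q b)) True"
      unfolding spmf_bind_coin spmf_both_guess ms
    proof (cases "m0 = m1")
      case True
      then show "(spmf (?W (if True then snd (m0, m1) else fst (m0, m1))) (True, True) +
          spmf (?W (if False then snd (m0, m1) else fst (m0, m1))) (False, False)) / 2
        \<le> (spmf (reduction_play Obf A2 B C l x s Q True) (True, True) +
          spmf (reduction_play Obf A2 B C l x s Q False) (False, False)) / 2"
        \<comment> \<open>Both values of the bit lead to the same distribution \<open>?W m0\<close>,
          in which the two winning outcomes exclude each other. The constant guess 0 wins with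
          probability exactly 1/2.\<close>
        using spmf_two_le[of "(True, True)" "(False, False)" "?W m0"] by (simp add: same)
    next
      case False
      then show "(spmf (?W (if True then snd (m0, m1) else fst (m0, m1))) (True, True) +
          spmf (?W (if False then snd (m0, m1) else fst (m0, m1))) (False, False)) / 2
        \<le> (spmf (reduction_play Obf A2 B C l x s Q True) (True, True) +
          spmf (reduction_play Obf A2 B C l x s Q False) (False, False)) / 2"
        \<comment> \<open>For messages 0, 1 the terms agree. For 1, 0 the bit of the obfuscation
          game is the plaintext, the complement of the bit of the cloning game, and flipping the
          guesses exchanges the two terms.\<close>
        by (cases m0) (simp_all add: ms reduction_play_def spmf_map_Not)
    qed
  qed
qed

lemma ue_secure_scheme:
  assumes Obf: "qpt Obf" and sec: "upo_secure point_class Obf (identical_uniform (inlen point_class))"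
  shows "ue_secure keygen_prog (Seq enc_prep Obf)"
  unfolding ue_secure_def
proof (intro allI impI)
  fix A1 A2 B C
  assume *: "qpt A1 \<and> qpt A2 \<and> qpt B \<and> qpt C"
  obtain m1 m2 where "prog_below m1 A1" "prog_below m2 A2" using prog_below_exists by metis
  \<comment> \<open>At least 3, because registers 0 to 2 carry what is sent to the challenger. The
    guessing programs start from freshly loaded memory, so the bound concerns only the two stages of
    the cloner.\<close>
  then have m: "3 \<le> max 3 (max m1 m2)" "prog_below (max 3 (max m1 m2)) A1" "prog_below (max 3 (max m1 m2)) A2"
    by (auto intro: prog_below_mono)
  have "qpt (reduction_A1 (max 3 (max m1 m2)) A1) \<and> qpt (reduction_A2 (max 3 (max m1 m2)) A2) \<and>
    qpt (reduction_guess B) \<and> qpt (reduction_guess C)"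
    using * qpt_reduction[OF m(1)] by blast
  then obtain \<nu> where "negligible \<nu>" and
    "\<And>l. spmf (upo_experiment point_class Obf (identical_uniform (inlen point_class))
      (reduction_A1 (max 3 (max m1 m2)) A1) (reduction_A2 (max 3 (max m1 m2)) A2)
      (reduction_guess B) (reduction_guess C) l) True \<le> 1 / 2 + \<nu> l"
    using sec unfolding upo_secure_def by blast
  then show "\<exists>\<nu>. negligible \<nu> \<and> (\<forall>l. spmf (ue_experiment keygen_prog (Seq enc_prep Obf) A1 A2 B C l) True \<le> 1 / 2 + \<nu> l)"
    using ue_le_upo[OF m Obf] * by (meson order_trans)
qed

text \<open>Needed for the unpredictability of the challenge, a premise of the assumption;
  \<open>point_class\<close> has input length \<open>l\<close>.\<close>

lemma negligible_inverse_exp: "negligible (\<lambda>l. 1 / 2 ^ l)"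
  unfolding negligible_def
proof
  fix c :: nat
  have "(\<lambda>n. real n ^ c / 2 ^ n) \<longlonglongrightarrow> 0"
  proof -
    \<comment> \<open>Written as \<open>exp (ln 2 * n)\<close>, the power \<open>2 ^ n\<close> is
      covered by the growth of the exponential over monomials; the extra factor
      \<open>ln 2 ^ c\<close> is divided out afterwards.\<close>
    have "filterlim (\<lambda>n. ln 2 * real n) at_top sequentially"
      by (rule filterlim_tendsto_pos_mult_at_top[OF tendsto_const _ filterlim_real_sequentially]) simp
    then have "(\<lambda>n. (ln 2 * real n) ^ c / exp (ln 2 * real n)) \<longlonglongrightarrow> 0"
      by (rule filterlim_compose[OF tendsto_power_div_exp_0])
    then have "(\<lambda>n. 1 / ln 2 ^ c * ((ln 2 * real n) ^ c / exp (ln 2 * real n))) \<longlonglongrightarrow> 1 / ln 2 ^ c * 0"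
      by (rule tendsto_mult_left)
    moreover have "exp (ln 2 * real n) = 2 ^ n" for n
      using exp_of_nat_mult[of n "ln 2 :: real"] by (simp add: mult.commute)
    ultimately show ?thesis by (simp add: power_mult_distrib)
  qed
  then have "eventually (\<lambda>n. real n ^ c / 2 ^ n < 1) sequentially"
    by (rule order_tendstoD) simp
  then show "(\<lambda>l. 1 / 2 ^ l :: real) \<in> O(\<lambda>n. 1 / real n ^ c)"
    by (intro bigoI[of _ 1]) (auto elim!: eventually_mono[OF eventually_conj[OF _ eventually_gt_at_top[of 0]]] simp: field_simps)
qed

theorem theorem3:
  assumes "generalized_upo_for_P_poly"
  shows "\<exists>Gen Enc Dec. one_time_unclonable_bit_encryption Gen Enc Dec"
proof -
  have "negligible (\<lambda>l. 1 / 2 ^ inlen point_class l)"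
    using negligible_inverse_exp by (simp add: point_class_def)
  then obtain Obf Eval where upo: "generalized_upo point_class (identical_uniform (inlen point_class)) Obf Eval"
    using assms generalized_puncturable_point unfolding generalized_upo_for_P_poly_def by blast
  then have "one_time_unclonable_bit_encryption keygen_prog (Seq enc_prep Obf) (dec_prog Eval)"
    unfolding one_time_unclonable_bit_encryption_def generalized_upo_def
    by (auto intro: qpt_keygen_prog qpt_Seq qpt_enc_prep qpt_dec_prog ue_correct_scheme ue_secure_scheme)
  then show ?thesis by blast
qed

end
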